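(* Let $\mathbb I\subset R\times\mathbb R$ be an idealistic filtration of r.f.g. type. Then its $\mathfrak R$-saturation coincides with its integral closure: $\mathfrak R(\mathbb I)=\operatorname{IC}(\mathbb I)$.
   Context: $k$ is an algebraically closed field of arbitrary characteristic. $R$ is the coordinate ring of an affine open subset of a variety $W$ smooth over $k$, or its localization by some multiplicative set. Idealistic filtration: for $T\subset R\times\mathbb R$ and $a\in\mathbb R$ write $T_a=\{f\in R:(f,a)\in T\}$. A subset $\mathbb I\subset R\times\mathbb R$ is an idealistic filtration if $\mathbb I_0=R$; each $\mathbb I_a$ is an ideal of $R$; $\mathbb I_a\mathbb I_b\subset\mathbb I_{a+b}$ for all $a,b$; and $\mathbb I_b\supset\mathbb I_a$ whenever $b\le a$. $G(T)$ denotes the smallest idealistic filtration containing $T$. $\mathbb I$ is of r.f.g. type if $\mathbb I=G(T)$ for some finite $T\subset R\times\mathbb Q$. $\mathbb I$ is $\mathfrak R$-saturated if (radical) $(f^n,na)\in\mathbb I$, $f\in R$, $n\in\mathbb Z_{>0}$ imply $(f,a)\in\mathbb I$, and (continuity) $(f,a_l)\in\mathbb I$ for a sequence $a_l\to a$ implies $(f,a)\in\mathbb I$; $\mathfrak R(\mathbb I)$ is the smallest $\mathfrak R$-saturated idealistic filtration containing $\mathbb I$. An element $(f,a)\in R\times\mathbb R$ is integral over $\mathbb I$ if $f^n+c_1f^{n-1}+\cdots+c_n=0$ for some $n\ge1$ and $c_i$ with $(c_i,ia)\in\mathbb I$ for $i=1,\dots,n$. $\mathbb I$ is integrally closed if every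 $(f,a)\in R\times\mathbb R$ integral over $\mathbb I$ belongs to $\mathbb I$; $\operatorname{IC}(\mathbb I)$ is the smallest integrally closed idealistic filtration containing $\mathbb I$. *)

theory Defs
  imports
    "HOL-Algebra.Algebraic_Closure_Type"
    "HOL-Algebra.Generated_Rings"
    "HOL-Library.Function_Algebras"
    "HOL-Library.Extended_Nat"
begin

text \<open>
  Rings are types of class \<^class>\<open>comm_ring_1\<close>. The constant \<^const>\<open>ring_of_type_algebra\<close> turns such
  a type into a HOL-Algebra ring with carrier \<^const>\<open>UNIV\<close>, which gives access to ideals, prime
  ideals, ring homomorphisms and generated subrings.
\<close>

abbreviation is_ideal :: "'r::comm_ring_1 set \<Rightarrow> bool" where
  "is_ideal J \<equiv> ideal J ring_of_type_algebra"

abbreviation is_prime_ideal :: "'r::comm_ring_1 set \<Rightarrow> bool" where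
  "is_prime_ideal J \<equiv> primeideal J ring_of_type_algebra"

abbreviation is_ring_hom :: "('r::comm_ring_1 \<Rightarrow> 's::comm_ring_1) \<Rightarrow> bool" where
  "is_ring_hom h \<equiv> h \<in> ring_hom ring_of_type_algebra ring_of_type_algebra"


section \<open>Coordinate rings of smooth affine varieties and their localizations\<close>

definition krull_dim :: "'a::comm_ring_1 itself \<Rightarrow> enat" where
  "krull_dim _ = Sup {enat n | n. \<exists>P :: nat \<Rightarrow> 'a set.
      (\<forall>i\<le>n. is_prime_ideal (P i)) \<and> (\<forall>i<n. P i \<subset> P (Suc i))}"

text \<open>
  A \<open>k\<close>-algebra \<open>A\<close> is given by its structure homomorphism \<open>\<phi>\<close>. The closed points of \<open>Spec A\<close> are
  the \<open>k\<close>-algebra homomorphisms \<open>A \<rightarrow> k\<close> (\<open>k\<close> is algebraically closed), and the Zariski tangent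
  space at such a point \<open>p\<close> is the space of \<open>k\<close>-derivations of \<open>A\<close> into \<open>k\<close>, where \<open>A\<close> acts on \<open>k\<close>
  through \<open>p\<close>. The \<open>k\<close>-linearity of \<open>D\<close> follows from additivity, the product rule and the vanishing
  on constants.
\<close>

definition k_point :: "('k::field \<Rightarrow> 'a::comm_ring_1) \<Rightarrow> ('a \<Rightarrow> 'k) \<Rightarrow> bool" where
  "k_point \<phi> p \<longleftrightarrow> is_ring_hom p \<and> (\<forall>c. p (\<phi> c) = c)"

definition tangent_space :: "('k::field \<Rightarrow> 'a::comm_ring_1) \<Rightarrow> ('a \<Rightarrow> 'k) \<Rightarrow> ('a \<Rightarrow> 'k) set" where
  "tangent_space \<phi> p = {D. (\<forall>x y. D (x + y) = D x + D y) \<and>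
     (\<forall>x y. D (x * y) = p x * D y + p y * D x) \<and> (\<forall>c. D (\<phi> c) = 0)}"

definition fun_scale :: "'k::field \<Rightarrow> ('a \<Rightarrow> 'k) \<Rightarrow> ('a \<Rightarrow> 'k)" where
  "fun_scale c D = (\<lambda>x. c * D x)"

lemma vector_space_fun_scale: "vector_space (fun_scale :: 'k::field \<Rightarrow> ('a \<Rightarrow> 'k) \<Rightarrow> _)"
  by unfold_locales (auto simp: fun_scale_def algebra_simps)

lemma subspace_tangent_space: "module.subspace fun_scale (tangent_space \<phi> p)"
proof -
  interpret vector_space "fun_scale :: 'a \<Rightarrow> ('b \<Rightarrow> 'a) \<Rightarrow> _" by (rule vector_space_fun_scale)
  show ?thesis
    unfolding subspace_def by (auto simp: tangent_space_def fun_scale_def algebra_simps)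
qed

text \<open>
  The coordinate rings of smooth affine varieties over \<open>k\<close> (and hence of affine open subsets of
  smooth varieties): finitely generated \<open>k\<close>-algebras without zero divisors (\<open>'a\<close> is an \<^class>\<open>idom\<close>)
  such that at every closed point the tangent space has the dimension of the variety.
\<close>

definition smooth_affine_coordinate_ring :: "('k::alg_closed_field \<Rightarrow> 'a::idom) \<Rightarrow> bool" where
  "smooth_affine_coordinate_ring \<phi> \<longleftrightarrow>
     is_ring_hom \<phi> \<and>
     (\<exists>G. finite G \<and> generate_ring ring_of_type_algebra (range \<phi> \<union> G) = UNIV) \<and>
     (\<forall>p. k_point \<phi> p \<longrightarrow>
        enat (vector_space.dim fun_scale (tangent_space \<phi> p)) = krull_dim TYPE('a))"

text \<open>
  \<open>\<iota>\<close> exhibits \<open>'r\<close> as the localization of \<open>'a\<close> by the multiplicative set \<open>S\<close>. The ring \<open>'a\<close> itself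
  is the case \<open>S = {1}\<close>. As \<open>0 \<noteq> 1\<close> holds in \<open>'r\<close>, the set \<open>S\<close> does not contain \<open>0\<close>.
\<close>

definition is_localization :: "'a::comm_ring_1 set \<Rightarrow> ('a \<Rightarrow> 'r::comm_ring_1) \<Rightarrow> bool" where
  "is_localization S \<iota> \<longleftrightarrow>
     submonoid S ring_of_type_algebra \<and>
     is_ring_hom \<iota> \<and>
     (\<forall>s\<in>S. \<iota> s dvd 1) \<and>
     (\<forall>r. \<exists>a. \<exists>s\<in>S. r * \<iota> s = \<iota> a) \<and>
     (\<forall>a. \<iota> a = 0 \<longleftrightarrow> (\<exists>s\<in>S. s * a = 0))"


section \<open>Idealistic filtrations\<close>

definition level :: "('r \<times> real) set \<Rightarrow> real \<Rightarrow> 'r set" where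
  "level T a = {f. (f, a) \<in> T}"

definition idealistic_filtration :: "('r::comm_ring_1 \<times> real) set \<Rightarrow> bool" where
  "idealistic_filtration I \<longleftrightarrow>
     level I 0 = UNIV \<and>
     (\<forall>a. is_ideal (level I a)) \<and>
     (\<forall>a b. \<forall>f\<in>level I a. \<forall>g\<in>level I b. f * g \<in> level I (a + b)) \<and>
     (\<forall>a b. b \<le> a \<longrightarrow> level I a \<subseteq> level I b)"

definition generated_filtration :: "('r::comm_ring_1 \<times> real) set \<Rightarrow> ('r \<times> real) set" where
  "generated_filtration T = idealistic_filtration hull T"

definition rfg_type :: "('r::comm_ring_1 \<times> real) set \<Rightarrow> bool" where
  "rfg_type I \<longleftrightarrow> (\<exists>T. finite T \<and> snd ` T \<subseteq> \<rat> \<and> I = generated_filtration T)"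

definition R_saturated :: "('r::comm_ring_1 \<times> real) set \<Rightarrow> bool" where
  "R_saturated I \<longleftrightarrow>
     (\<forall>f a n. n > 0 \<longrightarrow> (f ^ n, real n * a) \<in> I \<longrightarrow> (f, a) \<in> I) \<and>
     (\<forall>f a (u :: nat \<Rightarrow> real). (\<forall>l. (f, u l) \<in> I) \<longrightarrow> u \<longlonglongrightarrow> a \<longrightarrow> (f, a) \<in> I)"

definition R_saturation :: "('r::comm_ring_1 \<times> real) set \<Rightarrow> ('r \<times> real) set" where
  "R_saturation I = (\<lambda>J. idealistic_filtration J \<and> R_saturated J) hull I"

definition integral_over :: "('r::comm_ring_1 \<times> real) set \<Rightarrow> 'r \<Rightarrow> real \<Rightarrow> bool" where
  "integral_over I f a \<longleftrightarrow>
     (\<exists>n\<ge>1. \<exists>c :: nat \<Rightarrow> 'r. (\<forall>i\<in>{1..n}. (c i, real i * a) \<in> I) \<and>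
        f ^ n + (\<Sum>i=1..n. c i * f ^ (n - i)) = 0)"

definition integrally_closed :: "('r::comm_ring_1 \<times> real) set \<Rightarrow> bool" where
  "integrally_closed I \<longleftrightarrow> (\<forall>f a. integral_over I f a \<longrightarrow> (f, a) \<in> I)"

definition integral_closure :: "('r::comm_ring_1 \<times> real) set \<Rightarrow> ('r \<times> real) set" where
  "integral_closure I = (\<lambda>J. idealistic_filtration J \<and> integrally_closed J) hull I"

text \<open>
  The following lemmas show that the hulls above are indeed the smallest objects of the respective
  kind: they have the required properties themselves, and they are minimal by \<open>hull_minimal\<close>.
\<close>

lemma idealistic_filtration_Inter:
  fixes \<C> :: "('r::comm_ring_1 \<times> real) set set"
  assumes filt: "\<And>J. J \<in> \<C> \<Longrightarrow> idealistic_filtration J"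
  shows "idealistic_filtration (\<Inter>\<C>)"
proof -
  interpret R: ring "ring_of_type_algebra :: 'r ring" by (rule ring_from_type_algebra)
  have lev: "level (\<Inter>\<C>) a = \<Inter>((\<lambda>J. level J a) ` \<C>)" for a
    by (auto simp: level_def)
  have zero: "level J 0 = UNIV" and ideal: "is_ideal (level J a)"
    and mult: "\<And>f g. f \<in> level J a \<Longrightarrow> g \<in> level J b \<Longrightarrow> f * g \<in> level J (a + b)"
    and mono: "b \<le> a \<Longrightarrow> level J a \<subseteq> level J b" if "J \<in> \<C>" for J a b
    using filt[OF that] by (simp_all add: idealistic_filtration_def)
  have "is_ideal (level (\<Inter>\<C>) a)" for a
  proof (cases "\<C> = {}")
    case True
    then show ?thesis
      using R.oneideal by (simp add: level_def ring_of_type_algebra_def)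
  next
    case False
    then have "(\<lambda>J. level J a) ` \<C> \<noteq> {}" by simp
    from R.i_Intersect[OF _ this] show ?thesis
      unfolding lev using ideal by auto
  qed
  moreover have "level (\<Inter>\<C>) 0 = UNIV"
    unfolding lev using zero by simp
  moreover have "f * g \<in> level (\<Inter>\<C>) (a + b)"
    if "f \<in> level (\<Inter>\<C>) a" "g \<in> level (\<Inter>\<C>) b" for f g a b
    using that mult unfolding lev by simp
  moreover have "level (\<Inter>\<C>) a \<subseteq> level (\<Inter>\<C>) b" if "b \<le> a" for a b
    unfolding lev using mono[OF _ that] by (intro INF_mono) auto
  ultimately show ?thesis
    unfolding idealistic_filtration_def by simp
qed

lemma idealistic_filtration_generated: "idealistic_filtration (generated_filtration T)"
  unfolding generated_filtration_def by (rule hull_in, rule idealistic_filtration_Inter) blast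

lemma R_saturated_Inter:
  assumes "\<And>J. J \<in> \<C> \<Longrightarrow> R_saturated J"
  shows "R_saturated (\<Inter>\<C>)"
  unfolding R_saturated_def
proof (intro conjI allI impI InterI)
  fix f a n J assume "(n :: nat) > 0" "(f ^ n, real n * a) \<in> \<Inter>\<C>" "J \<in> \<C>"
  then show "(f, a) \<in> J"
    using assms[of J] unfolding R_saturated_def by (metis InterD)
next
  fix f a J and u :: "nat \<Rightarrow> real"
  assume "\<forall>l. (f, u l) \<in> \<Inter>\<C>" "u \<longlonglongrightarrow> a" "J \<in> \<C>"
  then have "\<forall>l. (f, u l) \<in> J" by blast
  with \<open>u \<longlonglongrightarrow> a\<close> show "(f, a) \<in> J"
    using assms[OF \<open>J \<in> \<C>\<close>] unfolding R_saturated_def by blast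
qed

lemma R_saturation_saturated:
  "idealistic_filtration (R_saturation I) \<and> R_saturated (R_saturation I)"
  unfolding R_saturation_def
  by (rule hull_in, rule conjI, rule idealistic_filtration_Inter, blast, rule R_saturated_Inter, blast)

lemma integrally_closed_Inter:
  assumes "\<And>J. J \<in> \<C> \<Longrightarrow> integrally_closed J"
  shows "integrally_closed (\<Inter>\<C>)"
proof -
  have "integral_over J f a" if "integral_over (\<Inter>\<C>) f a" "J \<in> \<C>" for J f a
  proof -
    from that(1) obtain n c where "n \<ge> 1" "\<forall>i\<in>{1..n}. (c i, real i * a) \<in> \<Inter>\<C>"
      "f ^ n + (\<Sum>i=1..n. c i * f ^ (n - i)) = 0"
      unfolding integral_over_def by (elim exE conjE bexE) blast
    moreover from this(2) that(2) have "\<forall>i\<in>{1..n}. (c i, real i * a) \<in> J" by blast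
    ultimately show ?thesis unfolding integral_over_def by blast
  qed
  then show ?thesis
    using assms unfolding integrally_closed_def by blast
qed

lemma integral_closure_closed:
  "idealistic_filtration (integral_closure I) \<and> integrally_closed (integral_closure I)"
  unfolding integral_closure_def
  by (rule hull_in, rule conjI, rule idealistic_filtration_Inter, blast, rule integrally_closed_Inter, blast)

end

theory Submission
  imports Defs "HOL-Computational_Algebra.Formal_Laurent_Series"
begin

text \<open>
  An \<open>R\<close>-saturated filtration is integrally closed, because an integral equation of level \<open>a\<close> pushes
  the level of \<open>f\<close> towards \<open>a\<close>. Conversely, inside a Laurent series field let \<open>A\<close> be the extended Rees
  algebra of \<open>I\<close>, with \<open>h\<close> the inverse of the variable, and let \<open>W b\<close> be the elements of asymptotic
  \<open>h\<close>-adic order at least \<open>b\<close>. The orders define an \<open>R\<close>-saturated filtration containing \<open>I\<close>, so it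
  suffices that \<open>f\<close> of order at least \<open>a\<close> is integral over \<open>I\<close> at level \<open>a\<close>. For rational \<open>a\<close> this follows
  from the Noetherian property of \<open>A[1 / \<xi>]\<close>, where \<open>\<xi>\<close> is a power of \<open>f\<close> divided by a power of \<open>h\<close>.
  Irrational \<open>a\<close> are never sharp: a Noether normalization adapted to \<open>h\<close> shows that the order of \<open>f\<close>
  is at least some \<open>a' > a\<close>.
\<close>

section \<open>Subrings and spans\<close>

text \<open>The obstacle is continuity. An integral equation at level \<open>a\<close> only sees the
  levels \<open>i * a\<close>, and its form does not survive a limit of levels, so some finiteness
  must show that the integral closure is closed under limits. It comes from the generators: they are
  finitely many with rational levels, so a common denominator \<open>\<delta>\<close> puts them at
  integer indices and makes the Rees algebra a localization of a finitely generated algebra over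
  \<open>k\<close>. The Noetherian property then turns an error of arbitrarily small slope in
  \<open>n\<close> into no error at all, but only where a power of \<open>f\<close> has integer
  order. At an irrational level no power has one, so the level must first be raised to a rational
  one, and a strict gain is needed to make room. Classically the rationality of asymptotic orders
  comes from finitely many Rees valuations; here one algebraic relation between \<open>f\<close> and
  \<open>h\<close> does that work. All rings are subsets of one ambient field and are compared by
  inclusion.\<close>

locale usubring =
  fixes A :: "'a::comm_ring_1 set"
  assumes one_mem [simp, intro]: "1 \<in> A"
    and add_mem [simp, intro]: "x \<in> A \<Longrightarrow> y \<in> A \<Longrightarrow> x + y \<in> A"
    and mult_mem [simp, intro]: "x \<in> A \<Longrightarrow> y \<in> A \<Longrightarrow> x * y \<in> A"
    and uminus_mem [simp, intro]: "x \<in> A \<Longrightarrow> - x \<in> A"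
begin

lemma diff_mem [simp, intro]: "x \<in> A \<Longrightarrow> y \<in> A \<Longrightarrow> x - y \<in> A"
  using add_mem[of x "- y"] by simp

lemma zero_mem [simp, intro]: "0 \<in> A"
  using diff_mem[of 1 1] by simp

lemma power_mem [simp, intro]: "x \<in> A \<Longrightarrow> x ^ n \<in> A"
  by (induction n) auto

lemma sum_mem [intro]: "(\<And>i. i \<in> I \<Longrightarrow> g i \<in> A) \<Longrightarrow> sum g I \<in> A"
  by (induction I rule: infinite_finite_induct) auto

lemma prod_mem [intro]: "(\<And>i. i \<in> I \<Longrightarrow> g i \<in> A) \<Longrightarrow> prod g I \<in> A"
  by (induction I rule: infinite_finite_induct) auto

lemma of_nat_mem [simp, intro]: "of_nat n \<in> A"
  by (induction n) auto

end

inductive_set gen :: "'a::comm_ring_1 set \<Rightarrow> 'a set" for U where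
  gen_base: "x \<in> U \<Longrightarrow> x \<in> gen U"
| gen_one: "1 \<in> gen U"
| gen_add: "x \<in> gen U \<Longrightarrow> y \<in> gen U \<Longrightarrow> x + y \<in> gen U"
| gen_mult: "x \<in> gen U \<Longrightarrow> y \<in> gen U \<Longrightarrow> x * y \<in> gen U"
| gen_uminus: "x \<in> gen U \<Longrightarrow> - x \<in> gen U"

lemma usubring_gen: "usubring (gen U)"
  by unfold_locales (auto intro: gen.intros)

lemma gen_least: "usubring A \<Longrightarrow> U \<subseteq> A \<Longrightarrow> gen U \<subseteq> A"
proof
  fix x assume A: "usubring A" "U \<subseteq> A" and "x \<in> gen U"
  interpret usubring A by fact
  from \<open>x \<in> gen U\<close> show "x \<in> A" using A(2) by induction auto
qed

lemma gen_superset: "U \<subseteq> gen U"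
  by (auto intro: gen_base)

lemma gen_mono: "U \<subseteq> V \<Longrightarrow> gen U \<subseteq> gen V"
  by (intro gen_least usubring_gen) (auto intro: gen_base)

text \<open>For a subring \<open>A\<close> this is the submodule generated by \<open>M\<close>,
  which may be infinite. Adding one scaled generator per step makes rule induction an induction on
  the length of a linear combination.\<close>

inductive_set aspan :: "'a::comm_ring_1 set \<Rightarrow> 'a set \<Rightarrow> 'a set" for A M where
  aspan_zero: "0 \<in> aspan A M"
| aspan_step: "x \<in> aspan A M \<Longrightarrow> a \<in> A \<Longrightarrow> m \<in> M \<Longrightarrow> a * m + x \<in> aspan A M"

lemma aspan_scaled: "a \<in> A \<Longrightarrow> m \<in> M \<Longrightarrow> a * m \<in> aspan A M"
  using aspan_step[OF aspan_zero] by fastforce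

lemma aspan_add: "x \<in> aspan A M \<Longrightarrow> y \<in> aspan A M \<Longrightarrow> x + y \<in> aspan A M"
  by (induction rule: aspan.induct) (auto simp: add.assoc intro: aspan_step)

lemma aspan_mono: "A \<subseteq> B \<Longrightarrow> M \<subseteq> N \<Longrightarrow> aspan A M \<subseteq> aspan B N"
proof
  fix x assume "A \<subseteq> B" "M \<subseteq> N" "x \<in> aspan A M"
  from this(3,1,2) show "x \<in> aspan B N"
    by induction (auto intro: aspan_zero aspan_step)
qed

lemma aspan_sum: "(\<And>i. i \<in> I \<Longrightarrow> g i \<in> aspan A M) \<Longrightarrow> sum g I \<in> aspan A M"
  by (induction I rule: infinite_finite_induct) (auto intro: aspan_zero aspan_add)

context usubring
begin

lemma aspan_base: "m \<in> M \<Longrightarrow> m \<in> aspan A M"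
  using aspan_scaled[of 1 A m M] by simp

lemma aspan_smult: "x \<in> aspan A M \<Longrightarrow> a \<in> A \<Longrightarrow> a * x \<in> aspan A M"
  by (induction rule: aspan.induct)
     (auto simp: distrib_left mult.assoc[symmetric] intro: aspan_zero aspan_step)

lemma aspan_uminus: "x \<in> aspan A M \<Longrightarrow> - x \<in> aspan A M"
  using aspan_smult[of x M "-1"] by auto

lemma aspan_diff: "x \<in> aspan A M \<Longrightarrow> y \<in> aspan A M \<Longrightarrow> x - y \<in> aspan A M"
  using aspan_add[of x A M "- y"] aspan_uminus by simp

lemma aspan_least:
  assumes "M \<subseteq> J" "0 \<in> J" "\<And>x y. x \<in> J \<Longrightarrow> y \<in> J \<Longrightarrow> x + y \<in> J"
    "\<And>a x. a \<in> A \<Longrightarrow> x \<in> J \<Longrightarrow> a * x \<in> J"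
  shows "aspan A M \<subseteq> J"
proof
  fix x assume "x \<in> aspan A M"
  then show "x \<in> J" using assms by induction blast+
qed

lemma aspan_subset: "M \<subseteq> aspan A N \<Longrightarrow> aspan A M \<subseteq> aspan A N"
  by (intro aspan_least) (auto intro: aspan_zero aspan_add aspan_smult)

lemma aspan_subset_self: "M \<subseteq> A \<Longrightarrow> aspan A M \<subseteq> A"
  by (intro aspan_least) auto

lemma aspan_mult:
  assumes "x \<in> aspan A M" "y \<in> aspan A N"
  shows "x * y \<in> aspan A {m * n | m n. m \<in> M \<and> n \<in> N}" (is "_ \<in> ?S")
  using assms(1)
proof induction
  case aspan_zero
  then show ?case by (auto intro: aspan.aspan_zero)
next
  case (aspan_step x a m)
  have "m * y \<in> ?S" using assms(2)
  proof induction
    case aspan_zero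
    then show ?case by (auto intro: aspan.aspan_zero)
  next
    case (aspan_step x b n)
    have "b * (m * n) + m * x \<in> ?S"
      using aspan_step \<open>m \<in> M\<close> by (intro aspan.aspan_step) auto
    then show ?case by (simp add: algebra_simps)
  qed
  then have "a * (m * y) + x * y \<in> ?S"
    using aspan_step by (auto intro!: aspan_add aspan_smult)
  then show ?case by (simp add: algebra_simps)
qed

lemma aspan_sum_rep:
  assumes "x \<in> aspan A M"
  shows "\<exists>F c. finite F \<and> F \<subseteq> M \<and> (\<forall>m\<in>F. c m \<in> A) \<and> x = (\<Sum>m\<in>F. c m * m)"
  using assms
proof induction
  case aspan_zero
  show ?case by (rule exI[of _ "{}"]) auto
next
  case (aspan_step x a m)
  then obtain F c where F: "finite F" "F \<subseteq> M" "\<forall>m\<in>F. c m \<in> A" "x = (\<Sum>m\<in>F. c m * m)" by blast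
  \<comment> \<open>\<open>m\<close> may already occur in \<open>F\<close>, so its new coefficient
    is added to the old one.\<close>
  define c' where "c' = (\<lambda>n. (if n = m then a else 0) + (if n \<in> F then c n else 0))"
  have "(\<Sum>n\<in>insert m F. c' n * n) = (\<Sum>n\<in>insert m F. (if n = m then a * n else 0)) +
      (\<Sum>n\<in>insert m F. (if n \<in> F then c n * n else 0))"
    by (simp add: c'_def distrib_right sum.distrib[symmetric] if_distrib[of "\<lambda>x. x * _"] cong: if_cong)
  also have "(\<Sum>n\<in>insert m F. (if n \<in> F then c n * n else 0)) = x"
    unfolding F(4) using F(1) by (intro sum.mono_neutral_cong_right) auto
  also have "(\<Sum>n\<in>insert m F. (if n = m then a * n else 0)) = a * m"
    using F(1) by simp
  finally have "(\<Sum>n\<in>insert m F. c' n * n) = a * m + x" .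
  then show ?case
    using F aspan_step.hyps
    by (intro exI[of _ "insert m F"] exI[of _ c']) (auto simp: c'_def)
qed

lemma aspan_finite_rep:
  assumes "x \<in> aspan A M" "finite M"
  shows "\<exists>c. (\<forall>m. c m \<in> A) \<and> x = (\<Sum>m\<in>M. c m * m)"
proof -
  from aspan_sum_rep[OF assms(1)] obtain F c where
    F: "finite F" "F \<subseteq> M" "\<forall>m\<in>F. c m \<in> A" "x = (\<Sum>m\<in>F. c m * m)" by blast
  have "(\<Sum>m\<in>M. (if m \<in> F then c m else 0) * m) = x"
    unfolding F(4) using F(1,2) assms(2) by (intro sum.mono_neutral_cong_right) auto
  then show ?thesis using F by (intro exI[of _ "\<lambda>m. if m \<in> F then c m else 0"]) auto
qed

end

section \<open>The ring A[z] and bounds on the degree in z\<close>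

definition adjoin :: "'a::comm_ring_1 set \<Rightarrow> 'a \<Rightarrow> 'a set" where
  "adjoin A z = aspan A (range (\<lambda>i::nat. z ^ i))"

lemma usubring_adjoin:
  assumes "usubring A" shows "usubring (adjoin A z)"
proof -
  interpret usubring A by fact
  show ?thesis
  proof
    show "1 \<in> adjoin A z"
      unfolding adjoin_def by (rule aspan_base, rule range_eqI[of _ _ 0]) simp
  next
    fix x y assume "x \<in> adjoin A z" "y \<in> adjoin A z"
    then have "x * y \<in> aspan A {m * n |m n. m \<in> range (\<lambda>i::nat. z ^ i) \<and> n \<in> range (\<lambda>i::nat. z ^ i)}"
      unfolding adjoin_def by (rule aspan_mult)
    also have "{m * n |m n. m \<in> range (\<lambda>i::nat. z ^ i) \<and> n \<in> range (\<lambda>i::nat. z ^ i)} \<subseteq> range (\<lambda>i::nat. z ^ i)"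
      by (auto simp: power_add[symmetric])
    then have "aspan A {m * n |m n. m \<in> range (\<lambda>i::nat. z ^ i) \<and> n \<in> range (\<lambda>i::nat. z ^ i)} \<subseteq> adjoin A z"
      unfolding adjoin_def by (rule aspan_mono[OF order.refl])
    finally show "x * y \<in> adjoin A z" .
  qed (auto simp: adjoin_def intro: aspan_add aspan_uminus)
qed

lemma adjoin_superset: "A \<subseteq> adjoin A z"
proof
  fix a assume "a \<in> A"
  then have "a * z ^ 0 \<in> adjoin A z" unfolding adjoin_def by (intro aspan_scaled rangeI)
  then show "a \<in> adjoin A z" by simp
qed

lemma adjoin_self: "usubring A \<Longrightarrow> z \<in> adjoin A z"
  unfolding adjoin_def by (rule usubring.aspan_base, assumption, rule range_eqI[of _ _ 1]) simp

lemma adjoin_least: "usubring B \<Longrightarrow> usubring A \<Longrightarrow> A \<subseteq> B \<Longrightarrow> z \<in> B \<Longrightarrow> adjoin A z \<subseteq> B"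
  unfolding adjoin_def
proof -
  assume B: "usubring B" "usubring A" "A \<subseteq> B" "z \<in> B"
  interpret B: usubring B by fact
  interpret A: usubring A by fact
  show "aspan A (range (\<lambda>i::nat. z ^ i)) \<subseteq> B"
    using B by (intro A.aspan_least) auto
qed

lemma gen_insert: "gen (insert z U) = adjoin (gen U) z"
proof
  show "gen (insert z U) \<subseteq> adjoin (gen U) z"
    using adjoin_superset[where A = "gen U" and z = z] adjoin_self[OF usubring_gen, of z U] gen_superset[of U]
    by (intro gen_least usubring_adjoin usubring_gen) auto
  show "adjoin (gen U) z \<subseteq> gen (insert z U)"
    by (intro adjoin_least usubring_gen gen_mono) (auto intro: gen_base)
qed

text \<open>\<open>z\<close> may be algebraic over \<open>A\<close>, so an element has no degree of
  its own; only a bound for some representation is recorded. The strict bound makes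
  \<open>n = 0\<close> the zero module and lets \<open>z ^ n \<in> polys_below A z n\<close> express
  a monic relation of degree \<open>n\<close>.\<close>

definition polys_below :: "'a::comm_ring_1 set \<Rightarrow> 'a \<Rightarrow> nat \<Rightarrow> 'a set" where
  "polys_below A z n = aspan A ((\<lambda>i. z ^ i) ` {..<n})"

lemma polys_below_mono: "m \<le> n \<Longrightarrow> polys_below A z m \<subseteq> polys_below A z n"
  unfolding polys_below_def by (intro aspan_mono) auto

lemma adjoin_polys_below:
  assumes "x \<in> adjoin A z" shows "\<exists>n. x \<in> polys_below A z n"
  using assms unfolding adjoin_def
proof induction
  case aspan_zero
  then show ?case by (auto simp: polys_below_def intro: aspan.aspan_zero)
next
  case (aspan_step x a m)
  then obtain n i where n: "x \<in> polys_below A z n" "m = z ^ i" by blast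
  then have "x \<in> polys_below A z (max n (Suc i))"
    using polys_below_mono[of n "max n (Suc i)"] by auto
  then have "a * m + x \<in> polys_below A z (max n (Suc i))"
    unfolding polys_below_def n(2) using aspan_step by (intro aspan.aspan_step) auto
  then show ?case ..
qed

context usubring
begin

lemma polys_below_Suc:
  assumes "x \<in> polys_below A z (Suc n)"
  shows "\<exists>a\<in>A. \<exists>w\<in>polys_below A z n. x = a * z ^ n + w"
  using assms unfolding polys_below_def
proof induction
  case aspan_zero
  show ?case by (rule bexI[of _ 0], rule bexI[of _ 0]) (auto intro: aspan.aspan_zero)
next
  case (aspan_step x b m)
  then obtain a w where aw: "a \<in> A" "w \<in> aspan A ((^) z ` {..<n})" "x = a * z ^ n + w" by blast
  from aspan_step obtain i where i: "m = z ^ i" "i < Suc n" by auto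
  show ?case
  proof (cases "i = n")
    case True
    then show ?thesis using aw i aspan_step
      by (intro bexI[of _ "b + a"] bexI[of _ w]) (auto simp: algebra_simps)
  next
    case False
    then have "b * m + w \<in> aspan A ((^) z ` {..<n})"
      using aw i aspan_step by (intro aspan.aspan_step) auto
    then show ?thesis using aw
      by (intro bexI[of _ a] bexI[of _ "b * m + w"]) (auto simp: algebra_simps)
  qed
qed

lemma polys_below_mult:
  assumes "x \<in> polys_below A z m" "y \<in> polys_below A z n"
  shows "x * y \<in> polys_below A z (m + n - 1)"
proof -
  have "x * y \<in> aspan A {u * v |u v. u \<in> (^) z ` {..<m} \<and> v \<in> (^) z ` {..<n}}"
    using assms unfolding polys_below_def by (rule aspan_mult)
  also have "\<dots> \<subseteq> polys_below A z (m + n - 1)"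
    unfolding polys_below_def
    by (intro aspan_mono) (auto simp: power_add[symmetric] intro!: imageI)
  finally show ?thesis .
qed

lemma polys_below_rep:
  assumes "x \<in> polys_below A z n"
  shows "\<exists>c. (\<forall>i. c i \<in> A) \<and> x = (\<Sum>i<n. c i * z ^ i)"
  using assms
proof (induction n arbitrary: x)
  case 0
  then have "x = 0" by (simp add: polys_below_def) (erule aspan.cases, auto)
  then show ?case by (intro exI[of _ "\<lambda>_. 0"]) auto
next
  case (Suc n)
  from polys_below_Suc[OF Suc.prems] obtain a w where aw: "a \<in> A" "w \<in> polys_below A z n" "x = a * z ^ n + w"
    by blast
  from Suc.IH[OF aw(2)] obtain c where "\<forall>i. c i \<in> A" "w = (\<Sum>i<n. c i * z ^ i)" by blast
  then show ?case using aw by (intro exI[of _ "c(n := a)"]) (auto simp: algebra_simps)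
qed

end

section \<open>Noetherian subrings\<close>

locale noeth = usubring +
  assumes fin_gen: "J \<subseteq> A \<Longrightarrow> 0 \<in> J \<Longrightarrow> (\<And>x y. x \<in> J \<Longrightarrow> y \<in> J \<Longrightarrow> x + y \<in> J) \<Longrightarrow>
      (\<And>a x. a \<in> A \<Longrightarrow> x \<in> J \<Longrightarrow> a * x \<in> J) \<Longrightarrow> \<exists>F. finite F \<and> F \<subseteq> J \<and> J \<subseteq> aspan A F"

lemma (in noeth) chain_stable:
  fixes J :: "nat \<Rightarrow> 'a set"
  assumes "\<And>n. J n \<subseteq> A" "\<And>n. 0 \<in> J n" "\<And>n x y. x \<in> J n \<Longrightarrow> y \<in> J n \<Longrightarrow> x + y \<in> J n"
    "\<And>n a x. a \<in> A \<Longrightarrow> x \<in> J n \<Longrightarrow> a * x \<in> J n" "\<And>m n. m \<le> n \<Longrightarrow> J m \<subseteq> J n"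
  shows "\<exists>N. (\<Union>n. J n) \<subseteq> J N"
proof -
  let ?U = "\<Union>n. J n"
  have "x + y \<in> ?U" if xy: "x \<in> ?U" "y \<in> ?U" for x y
  proof -
    from xy obtain m n where "x \<in> J m" "y \<in> J n" by auto
    then have "x \<in> J (max m n)" "y \<in> J (max m n)"
      using assms(5)[of m "max m n"] assms(5)[of n "max m n"] by auto
    then show ?thesis using assms(3) by auto
  qed
  note Uadd = this
  have "\<exists>F. finite F \<and> F \<subseteq> ?U \<and> ?U \<subseteq> aspan A F"
  proof (rule fin_gen)
    show "?U \<subseteq> A" "0 \<in> ?U" using assms(1,2) by auto
    show "a * x \<in> ?U" if "a \<in> A" "x \<in> ?U" for a x using that assms(4) by auto
  qed (fact Uadd)
  then obtain F where F: "finite F" "F \<subseteq> ?U" "?U \<subseteq> aspan A F" by blast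
  have "\<exists>N. F \<subseteq> J N" using F(1,2)
  proof (induction F rule: finite_induct)
    case (insert x F)
    then obtain m n where "F \<subseteq> J m" "x \<in> J n" by auto
    then have "insert x F \<subseteq> J (max m n)"
      using assms(5)[of m "max m n"] assms(5)[of n "max m n"] by auto
    then show ?case ..
  qed auto
  then obtain N where "F \<subseteq> J N" ..
  then have "aspan A F \<subseteq> J N"
    using assms(2-4) by (intro aspan_least) auto
  then show ?thesis using F(3) by blast
qed

text \<open>The classical argument through the ideals of leading coefficients.\<close>

theorem Hilbert_basis:
  fixes A :: "'a::comm_ring_1 set"
  assumes "noeth A"
  shows "noeth (adjoin A z)"
proof -
  interpret noeth A by fact
  interpret Az: usubring "adjoin A z" by (rule usubring_adjoin) unfold_locales
  show ?thesis
  proof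
    fix J
    assume J: "J \<subseteq> adjoin A z" "0 \<in> J" "\<And>x y. x \<in> J \<Longrightarrow> y \<in> J \<Longrightarrow> x + y \<in> J"
      "\<And>a x. a \<in> adjoin A z \<Longrightarrow> x \<in> J \<Longrightarrow> a * x \<in> J"
    have sub: "A \<subseteq> adjoin A z" by (rule adjoin_superset)
    have z: "z \<in> adjoin A z" by (rule adjoin_self) unfold_locales
    \<comment> \<open>\<open>L m\<close> holds the coefficients of \<open>z ^ m\<close> in
      representations, of degree at most \<open>m\<close>, of elements of \<open>J\<close>. It
      includes 0, and one element may contribute several coefficients.\<close>
    define L where "L m = {a \<in> A. \<exists>w\<in>polys_below A z m. a * z ^ m + w \<in> J}" for m
    have pb_add: "u + v \<in> polys_below A z m" if "u \<in> polys_below A z m" "v \<in> polys_below A z m" for u v m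
      using that unfolding polys_below_def by (rule aspan_add)
    have pb_smult: "a * v \<in> polys_below A z m" if "a \<in> A" "v \<in> polys_below A z m" for a v m
      using that unfolding polys_below_def by (intro aspan_smult)
    have pb_zero: "0 \<in> polys_below A z m" for m
      unfolding polys_below_def by (rule aspan_zero)
    have pb_shift: "z ^ k * v \<in> polys_below A z (m + k)" if "v \<in> polys_below A z m" for k v m
    proof -
      have "z ^ k \<in> polys_below A z (Suc k)"
        unfolding polys_below_def by (intro aspan_base) auto
      from polys_below_mult[OF this that] show ?thesis by (simp add: add.commute)
    qed
    have L0: "0 \<in> L m" for m
      unfolding L_def using pb_zero J(2) by auto
    have Ladd: "a + b \<in> L m" if "a \<in> L m" "b \<in> L m" for a b m
    proof -
      from that obtain u v where "a \<in> A" "b \<in> A" "u \<in> polys_below A z m" "v \<in> polys_below A z m"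
        "a * z ^ m + u \<in> J" "b * z ^ m + v \<in> J" unfolding L_def by blast
      moreover from this J(3)[OF this(5,6)] have "(a + b) * z ^ m + (u + v) \<in> J"
        by (simp add: algebra_simps)
      ultimately show ?thesis unfolding L_def using pb_add by blast
    qed
    have Lmult: "c * a \<in> L m" if "c \<in> A" "a \<in> L m" for a c m
    proof -
      from that obtain u where "a \<in> A" "u \<in> polys_below A z m" "a * z ^ m + u \<in> J" unfolding L_def by blast
      moreover from this J(4)[of c, OF _ this(3)] that sub have "(c * a) * z ^ m + c * u \<in> J"
        by (auto simp: algebra_simps)
      ultimately show ?thesis unfolding L_def using pb_smult that by blast
    qed
    have LSuc: "L m \<subseteq> L (Suc m)" for m
    proof
      fix a assume "a \<in> L m"
      then obtain u where "a \<in> A" "u \<in> polys_below A z m" "a * z ^ m + u \<in> J" unfolding L_def by blast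
      moreover from this J(4)[OF z this(3)] have "a * z ^ Suc m + z * u \<in> J"
        by (simp add: algebra_simps)
      moreover have "z * u \<in> polys_below A z (Suc m)"
        using pb_shift[OF calculation(2), of 1] by simp
      ultimately show "a \<in> L (Suc m)" unfolding L_def by blast
    qed
    have Lmono: "L m \<subseteq> L n" if "m \<le> n" for m n
      using LSuc that by (rule lift_Suc_mono_le)
    have "\<exists>D. (\<Union>n. L n) \<subseteq> L D"
    proof (rule chain_stable)
      show "L n \<subseteq> A" for n unfolding L_def by auto
    qed (fact L0 Ladd Lmult Lmono)+
    then obtain D where "(\<Union>n. L n) \<subseteq> L D" ..
    then have D: "L n \<subseteq> L D" for n by auto
    have "\<exists>F. finite F \<and> F \<subseteq> L m \<and> L m \<subseteq> aspan A F" for m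
      using L0 Ladd Lmult by (intro fin_gen) (auto simp: L_def)
    then obtain F where F: "\<And>m. finite (F m)" "\<And>m. F m \<subseteq> L m" "\<And>m. L m \<subseteq> aspan A (F m)"
      by metis
    have "\<forall>m. \<forall>b\<in>F m. \<exists>w\<in>polys_below A z m. b * z ^ m + w \<in> J"
      using F(2) unfolding L_def by blast
    then obtain w where w: "\<And>m b. b \<in> F m \<Longrightarrow> w m b \<in> polys_below A z m"
      "\<And>m b. b \<in> F m \<Longrightarrow> b * z ^ m + w m b \<in> J" by metis
    define G where "G = (\<Union>m\<in>{..D}. (\<lambda>b. b * z ^ m + w m b) ` F m)"
    have "finite G" unfolding G_def using F(1) by auto
    moreover have GJ: "G \<subseteq> J" unfolding G_def using w(2) by auto
    moreover have "v \<in> aspan (adjoin A z) G" if "v \<in> polys_below A z m" "v \<in> J" for v m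
      using that
    proof (induction m arbitrary: v)
      case 0
      then have "v = 0" by (simp add: polys_below_def) (erule aspan.cases, auto)
      then show ?case by (simp add: aspan_zero)
    next
      case (Suc m)
      from polys_below_Suc[OF Suc.prems(1)] obtain a u where
        au: "a \<in> A" "u \<in> polys_below A z m" "v = a * z ^ m + u" by blast
      \<comment> \<open>From \<open>D\<close> on the ideals \<open>L m\<close> no longer grow, so
        generators found in degree \<open>D\<close>, times a power of \<open>z\<close>, serve for
        every larger degree.\<close>
      define m' where "m' = min m D"
      have m': "m' \<le> m" "m' \<le> D" "L m \<subseteq> L m'" using D[of m] by (auto simp: m'_def min_def)
      from au Suc.prems(2) have "a \<in> L m" unfolding L_def by blast
      with m'(3) F(3)[of m'] have "a \<in> aspan A (F m')" by blast
      from aspan_finite_rep[OF this F(1)] obtain c where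
        c: "\<And>b. c b \<in> A" "a = (\<Sum>b\<in>F m'. c b * b)" by blast
      \<comment> \<open>\<open>e\<close> lies in the span of \<open>G\<close> and has the
        coefficient \<open>a\<close> of \<open>v\<close> at \<open>z ^ m\<close>, so
        \<open>v - e\<close> has a smaller degree bound.\<close>
      define e where "e = z ^ (m - m') * (\<Sum>b\<in>F m'. c b * (b * z ^ m' + w m' b))"
      have zpow: "z ^ (m - m') * z ^ m' = z ^ m" using m'(1) by (simp add: power_add[symmetric])
      have "e \<in> aspan (adjoin A z) G"
        unfolding e_def
      proof (intro Az.aspan_smult aspan_sum)
        fix b assume "b \<in> F m'"
        then show "b * z ^ m' + w m' b \<in> aspan (adjoin A z) G"
          using m'(2) by (intro Az.aspan_base) (auto simp: G_def)
      qed (use c sub z in auto)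
      moreover have "v - e \<in> aspan (adjoin A z) G"
      proof (rule Suc.IH)
        have "e = (\<Sum>b\<in>F m'. c b * b) * (z ^ (m - m') * z ^ m') + z ^ (m - m') * (\<Sum>b\<in>F m'. c b * w m' b)"
          by (simp add: e_def algebra_simps sum_distrib_left sum_distrib_right sum.distrib)
        then have e: "e = a * z ^ m + z ^ (m - m') * (\<Sum>b\<in>F m'. c b * w m' b)"
          unfolding zpow c(2) .
        have "(\<Sum>b\<in>F m'. c b * w m' b) \<in> polys_below A z m'"
          unfolding polys_below_def
          by (intro aspan_sum aspan_smult) (use c w(1) in \<open>auto simp: polys_below_def\<close>)
        from pb_shift[OF this, of "m - m'"] m'(1)
        have "z ^ (m - m') * (\<Sum>b\<in>F m'. c b * w m' b) \<in> polys_below A z m" by simp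
        with au(2) show "v - e \<in> polys_below A z m"
          unfolding e au(3) polys_below_def by (auto intro: aspan_diff)
        have "e \<in> aspan (adjoin A z) J" 
          using \<open>e \<in> aspan (adjoin A z) G\<close> aspan_mono[OF order.refl GJ] by blast
        then have "e \<in> J" using Az.aspan_least[of J J] J by blast
        then show "v - e \<in> J" using J(3)[OF Suc.prems(2) J(4)[of "-1" e]] by simp
      qed
      ultimately have "e + (v - e) \<in> aspan (adjoin A z) G" by (rule aspan_add)
      then show ?case by simp
    qed
    then have "J \<subseteq> aspan (adjoin A z) G" using J(1) adjoin_polys_below by blast
    ultimately show "\<exists>F. finite F \<and> F \<subseteq> J \<and> J \<subseteq> aspan (adjoin A z) F" by blast
  qed
qed

text \<open>A field has only two ideals, and each element of \<open>F\<close> costs one application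
  of \<open>Hilbert_basis\<close>.\<close>

lemma noeth_gen_field:
  fixes k :: "'a::field set"
  assumes "usubring k" "\<And>x. x \<in> k \<Longrightarrow> inverse x \<in> k" "finite F"
  shows "noeth (gen (k \<union> F))"
  using assms(3)
proof induction
  case empty
  interpret usubring k by fact
  have gk: "gen k = k" using gen_least[OF assms(1), of k] gen_superset[of k] by blast
  show ?case unfolding Un_empty_right gk
  proof
    fix J assume J: "J \<subseteq> k" "0 \<in> J" "\<And>x y. x \<in> J \<Longrightarrow> y \<in> J \<Longrightarrow> x + y \<in> J"
      "\<And>a x. a \<in> k \<Longrightarrow> x \<in> J \<Longrightarrow> a * x \<in> J"
    show "\<exists>F. finite F \<and> F \<subseteq> J \<and> J \<subseteq> aspan k F"
    proof (cases "J \<subseteq> {0}")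
      case True
      then show ?thesis by (intro exI[of _ "{}"]) (auto intro: aspan_zero)
    next
      case False
      then obtain x where x: "x \<in> J" "x \<noteq> 0" by auto
      have "y \<in> aspan k {x}" if "y \<in> J" for y
      proof -
        have "(y * inverse x) * x \<in> aspan k {x}"
          using assms(2)[of x] x that J(1) by (intro aspan_scaled) auto
        then show ?thesis using x by (simp add: mult.assoc)
      qed
      then show ?thesis using x by (intro exI[of _ "{x}"]) auto
    qed
  qed
next
  case (insert z F)
  then show ?case using Hilbert_basis[of "gen (k \<union> F)" z] gen_insert[of z "k \<union> F"] by simp
qed

section \<open>Localization inside a field\<close>

definition loc :: "'a::comm_ring_1 set \<Rightarrow> 'a set \<Rightarrow> 'a set" where
  "loc S A = {w. \<exists>s\<in>S. s * w \<in> A}"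

locale mult_subset = usubring A for A :: "'a::comm_ring_1 set" +
  fixes S :: "'a set"
  assumes S_subset: "S \<subseteq> A" and S_one: "1 \<in> S" and S_mult: "s \<in> S \<Longrightarrow> t \<in> S \<Longrightarrow> s * t \<in> S"
begin

lemma subset_loc: "A \<subseteq> loc S A"
  using S_one by (auto simp: loc_def intro!: bexI[of _ 1])

lemma locI: "s \<in> S \<Longrightarrow> s * w \<in> A \<Longrightarrow> w \<in> loc S A"
  by (auto simp: loc_def)

lemma usubring_loc: "usubring (loc S A)"
proof
  show "1 \<in> loc S A" using subset_loc by blast
next
  fix x y assume "x \<in> loc S A" "y \<in> loc S A"
  then obtain s t where st: "s \<in> S" "t \<in> S" "s * x \<in> A" "t * y \<in> A" by (auto simp: loc_def)
  have "(s * t) * (x + y) = t * (s * x) + s * (t * y)" by (simp add: algebra_simps)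
  then show "x + y \<in> loc S A" using st S_subset by (intro locI[of "s * t"] S_mult) auto
  have "(s * t) * (x * y) = (s * x) * (t * y)" by (simp add: algebra_simps)
  then show "x * y \<in> loc S A" using st by (intro locI[of "s * t"] S_mult) (auto simp only: mult_mem)
next
  fix x assume "x \<in> loc S A"
  then obtain s where "s \<in> S" "s * x \<in> A" by (auto simp: loc_def)
  then show "- x \<in> loc S A" by (intro locI[of s]) auto
qed

end

text \<open>An ideal of the localization is generated by its contraction to \<open>A\<close>,
  because denominators are units; finitely many generators of the contraction suffice.\<close>

lemma noeth_loc:
  fixes A S :: "'a::field set"
  assumes "noeth A" "mult_subset A S" "0 \<notin> S"
  shows "noeth (loc S A)"
proof -
  interpret noeth A by fact
  interpret mult_subset A S by fact
  interpret L: usubring "loc S A" by (rule usubring_loc)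
  show ?thesis
  proof
    fix J assume J: "J \<subseteq> loc S A" "0 \<in> J" "\<And>x y. x \<in> J \<Longrightarrow> y \<in> J \<Longrightarrow> x + y \<in> J"
      "\<And>a x. a \<in> loc S A \<Longrightarrow> x \<in> J \<Longrightarrow> a * x \<in> J"
    have "\<exists>F. finite F \<and> F \<subseteq> J \<inter> A \<and> J \<inter> A \<subseteq> aspan A F"
      using J subset_loc by (intro fin_gen) auto
    then obtain F where F: "finite F" "F \<subseteq> J \<inter> A" "J \<inter> A \<subseteq> aspan A F" by blast
    have "x \<in> aspan (loc S A) F" if "x \<in> J" for x
    proof -
      from that J(1) obtain s where s: "s \<in> S" "s * x \<in> A" by (auto simp: loc_def)
      then have s0: "s \<noteq> 0" "s \<in> loc S A" using assms(3) S_subset subset_loc by auto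
      have "s * x \<in> J \<inter> A" using J(4)[OF s0(2) that] s by auto
      then have "s * x \<in> aspan (loc S A) F"
        using F(3) aspan_mono[OF subset_loc order.refl] by blast
      moreover have "inverse s \<in> loc S A" using s s0 by (intro locI[of s]) auto
      ultimately have "inverse s * (s * x) \<in> aspan (loc S A) F" using L.aspan_smult by blast
      then show ?thesis using s0 by (simp add: mult.assoc[symmetric])
    qed
    then show "\<exists>F. finite F \<and> F \<subseteq> J \<and> J \<subseteq> aspan (loc S A) F"
      using F by (intro exI[of _ F]) auto
  qed
qed

section \<open>Asymptotic order\<close>

text \<open>An Artin-Rees bound for principal ideals: dividing by \<open>g\<close> loses at most
  \<open>c\<close> powers of \<open>y\<close>, uniformly in \<open>N\<close>. The colon ideals
  \<open>J n\<close> of elements that \<open>y ^ n\<close> multiplies into \<open>g A\<close>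
  increase with \<open>n\<close>, and \<open>c\<close> is an index where they have
  stabilized.\<close>

lemma (in noeth) power_quotient_bound:
  fixes g y :: "'a::comm_ring_1"
  assumes "g \<in> A" "y \<in> A" "\<And>a b. y * a = y * b \<Longrightarrow> a = b" "\<And>a b. g * a = g * b \<Longrightarrow> a = b"
  shows "\<exists>c. \<forall>N. \<forall>t\<in>A. (\<exists>w\<in>A. t * g = y ^ N * w) \<longrightarrow> (\<exists>w\<in>A. t = y ^ (N - c) * w)"
proof -
  define J where "J n = {s \<in> A. \<exists>w\<in>A. y ^ n * s = g * w}" for n
  have y_cancel: "a = b" if "y ^ n * a = y ^ n * b" for n a b
    using that by (induction n) (auto simp: mult.assoc dest: assms(3))
  have "\<exists>N. (\<Union>n. J n) \<subseteq> J N"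
  proof (rule chain_stable)
    show "J n \<subseteq> A" "0 \<in> J n" for n by (auto simp: J_def intro: bexI[of _ 0])
  next
    fix n s t assume "s \<in> J n" "t \<in> J n"
    then obtain u v where "s \<in> A" "t \<in> A" "u \<in> A" "v \<in> A" "y ^ n * s = g * u" "y ^ n * t = g * v"
      by (auto simp: J_def)
    moreover from this have "y ^ n * (s + t) = g * (u + v)" by (simp add: distrib_left)
    ultimately show "s + t \<in> J n" unfolding J_def by blast
  next
    fix n a s assume "a \<in> A" "s \<in> J n"
    then obtain u where "s \<in> A" "u \<in> A" "y ^ n * s = g * u" by (auto simp: J_def)
    moreover from this have "y ^ n * (a * s) = g * (a * u)" by (simp add: ac_simps)
    ultimately show "a * s \<in> J n" unfolding J_def using \<open>a \<in> A\<close> by blast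
  next
    fix m n :: nat assume "m \<le> n"
    show "J m \<subseteq> J n"
    proof
      fix s assume "s \<in> J m"
      then obtain u where u: "s \<in> A" "u \<in> A" "y ^ m * s = g * u" by (auto simp: J_def)
      have "y ^ n * s = y ^ (n - m) * (y ^ m * s)"
        using \<open>m \<le> n\<close> by (simp add: mult.assoc[symmetric] power_add[symmetric])
      also have "\<dots> = g * (y ^ (n - m) * u)" unfolding u(3) by (simp add: ac_simps)
      finally show "s \<in> J n" unfolding J_def using u assms(2) by blast
    qed
  qed
  then obtain c where c: "(\<Union>n. J n) \<subseteq> J c" ..
  show ?thesis
  proof (intro exI[of _ c] allI ballI impI)
    fix N t assume t: "t \<in> A" "\<exists>w\<in>A. t * g = y ^ N * w"
    then obtain w where w: "w \<in> A" "t * g = y ^ N * w" by blast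
    show "\<exists>w\<in>A. t = y ^ (N - c) * w"
    proof (cases "c \<le> N")
      case False
      then show ?thesis using t by (intro bexI[of _ t]) auto
    next
      case True
      \<comment> \<open>\<open>y ^ N * w = g * t\<close> puts \<open>w\<close> into the stable
        ideal, so already \<open>y ^ c * w\<close> is a multiple of \<open>g\<close>; cancelling
        \<open>g\<close> leaves \<open>N - c\<close> powers of \<open>y\<close> in
        \<open>t\<close>.\<close>
      have "w \<in> J N" unfolding J_def using w t(1) by (auto intro!: bexI[of _ t] simp: ac_simps)
      then obtain v where v: "v \<in> A" "y ^ c * w = g * v" using c by (auto simp: J_def)
      have "g * t = y ^ (N - c) * (y ^ c * w)"
        using True w(2) by (simp add: mult.assoc[symmetric] power_add[symmetric] mult.commute[of g])
      also have "\<dots> = g * (y ^ (N - c) * v)" unfolding v(2) by (simp add: ac_simps)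
      finally have "t = y ^ (N - c) * v" by (rule assms(4))
      then show ?thesis using v(1) by blast
    qed
  qed
qed

text \<open>
  \<open>W b\<close> consists of the elements whose asymptotic \<open>h\<close>-adic order is at least \<open>b\<close>. The
  quantifier over \<open>c < b\<close> makes it continuous in \<open>b\<close>, and the factor \<open>d\<close>, which does not depend
  on \<open>n\<close>, absorbs bounded errors.
\<close>

locale order_filtration = usubring A for A :: "'a::field set" +
  fixes h :: 'a
  assumes h_mem: "h \<in> A" and h_nz: "h \<noteq> 0"
begin

definition W :: "real \<Rightarrow> 'a set" where
  "W b = {x. \<forall>c<b. \<exists>d\<in>A - {0}. \<forall>n::nat. d * x ^ n * h powi (- \<lceil>real n * c\<rceil>) \<in> A}"

lemma WI:
  assumes "\<And>c::real. c < b \<Longrightarrow> \<exists>d\<in>A - {0}. \<forall>n::nat. d * x ^ n * h powi (- \<lceil>real n * c\<rceil>) \<in> A"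
  shows "x \<in> W b"
  using assms by (auto simp: W_def)

lemma WD:
  assumes "x \<in> W b" "c < b"
  obtains d where "d \<in> A" "d \<noteq> 0" "\<And>n::nat. d * x ^ n * h powi (- \<lceil>real n * c\<rceil>) \<in> A"
  using assms unfolding W_def by blast

lemma powi_mem: "k \<ge> 0 \<Longrightarrow> h powi k \<in> A"
  using h_mem by (auto simp: power_int_def)

text \<open>Since \<open>h\<close> lies in \<open>A\<close>, dividing by fewer powers of
  \<open>h\<close> is harmless. The rounding errors of ceilings are absorbed here.\<close>

lemma weaken_exponent:
  assumes "x * h powi (- p) \<in> A" "q \<le> p"
  shows "x * h powi (- q) \<in> A"
proof -
  have "h powi (- q) = h powi (- p) * h powi (p - q)"
    using h_nz by (simp add: power_int_add[symmetric])
  then show ?thesis using assms mult_mem[OF assms(1) powi_mem[of "p - q"]] by (simp add: mult.assoc)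
qed

lemma W_mono: "b \<le> b' \<Longrightarrow> W b' \<subseteq> W b"
  by (fastforce simp: W_def)

lemma W_limit: "(\<And>c. c < b \<Longrightarrow> x \<in> W c) \<Longrightarrow> x \<in> W b"
proof (rule WI)
  fix c assume *: "\<And>c. c < b \<Longrightarrow> x \<in> W c" and "c < b"
  then obtain c' where "c < c'" "c' < b" using dense by blast
  with *[of c'] show "\<exists>d\<in>A - {0}. \<forall>n::nat. d * x ^ n * h powi (- \<lceil>real n * c\<rceil>) \<in> A"
    by (auto elim!: WD)
qed

lemma subset_W: 
  assumes "x \<in> A" "b \<le> 0" shows "x \<in> W b"
proof (rule WI)
  fix c assume "c < b"
  have "x ^ n * h powi (- \<lceil>real n * c\<rceil>) \<in> A" for n :: nat
  proof -
    have "real n * c \<le> 0" using \<open>c < b\<close> assms(2) by (simp add: mult_nonneg_nonpos)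
    then show ?thesis using assms(1) by (intro mult_mem powi_mem power_mem) simp_all
  qed
  then show "\<exists>d\<in>A - {0}. \<forall>n::nat. d * x ^ n * h powi (- \<lceil>real n * c\<rceil>) \<in> A"
    by (intro bexI[of _ 1]) auto
qed

lemma h_in_W: "h \<in> W 1"
proof (rule WI)
  fix c :: real assume "c < 1"
  have "h ^ n * h powi (- \<lceil>real n * c\<rceil>) \<in> A" for n :: nat
  proof -
    have "real n * c \<le> n" using \<open>c < 1\<close> by (simp add: mult_left_le)
    then have "\<lceil>real n * c\<rceil> \<le> int n" by (simp add: ceiling_le_iff)
    moreover have "h ^ n * h powi (- \<lceil>real n * c\<rceil>) = h powi (int n - \<lceil>real n * c\<rceil>)"
      using h_nz by (simp add: power_int_diff power_int_minus divide_inverse)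
    ultimately show ?thesis by (simp add: powi_mem)
  qed
  then show "\<exists>d\<in>A - {0}. \<forall>n::nat. d * h ^ n * h powi (- \<lceil>real n * c\<rceil>) \<in> A"
    by (intro bexI[of _ 1]) auto
qed

lemma W_mult:
  assumes "x \<in> W b" "y \<in> W b'" shows "x * y \<in> W (b + b')"
proof (rule WI)
  fix c assume c: "c < b + b'"
  \<comment> \<open>Half of the slack below \<open>b + b'\<close> is spent on each factor.\<close>
  define e where "e = (b + b' - c) / 2"
  have e: "b - e < b" "b' - e < b'" "c = (b - e) + (b' - e)" using c by (auto simp: e_def field_simps)
  obtain d where d: "d \<in> A" "d \<noteq> 0" "\<And>n::nat. d * x ^ n * h powi (- \<lceil>real n * (b - e)\<rceil>) \<in> A"
    using WD[OF assms(1) e(1)] by metis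
  obtain d' where d': "d' \<in> A" "d' \<noteq> 0" "\<And>n::nat. d' * y ^ n * h powi (- \<lceil>real n * (b' - e)\<rceil>) \<in> A"
    using WD[OF assms(2) e(2)] by metis
  have "(d * d') * (x * y) ^ n * h powi (- \<lceil>real n * c\<rceil>) \<in> A" for n :: nat
  proof (rule weaken_exponent)
    have "(d * d') * (x * y) ^ n * h powi (- (\<lceil>real n * (b - e)\<rceil> + \<lceil>real n * (b' - e)\<rceil>)) =
      (d * x ^ n * h powi (- \<lceil>real n * (b - e)\<rceil>)) * (d' * y ^ n * h powi (- \<lceil>real n * (b' - e)\<rceil>))"
      using h_nz by (simp add: power_mult_distrib power_int_diff power_int_minus divide_inverse)
    also have "\<dots> \<in> A" using d d' by blast
    finally show "(d * d') * (x * y) ^ n * h powi (- (\<lceil>real n * (b - e)\<rceil> + \<lceil>real n * (b' - e)\<rceil>)) \<in> A" .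
    show "\<lceil>real n * c\<rceil> \<le> \<lceil>real n * (b - e)\<rceil> + \<lceil>real n * (b' - e)\<rceil>"
      unfolding e(3) distrib_left by (rule ceiling_add_le)
  qed
  then show "\<exists>d\<in>A - {0}. \<forall>n::nat. d * (x * y) ^ n * h powi (- \<lceil>real n * c\<rceil>) \<in> A"
    using d d' by (intro bexI[of _ "d * d'"]) auto
qed

text \<open>The multipliers \<open>d\<close> and \<open>d'\<close> work for all exponents at once,
  so the single product \<open>d * d'\<close> handles every term \<open>x ^ i * y ^ (n - i)\<close>
  of the binomial expansion.\<close>

lemma W_add:
  assumes "x \<in> W b" "y \<in> W b" shows "x + y \<in> W b"
proof (rule WI)
  fix c assume c: "c < b"
  obtain d where d: "d \<in> A" "d \<noteq> 0" "\<And>n::nat. d * x ^ n * h powi (- \<lceil>real n * c\<rceil>) \<in> A"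
    using WD[OF assms(1) c] by metis
  obtain d' where d': "d' \<in> A" "d' \<noteq> 0" "\<And>n::nat. d' * y ^ n * h powi (- \<lceil>real n * c\<rceil>) \<in> A"
    using WD[OF assms(2) c] by metis
  have "(d * d') * (x + y) ^ n * h powi (- \<lceil>real n * c\<rceil>) \<in> A" for n :: nat
  proof -
    have "(d * d') * (x + y) ^ n * h powi (- \<lceil>real n * c\<rceil>) =
      (\<Sum>i\<le>n. of_nat (n choose i) * ((d * d') * (x ^ i * y ^ (n - i)) * h powi (- \<lceil>real n * c\<rceil>)))"
      unfolding binomial_ring sum_distrib_left sum_distrib_right by (intro sum.cong) (auto simp: ac_simps)
    also have "\<dots> \<in> A"
    proof (rule sum_mem, rule mult_mem[OF of_nat_mem], rule weaken_exponent)
      fix i assume "i \<in> {..n}"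
      then have n: "real n = real i + real (n - i)" by simp
      have "d * d' * (x ^ i * y ^ (n - i)) * h powi (- (\<lceil>real i * c\<rceil> + \<lceil>real (n - i) * c\<rceil>)) =
        (d * x ^ i * h powi (- \<lceil>real i * c\<rceil>)) * (d' * y ^ (n - i) * h powi (- \<lceil>real (n - i) * c\<rceil>))"
        using h_nz by (simp add: power_int_diff power_int_minus divide_inverse)
      also have "\<dots> \<in> A" using d d' by blast
      finally show "d * d' * (x ^ i * y ^ (n - i)) * h powi (- (\<lceil>real i * c\<rceil> + \<lceil>real (n - i) * c\<rceil>)) \<in> A" .
      show "\<lceil>real n * c\<rceil> \<le> \<lceil>real i * c\<rceil> + \<lceil>real (n - i) * c\<rceil>"
        unfolding n distrib_right by (rule ceiling_add_le)
    qed
    finally show ?thesis .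
  qed
  then show "\<exists>d\<in>A - {0}. \<forall>n::nat. d * (x + y) ^ n * h powi (- \<lceil>real n * c\<rceil>) \<in> A"
    using d d' by (intro bexI[of _ "d * d'"]) auto
qed

lemma W_smult: "a \<in> A \<Longrightarrow> x \<in> W b \<Longrightarrow> a * x \<in> W b"
  using W_mult[OF subset_W[of a 0], of x b] by simp

lemma W_zero: "0 \<in> W b"
proof (rule WI)
  fix c
  have "0 ^ n * h powi (- \<lceil>real n * c\<rceil>) \<in> A" for n :: nat
    by (cases n) auto
  then show "\<exists>d\<in>A - {0}. \<forall>n::nat. d * 0 ^ n * h powi (- \<lceil>real n * c\<rceil>) \<in> A"
    by (intro bexI[of _ 1]) auto
qed

lemma W_sum: "(\<And>i. i \<in> I \<Longrightarrow> g i \<in> W b) \<Longrightarrow> sum g I \<in> W b"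
  by (induction I rule: infinite_finite_induct) (auto intro: W_zero W_add)

lemma W_power: "x \<in> W b \<Longrightarrow> x ^ m \<in> W (real m * b)"
proof (induction m)
  case 0
  then show ?case by (auto intro: subset_W)
next
  case (Suc m)
  then show ?case using W_mult[of x b "x ^ m" "real m * b"] by (simp add: algebra_simps)
qed

text \<open>The exponent \<open>n\<close> is padded to a multiple \<open>m * j\<close> with
  \<open>n \<le> m * j \<le> n + m\<close>, and the constant multiplier \<open>d * x ^ m\<close>
  pays for the padding. This multiplier must not vanish, hence the separate case
  \<open>x = 0\<close>.\<close>

lemma W_root:
  assumes "x \<in> A" "m > 0" "x ^ m \<in> W (real m * b)" shows "x \<in> W b"
proof (cases "x = 0")
  case False
  show ?thesis
  proof (rule W_limit)
    fix c' assume "c' < b"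
    show "x \<in> W c'"
    proof (cases "c' \<le> 0")
      case True
      then show ?thesis using assms(1) by (rule subset_W[rotated])
    next
      case False
      show ?thesis
      proof (rule WI)
        fix c assume "c < c'"
        \<comment> \<open>A nonnegative slope is needed so that replacing \<open>n\<close> by the
          larger \<open>m * j\<close> does not lower the required exponent. It is still below
          \<open>b\<close>, because \<open>0 < c' < b\<close> in this case.\<close>
        define c1 where "c1 = max c 0"
        have c1: "c1 \<ge> 0" "c \<le> c1" "c1 < b" using \<open>c < c'\<close> \<open>c' < b\<close> False by (auto simp: c1_def)
        then have "real m * c1 < real m * b" using assms(2) by simp
        with assms(3) obtain d where d: "d \<in> A" "d \<noteq> 0"
          "\<And>n::nat. d * (x ^ m) ^ n * h powi (- \<lceil>real n * (real m * c1)\<rceil>) \<in> A" by (metis WD)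
        have "(d * x ^ m) * x ^ n * h powi (- \<lceil>real n * c\<rceil>) \<in> A" for n :: nat
        proof (rule weaken_exponent)
          define j where "j = n div m + 1"
          have j: "n \<le> m * j" "m * j \<le> n + m"
            using mod_less_divisor[OF assms(2), of n] mult_div_mod_eq[of m n]
            unfolding j_def distrib_left by linarith+
          have "x ^ m * x ^ n = (x ^ m) ^ j * x ^ (n + m - m * j)"
            using j by (simp add: power_mult[symmetric] power_add[symmetric] add.commute)
          then have "d * x ^ m * x ^ n * h powi (- \<lceil>real j * (real m * c1)\<rceil>) =
            (d * (x ^ m) ^ j * h powi (- \<lceil>real j * (real m * c1)\<rceil>)) * x ^ (n + m - m * j)"
            by (simp add: mult.assoc) 
          also have "\<dots> \<in> A" using d assms(1) by blast
          finally show "d * x ^ m * x ^ n * h powi (- \<lceil>real j * (real m * c1)\<rceil>) \<in> A" .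
          have "real n * c \<le> real n * c1" using c1 by (simp add: mult_left_mono)
          also have "\<dots> \<le> real (m * j) * c1" using j(1) c1 by (intro mult_right_mono of_nat_mono) auto
          finally show "\<lceil>real n * c\<rceil> \<le> \<lceil>real j * (real m * c1)\<rceil>" by (intro ceiling_mono) (simp add: ac_simps)
        qed
        then show "\<exists>d\<in>A - {0}. \<forall>n::nat. d * x ^ n * h powi (- \<lceil>real n * c\<rceil>) \<in> A"
          using d assms(1) \<open>x \<noteq> 0\<close> by (intro bexI[of _ "d * x ^ m"]) auto
      qed
    qed
  qed
qed (simp add: W_zero)

text \<open>
  With \<open>\<xi> = x / h ^ p\<close> and \<open>y = 1 / \<xi>\<close>, membership in \<open>W p\<close> says that \<open>d * h ^ k\<close> is divisible by
  \<open>y ^ n\<close> in \<open>A[y]\<close> with \<open>k / n\<close> arbitrarily small. In a Noetherian domain this forces \<open>y\<close> to be a unit.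
\<close>

theorem W_imp_adjoin_inverse:
  assumes "noeth A" "x \<in> W (of_int p)" "x \<noteq> 0"
  defines "\<xi> \<equiv> x * h powi (- p)"
  shows "\<xi> \<in> adjoin A (inverse \<xi>)"
proof (rule ccontr)
  define y where "y = inverse \<xi>"
  assume "\<xi> \<notin> adjoin A (inverse \<xi>)"
  then have nonunit: "inverse y \<notin> adjoin A y" by (simp add: y_def)
  have nz: "\<xi> \<noteq> 0" "y \<noteq> 0" using assms(3) h_nz by (auto simp: \<xi>_def y_def)
  interpret B: noeth "adjoin A y" using assms(1) by (rule Hilbert_basis)
  have sub: "A \<subseteq> adjoin A y" by (rule adjoin_superset)
  have y: "y \<in> adjoin A y" by (rule adjoin_self) unfold_locales
  have bound: "\<exists>c. \<forall>N. \<forall>t\<in>adjoin A y. (\<exists>w\<in>adjoin A y. t * g = y ^ N * w) \<longrightarrow>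
      (\<exists>w\<in>adjoin A y. t = y ^ (N - c) * w)" if "g \<in> A" "g \<noteq> 0" for g
    using that sub y nz by (intro B.power_quotient_bound) auto
  obtain c where c: "\<And>N t. t \<in> adjoin A y \<Longrightarrow> \<exists>w\<in>adjoin A y. t * h = y ^ N * w \<Longrightarrow>
      \<exists>w\<in>adjoin A y. t = y ^ (N - c) * w"
    using bound[OF h_mem h_nz] by blast
  \<comment> \<open>With this slope about \<open>n * e\<close> factors \<open>h\<close> have to be
    removed, each at a cost of \<open>c\<close> powers of \<open>y\<close>. The choice keeps the
    total cost below \<open>n / 2\<close>.\<close>
  define e where "e = 1 / (2 * (real c + 1))"
  have e: "e > 0" "real c * e \<le> 1/2" by (auto simp: e_def field_simps)
  then obtain d where d: "d \<in> A" "d \<noteq> 0" "\<And>n::nat. d * x ^ n * h powi (- \<lceil>real n * (real_of_int p - e)\<rceil>) \<in> A"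
    using WD[OF assms(2), of "real_of_int p - e"] by auto
  obtain c' where c': "\<And>N t. t \<in> adjoin A y \<Longrightarrow> \<exists>w\<in>adjoin A y. t * d = y ^ N * w \<Longrightarrow>
      \<exists>w\<in>adjoin A y. t = y ^ (N - c') * w"
    using bound[OF d(1,2)] by blast
  \<comment> \<open>Each division by \<open>h\<close> costs at most \<open>c\<close> powers of
    \<open>y\<close>, so removing \<open>h ^ k\<close> costs \<open>k * c\<close>.\<close>
  have iter: "\<exists>w\<in>adjoin A y. d = y ^ (N - k * c) * w" if "\<exists>w\<in>adjoin A y. d * h ^ k = y ^ N * w" for N k
    using that
  proof (induction k arbitrary: N)
    case (Suc k)
    have "d * h ^ k \<in> adjoin A y" using d(1) h_mem sub by blast
    moreover have "\<exists>w\<in>adjoin A y. (d * h ^ k) * h = y ^ N * w"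
      using Suc.prems by (simp add: ac_simps)
    ultimately have "\<exists>w\<in>adjoin A y. d * h ^ k = y ^ (N - c) * w" by (rule c)
    from Suc.IH[OF this] show ?case by (simp add: algebra_simps)
  qed auto
  \<comment> \<open>Removing \<open>h ^ k\<close> costs at most \<open>n / 2 = c' + 1\<close> powers
    of \<open>y\<close> and removing \<open>d\<close> costs \<open>c'\<close> more, so at least one
    of the \<open>2 * c' + 2\<close> powers survives.\<close>
  define n where "n = 2 * c' + 2"
  define k where "k = nat (int n * p - \<lceil>real n * (real_of_int p - e)\<rceil>)"
  have "real n * (real_of_int p - e) \<le> real n * p" using e by (simp add: mult_left_mono)
  then have "\<lceil>real n * (real_of_int p - e)\<rceil> \<le> int n * p" by (simp add: ceiling_le_iff)
  then have k: "int k = int n * p - \<lceil>real n * (real_of_int p - e)\<rceil>" by (simp add: k_def)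
  have "real k = real_of_int (int n * p) - real_of_int \<lceil>real n * (real_of_int p - e)\<rceil>" using k by (metis of_int_diff of_int_of_nat_eq)
  also have "\<dots> \<le> real n * e" 
  proof -
    define C where "C = \<lceil>real n * (real_of_int p - e)\<rceil>"
    have "real n * (real_of_int p - e) \<le> C" unfolding C_def by (rule le_of_int_ceiling)
    then show ?thesis unfolding C_def[symmetric] by (simp add: algebra_simps)
  qed
  finally have "real k \<le> real n * e" .
  then have "real k * real c \<le> (real n * e) * real c" by (rule mult_right_mono) simp
  then have "real (k * c) \<le> real n * (real c * e)" by (simp add: ac_simps)
  also have "\<dots> \<le> real n * (1 / 2)" using e by (intro mult_left_mono) auto
  finally have "real (k * c) \<le> real (c' + 1)" by (simp add: n_def)
  then have kc: "k * c \<le> c' + 1" by (simp only: of_nat_le_iff)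
  have xi: "x = \<xi> * h powi p" using h_nz by (simp add: \<xi>_def power_int_minus)
  have "d * x ^ n * h powi (- \<lceil>real n * (real_of_int p - e)\<rceil>) = d * \<xi> ^ n * (h powi (p * int n) * h powi (- \<lceil>real n * (real_of_int p - e)\<rceil>))"
    unfolding xi power_mult_distrib by (simp add: power_int_power' mult.assoc)
  also have "h powi (p * int n) * h powi (- \<lceil>real n * (real_of_int p - e)\<rceil>) = h ^ k"
    using h_nz k by (simp add: power_int_add[symmetric] mult.commute flip: power_int_of_nat)
  finally have "d * \<xi> ^ n * h ^ k \<in> A" using d(3)[of n] by (simp only:)
  then have "d * \<xi> ^ n * h ^ k \<in> adjoin A y" using sub by blast
  moreover have "d * h ^ k = y ^ n * (d * \<xi> ^ n * h ^ k)"
    using nz by (simp add: y_def power_inverse field_simps)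
  ultimately have "\<exists>w\<in>adjoin A y. d * h ^ k = y ^ n * w" by blast
  then have "\<exists>w\<in>adjoin A y. 1 * d = y ^ (n - k * c) * w" using iter by simp
  then have "\<exists>w\<in>adjoin A y. 1 = y ^ (n - k * c - c') * w" using c'[of 1] by blast
  then obtain w where w: "w \<in> adjoin A y" "1 = y ^ (n - k * c - c') * w" by blast
  \<comment> \<open>The surviving power exhibits 1 as a multiple of \<open>y\<close> in
    \<open>A[y]\<close>, so \<open>y\<close> is a unit there.\<close>
  obtain l where "n - k * c - c' = Suc l" using kc by (cases "n - k * c - c'") (auto simp: n_def)
  then have "inverse y = y ^ l * w" using w nz by (simp add: field_simps)
  then show False using nonunit w(1) y by simp
qed

end

section \<open>Linear and algebraic dependence\<close>

lemma (in usubring) aspan_insert: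
  assumes "x \<in> aspan A (insert m M)"
  shows "\<exists>a\<in>A. \<exists>w\<in>aspan A M. x = a * m + w"
  using assms
proof induction
  case aspan_zero
  show ?case by (rule bexI[of _ 0], rule bexI[of _ 0]) (auto intro: aspan.aspan_zero)
next
  case (aspan_step x b n)
  then obtain a w where aw: "a \<in> A" "w \<in> aspan A M" "x = a * m + w" by blast
  show ?case
  proof (cases "n = m")
    case True
    then show ?thesis using aw aspan_step
      by (intro bexI[of _ "b + a"] bexI[of _ w]) (auto simp: algebra_simps)
  next
    case False
    then have "b * n + w \<in> aspan A M"
      using aw aspan_step by (intro aspan.aspan_step) auto
    then show ?thesis using aw
      by (intro bexI[of _ a] bexI[of _ "b * n + w"]) (auto simp: algebra_simps)
  qed
qed

text \<open>Gaussian elimination without division: the generator \<open>m\<close> is eliminated by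
  cross-multiplying with a pivot \<open>y0\<close>. The vectors form an indexed family, so repeated
  values count separately; powers and monomials that happen to coincide cause no trouble
  later.\<close>

lemma dependent_family:
  fixes v :: "'b \<Rightarrow> 'a::field" and A :: "'a set"
  assumes "usubring A" "finite M" "finite Y" "card M < card Y" "\<And>y. y \<in> Y \<Longrightarrow> v y \<in> aspan A M"
  shows "\<exists>c. (\<forall>y. c y \<in> A) \<and> (\<exists>y\<in>Y. c y \<noteq> 0) \<and> (\<Sum>y\<in>Y. c y * v y) = 0"
  using assms(2-5)
proof (induction M arbitrary: Y v rule: finite_induct)
  case empty
  interpret usubring A by fact
  have "v y = 0" if "y \<in> Y" for y
    using empty(3)[OF that] by (auto elim: aspan.cases)
  moreover obtain y where "y \<in> Y" using empty(2) by fastforce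
  ultimately show ?case by (intro exI[of _ "\<lambda>_. 1"]) auto
next
  case (insert m M)
  interpret usubring A by fact
  have "\<forall>y\<in>Y. \<exists>a w. a \<in> A \<and> w \<in> aspan A M \<and> v y = a * m + w"
    using insert.prems(3) aspan_insert by blast
  then obtain a w where aw: "\<And>y. y \<in> Y \<Longrightarrow> a y \<in> A" "\<And>y. y \<in> Y \<Longrightarrow> w y \<in> aspan A M"
    "\<And>y. y \<in> Y \<Longrightarrow> v y = a y * m + w y" by metis
  show ?case
  proof (cases "\<forall>y\<in>Y. a y = 0")
    case True
    then show ?thesis using insert.IH[of Y v] insert.prems insert.hyps aw by simp
  next
    case False
    then obtain y0 where y0: "y0 \<in> Y" "a y0 \<noteq> 0" by blast
    define Y' where "Y' = Y - {y0}"
    define v' where "v' y = a y0 * v y - a y * v y0" for y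
    have Y: "Y = insert y0 Y'" "y0 \<notin> Y'" "finite Y'" using y0 insert.prems(1) by (auto simp: Y'_def)
    then have "card M < card Y'" using insert.prems(2) insert.hyps by simp
    moreover have "v' y \<in> aspan A M" if "y \<in> Y'" for y
    proof -
      have "y \<in> Y" using that by (simp add: Y'_def)
      then have "v' y = a y0 * w y - a y * w y0"
        using aw(3)[of y] aw(3)[of y0] y0 by (simp add: v'_def algebra_simps)
      then show ?thesis using aw \<open>y \<in> Y\<close> y0 by (auto intro!: aspan_diff aspan_smult)
    qed
    ultimately obtain c where c: "\<forall>y. c y \<in> A" "\<exists>y\<in>Y'. c y \<noteq> 0" "(\<Sum>y\<in>Y'. c y * v' y) = 0"
      using insert.IH[of Y' v'] Y(3) by blast
    \<comment> \<open>The pivot coefficient is chosen so that the sum over \<open>Y\<close> turns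
      into the relation already found among the vectors \<open>v'\<close>.\<close>
    define c' where "c' y = (if y = y0 then - (\<Sum>y\<in>Y'. c y * a y) else if y \<in> Y' then a y0 * c y else 0)" for y
    have "(\<Sum>y\<in>Y'. c y * a y) \<in> A" using c(1) aw(1) Y(1) by (intro sum_mem) auto
    then have "\<forall>y. c' y \<in> A" using c(1) aw(1) y0 by (auto simp: c'_def)
    moreover have "\<exists>y\<in>Y. c' y \<noteq> 0"
    proof -
      obtain y where "y \<in> Y'" "c y \<noteq> 0" using c(2) by blast
      then show ?thesis using y0 Y by (intro bexI[of _ y]) (auto simp: c'_def)
    qed
    moreover have "(\<Sum>y\<in>Y. c' y * v y) = 0"
    proof -
      have "(\<Sum>y\<in>Y. c' y * v y) = c' y0 * v y0 + (\<Sum>y\<in>Y'. c' y * v y)"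
        using Y by simp
      also have "(\<Sum>y\<in>Y'. c' y * v y) = (\<Sum>y\<in>Y'. a y0 * c y * v y)"
        using Y by (intro sum.cong) (auto simp: c'_def)
      also have "c' y0 * v y0 = (\<Sum>y\<in>Y'. - (c y * a y * v y0))"
        by (simp add: c'_def sum_distrib_right sum_negf)
      also have "\<dots> + (\<Sum>y\<in>Y'. a y0 * c y * v y) = (\<Sum>y\<in>Y'. c y * v' y)"
        unfolding sum.distrib[symmetric] by (intro sum.cong) (auto simp: v'_def algebra_simps)
      finally show ?thesis using c(3) by simp
    qed
    ultimately show ?thesis by blast
  qed
qed

definition independent_over :: "'a::comm_ring_1 set \<Rightarrow> 'a set \<Rightarrow> bool" where
  "independent_over A e \<longleftrightarrow> (\<forall>c. (\<forall>m. c m \<in> A) \<longrightarrow> (\<Sum>m\<in>e. c m * m) = 0 \<longrightarrow> (\<forall>m\<in>e. c m = 0))"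

text \<open>A maximal independent subset \<open>e\<close> of \<open>M\<close> spans up to torsion:
  every generator has a nonzero multiple in its span, and \<open>D\<close> is the product of these
  finitely many multipliers. At the cost of the constant \<open>D\<close> a finite module may thus
  be treated as free.\<close>

lemma free_submodule:
  fixes A :: "'a::field set"
  assumes "usubring A" "finite M"
  shows "\<exists>e D. e \<subseteq> M \<and> independent_over A e \<and> D \<in> A \<and> D \<noteq> 0 \<and> (\<forall>x\<in>aspan A M. D * x \<in> aspan A e)"
proof -
  interpret usubring A by fact
  have "{} \<in> {e. e \<subseteq> M \<and> independent_over A e}" by (simp add: independent_over_def)
  moreover have "finite {e. e \<subseteq> M \<and> independent_over A e}" using assms(2) by simp
  ultimately have "\<exists>e\<in>{e. e \<subseteq> M \<and> independent_over A e}.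
      \<forall>e'\<in>{e. e \<subseteq> M \<and> independent_over A e}. e \<subseteq> e' \<longrightarrow> e = e'"
    by (intro finite_has_maximal) auto
  then obtain e where "e \<in> {e. e \<subseteq> M \<and> independent_over A e}"
    and max: "\<forall>e'\<in>{e. e \<subseteq> M \<and> independent_over A e}. e \<subseteq> e' \<longrightarrow> e = e'" ..
  then have e: "e \<subseteq> M" "independent_over A e" by auto
  have fe: "finite e" using e(1) assms(2) finite_subset by blast
  have "\<exists>s\<in>A - {0}. s * m \<in> aspan A e" if "m \<in> M" for m
  proof (cases "m \<in> e")
    case True
    then show ?thesis by (intro bexI[of _ 1]) (auto intro: aspan_base)
  next
    case False
    then have "\<not> independent_over A (insert m e)" using max[rule_format, of "insert m e"] e(1) that by auto
    then obtain c where c: "\<forall>m. c m \<in> A" "(\<Sum>n\<in>insert m e. c n * n) = 0" "\<exists>n\<in>insert m e. c n \<noteq> 0"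
      unfolding independent_over_def by blast
    have s: "c m * m + (\<Sum>n\<in>e. c n * n) = 0" using c(2) fe False by simp
    have "c m \<noteq> 0"
    proof
      assume "c m = 0"
      with s e(2) c(1) have "\<forall>n\<in>e. c n = 0" unfolding independent_over_def by simp
      then show False using c(3) \<open>c m = 0\<close> by blast
    qed
    moreover have "c m * m = - (\<Sum>n\<in>e. c n * n)" using s by (simp add: eq_neg_iff_add_eq_0)
    moreover have "- (\<Sum>n\<in>e. c n * n) \<in> aspan A e"
      using c(1) by (intro aspan_uminus aspan_sum aspan_scaled) auto
    ultimately show ?thesis using c(1) by (intro bexI[of _ "c m"]) auto
  qed
  then obtain s where s: "\<And>m. m \<in> M \<Longrightarrow> s m \<in> A" "\<And>m. m \<in> M \<Longrightarrow> s m \<noteq> 0"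
    "\<And>m. m \<in> M \<Longrightarrow> s m * m \<in> aspan A e" by (metis DiffD1 DiffD2 insertI1)
  define D where "D = prod s M"
  have "D * x \<in> aspan A e" if "x \<in> aspan A M" for x
    using that
  proof induction
    case aspan_zero
    then show ?case by (auto intro: aspan.aspan_zero)
  next
    case (aspan_step x a m)
    have "D = s m * prod s (M - {m})" unfolding D_def using aspan_step assms(2) by (intro prod.remove)
    then have "D * (a * m + x) = (prod s (M - {m}) * a) * (s m * m) + D * x" by (simp add: algebra_simps)
    moreover have "prod s (M - {m}) \<in> A" using s(1) by (intro prod_mem) auto
    moreover from this have "(prod s (M - {m}) * a) * (s m * m) \<in> aspan A e"
      using aspan_step s(3)[of m] by (intro aspan_smult[of "s m * m"]) auto
    ultimately show ?case using aspan_step by (simp add: aspan_add)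
  qed
  moreover have "D \<in> A" "D \<noteq> 0" using s(1,2) assms(2) unfolding D_def by auto
  ultimately show ?thesis using e by blast
qed

section \<open>Transcendental elements and regular sequences\<close>

definition transcendental_over :: "'a::comm_ring_1 set \<Rightarrow> 'a \<Rightarrow> bool" where
  "transcendental_over E z \<longleftrightarrow>
    (\<forall>n c. (\<forall>i. c i \<in> E) \<longrightarrow> (\<Sum>i<n. c i * z ^ i) = 0 \<longrightarrow> (\<forall>i<n. c i = 0))"

lemma (in usubring) adjoin_split:
  assumes "x \<in> adjoin A z"
  shows "\<exists>w\<in>polys_below A z n. \<exists>g\<in>adjoin A z. x = w + z ^ n * g"
  using assms unfolding adjoin_def
proof induction
  case aspan_zero
  show ?case by (rule bexI[of _ 0], rule bexI[of _ 0]) (auto intro: aspan.aspan_zero simp: polys_below_def)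
next
  case (aspan_step x a m)
  then obtain w g i where w: "w \<in> polys_below A z n" "g \<in> aspan A (range ((^) z))" "x = w + z ^ n * g"
    "m = z ^ i" by blast
  show ?case
  proof (cases "i < n")
    case True
    then have "a * m + w \<in> polys_below A z n"
      using w aspan_step unfolding polys_below_def by (intro aspan.aspan_step) auto
    then show ?thesis using w by (intro bexI[of _ "a * m + w"] bexI[of _ g]) auto
  next
    case False
    then have "z ^ i = z ^ n * z ^ (i - n)" by (simp add: power_add[symmetric])
    then have "a * m + x = w + z ^ n * (a * z ^ (i - n) + g)" using w by (simp add: algebra_simps)
    moreover have "a * z ^ (i - n) + g \<in> aspan A (range ((^) z))"
      using w aspan_step by (intro aspan.aspan_step) auto
    ultimately show ?thesis using w by blast
  qed
qed

text \<open>Below degree \<open>n\<close> the left side has no terms, so \<open>u\<close> kills the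
  low coefficients of \<open>b\<close>; they vanish because \<open>u\<close> is a nonzero element of
  a field.\<close>

lemma transcendental_dvd:
  fixes E :: "'a::field set"
  assumes "usubring E" "transcendental_over E z" "u \<in> E" "u \<noteq> 0"
    "a \<in> adjoin E z" "b \<in> adjoin E z" "z ^ n * a = u * b"
  shows "\<exists>g\<in>adjoin E z. b = z ^ n * g"
proof -
  interpret usubring E by fact
  interpret P: usubring "adjoin E z" by (rule usubring_adjoin) fact
  obtain w g where w: "w \<in> polys_below E z n" "g \<in> adjoin E z" "b = w + z ^ n * g"
    using adjoin_split[OF assms(6)] by blast
  obtain c where c: "\<forall>i. c i \<in> E" "w = (\<Sum>i<n. c i * z ^ i)" using polys_below_rep[OF w(1)] by blast
  have "a - u * g \<in> adjoin E z" using assms w adjoin_superset by blast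
  then obtain m where "a - u * g \<in> polys_below E z m" using adjoin_polys_below by blast
  from polys_below_rep[OF this] obtain c' where c': "\<forall>i. c' i \<in> E" "a - u * g = (\<Sum>i<m. c' i * z ^ i)"
    by blast
  \<comment> \<open>These are the coefficients of \<open>u * w - z ^ n * (a - u * g)\<close>, which
    is 0; those below \<open>n\<close> are the \<open>u * c i\<close>.\<close>
  define C where "C i = (if i < n then u * c i else - c' (i - n))" for i
  have "(\<Sum>i<n + m. C i * z ^ i) = (\<Sum>i<n. C i * z ^ i) + (\<Sum>i<m. C (n + i) * z ^ (n + i))"
    by (induction m) (simp_all add: add.assoc)
  also have "\<dots> = u * w - z ^ n * (a - u * g)"
    unfolding c(2) c'(2) by (simp add: C_def sum_distrib_left sum_negf power_add ac_simps)
  also have "\<dots> = 0" using assms(7) w(3) by (simp add: algebra_simps)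
  finally have "(\<Sum>i<n + m. C i * z ^ i) = 0" .
  moreover have "\<forall>i. C i \<in> E" using assms(3) c(1) c'(1) by (auto simp: C_def)
  ultimately have "\<forall>i<n + m. C i = 0" using assms(2) unfolding transcendental_over_def by blast
  then have "C i = 0" if "i < n" for i using that by simp
  then have "\<forall>i<n. c i = 0" using assms(4) by (auto simp: C_def)
  then have "w = 0" unfolding c(2) by simp
  then show ?thesis using w by auto
qed

text \<open>\<open>u\<close> and \<open>z ^ n\<close> form a regular sequence on the free module spanned by \<open>e\<close>.\<close>

lemma free_module_Hartogs:
  fixes E :: "'a::field set"
  assumes "usubring E" "transcendental_over E z" "z \<noteq> 0" "finite e" "independent_over (adjoin E z) e"
    "u \<in> E" "u \<noteq> 0" "u * w \<in> aspan (adjoin E z) e" "z ^ n * w \<in> aspan (adjoin E z) e"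
  shows "w \<in> aspan (adjoin E z) e"
proof -
  interpret E: usubring E by fact
  interpret P: usubring "adjoin E z" by (rule usubring_adjoin) fact
  obtain a where a: "\<forall>m. a m \<in> adjoin E z" "u * w = (\<Sum>m\<in>e. a m * m)"
    using P.aspan_finite_rep[OF assms(8,4)] by blast
  obtain b where b: "\<forall>m. b m \<in> adjoin E z" "z ^ n * w = (\<Sum>m\<in>e. b m * m)"
    using P.aspan_finite_rep[OF assms(9,4)] by blast
  have z: "z \<in> adjoin E z" by (rule adjoin_self) fact
  have u: "u \<in> adjoin E z" using assms(6) adjoin_superset by blast
  \<comment> \<open>Both \<open>z ^ n * (u * w)\<close> and \<open>u * (z ^ n * w)\<close> are the
    same element, and independence of \<open>e\<close> allows its coordinates to be
    compared.\<close>
  have "(\<Sum>m\<in>e. (z ^ n * a m - u * b m) * m) = z ^ n * (u * w) - u * (z ^ n * w)"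
    unfolding a(2) b(2) by (simp add: left_diff_distrib sum_subtractf sum_distrib_left mult.assoc)
  then have "(\<Sum>m\<in>e. (z ^ n * a m - u * b m) * m) = 0" by (simp add: ac_simps)
  moreover have "\<forall>m. z ^ n * a m - u * b m \<in> adjoin E z" using a b z u by auto
  ultimately have "\<forall>m\<in>e. z ^ n * a m - u * b m = 0"
    using assms(5)[unfolded independent_over_def, rule_format, of "\<lambda>m. z ^ n * a m - u * b m"] by blast
  then have "\<forall>m\<in>e. \<exists>g\<in>adjoin E z. b m = z ^ n * g"
    using transcendental_dvd[OF assms(1,2,6,7) a(1)[rule_format] b(1)[rule_format]] by auto
  then obtain g where g: "\<And>m. m \<in> e \<Longrightarrow> g m \<in> adjoin E z" "\<And>m. m \<in> e \<Longrightarrow> b m = z ^ n * g m"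
    by metis
  have "z ^ n * w = z ^ n * (\<Sum>m\<in>e. g m * m)"
    unfolding b(2) sum_distrib_left using g(2) by (intro sum.cong) (auto simp: ac_simps)
  then have "w = (\<Sum>m\<in>e. g m * m)" using assms(3) by simp
  then show ?thesis using g(1) by (auto intro!: aspan_sum aspan_scaled)
qed

text \<open>For finite \<open>M\<close> its span over \<open>E\<close> is the part of degree at most
  \<open>c\<close> in \<open>z\<close> of the \<open>E[z]\<close>-module generated by
  \<open>M\<close>; its number of generators grows linearly in \<open>c\<close>.\<close>

definition power_multiples :: "'a::comm_ring_1 \<Rightarrow> 'a set \<Rightarrow> nat \<Rightarrow> 'a set" where
  "power_multiples z M c = (\<lambda>(l, m). z ^ l * m) ` ({..c} \<times> M)"

lemma power_multiplesI: "l \<le> c \<Longrightarrow> m \<in> M \<Longrightarrow> z ^ l * m \<in> power_multiples z M c"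
  by (auto simp: power_multiples_def)

lemma power_multiples_mono: "c \<le> c' \<Longrightarrow> power_multiples z M c \<subseteq> power_multiples z M c'"
  unfolding power_multiples_def by (intro image_mono) auto

lemma adjoin_span_graded:
  assumes "usubring E" "x \<in> aspan (adjoin E z) M"
  shows "\<exists>c. x \<in> aspan E (power_multiples z M c)"
  using assms(2)
proof induction
  case aspan_zero
  then show ?case by (auto intro: aspan.aspan_zero)
next
  case (aspan_step x a m)
  interpret usubring E by fact
  from aspan_step obtain c where c: "x \<in> aspan E (power_multiples z M c)" by blast
  from aspan_step obtain n where n: "a \<in> polys_below E z n" using adjoin_polys_below by blast
  let ?T = "power_multiples z M (max c n)"
  from polys_below_rep[OF n] obtain b where b: "\<forall>i. b i \<in> E" "a = (\<Sum>i<n. b i * z ^ i)" by blast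
  have "x \<in> aspan E ?T"
    using c aspan_mono[OF order.refl power_multiples_mono[of c "max c n" z M], of E] by auto
  moreover have "a * m \<in> aspan E ?T"
    unfolding b(2) sum_distrib_right mult.assoc using b(1) aspan_step
    by (intro aspan_sum aspan_scaled power_multiplesI) auto
  ultimately show ?case by (blast intro: aspan_add)
qed

text \<open>
  Monomials of degree less than \<open>N\<close> in each of \<open>f\<close> and \<open>g\<close> are \<open>N\<^sup>2\<close> many but span a module of rank \<open>O(N)\<close>.
\<close>

lemma algebraic_relation:
  fixes E :: "'a::field set"
  assumes "usubring E" "usubring B" "finite M" "M \<subseteq> B" "B \<subseteq> aspan (adjoin E z) M" "f \<in> B" "g \<in> B"
  shows "\<exists>(N::nat) c. (\<forall>p. c p \<in> E) \<and> (\<exists>p\<in>{..<N} \<times> {..<N}. c p \<noteq> 0) \<and>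
    (\<Sum>(i, j)\<in>{..<N} \<times> {..<N}. c (i, j) * (f ^ i * g ^ j)) = 0"
proof -
  interpret E: usubring E by fact
  interpret B: usubring B by fact
  define T where "T = power_multiples z M"
  have T_mono: "aspan E (T c) \<subseteq> aspan E (T c')" if "c \<le> c'" for c c'
    unfolding T_def using that by (intro aspan_mono power_multiples_mono) auto
  have T_fin: "finite (T c)" "card (T c) \<le> Suc c * card M" for c
    using assms(3) card_image_le[of "{..c} \<times> M" "\<lambda>(l, m). z ^ l * m"] 
    by (auto simp: T_def power_multiples_def card_cartesian_product)
  have deg: "\<exists>c. x \<in> aspan E (T c)" if "x \<in> B" for x
    using adjoin_span_graded[OF assms(1)] that assms(5) unfolding T_def by blast
  \<comment> \<open>Multiplication by \<open>x\<close> raises the \<open>z\<close>-degree by a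
    bounded amount, since it is determined on the finitely many generators \<open>M\<close>.\<close>
  have mult_deg: "\<exists>c. \<forall>k. \<forall>y\<in>aspan E (T k). x * y \<in> aspan E (T (k + c))" if "x \<in> B" for x
  proof -
    have "\<forall>m\<in>M. \<exists>c. x * m \<in> aspan E (T c)" using deg that assms(4) by blast
    then obtain c where c: "\<And>m. m \<in> M \<Longrightarrow> x * m \<in> aspan E (T (c m))" by metis
    define C where "C = Max (insert 0 (c ` M))"
    have C: "x * m \<in> aspan E (T C)" if "m \<in> M" for m
      using c[OF that] T_mono[of "c m" C] that assms(3) by (auto simp: C_def)
    have "x * y \<in> aspan E (T (k + C))" if "y \<in> aspan E (T k)" for k y
      using that
    proof induction
      case aspan_zero
      then show ?case by (auto intro: aspan.aspan_zero)
    next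
      case (aspan_step y a t)
      then obtain l m where lm: "t = z ^ l * m" "l \<le> k" "m \<in> M"
        by (auto simp: T_def power_multiples_def)
      have "z ^ l * v \<in> aspan E (T (k + C))" if "v \<in> aspan E (T C)" for v
        using that
      proof induction
        case aspan_zero
        then show ?case by (auto intro: aspan.aspan_zero)
      next
        case (aspan_step v b s)
        then obtain l' m' where lm': "s = z ^ l' * m'" "l' \<le> C" "m' \<in> M"
          by (auto simp: T_def power_multiples_def)
        have "z ^ l * (b * s + v) = b * (z ^ (l + l') * m') + z ^ l * v"
          using lm' by (simp add: algebra_simps power_add)
        moreover have "z ^ (l + l') * m' \<in> T (k + C)" using lm lm' unfolding T_def by (intro power_multiplesI) auto
        ultimately show ?case using aspan_step by (auto intro: aspan.aspan_step)
      qed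
      from this[OF C[OF lm(3)]] have "x * t \<in> aspan E (T (k + C))" by (simp add: lm ac_simps)
      then have "a * (x * t) + x * y \<in> aspan E (T (k + C))"
        using aspan_step by (auto intro!: aspan_add E.aspan_smult)
      then show ?case by (simp add: algebra_simps)
    qed
    then show ?thesis by blast
  qed
  obtain cf where cf: "\<And>k y. y \<in> aspan E (T k) \<Longrightarrow> f * y \<in> aspan E (T (k + cf))"
    using mult_deg[OF assms(6)] by blast
  obtain cg where cg: "\<And>k y. y \<in> aspan E (T k) \<Longrightarrow> g * y \<in> aspan E (T (k + cg))"
    using mult_deg[OF assms(7)] by blast
  obtain c1 where c1: "1 \<in> aspan E (T c1)" using deg[of 1] by auto
  have gj: "g ^ j \<in> aspan E (T (c1 + j * cg))" for j
  proof (induction j)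
    case (Suc j)
    from cg[OF this] show ?case by (simp add: algebra_simps)
  qed (use c1 in auto)
  have fg: "f ^ i * g ^ j \<in> aspan E (T (c1 + j * cg + i * cf))" for i j
  proof (induction i)
    case (Suc i)
    from cf[OF this] show ?case by (simp add: algebra_simps)
  qed (use gj in auto)
  \<comment> \<open>The monomials have degree at most \<open>N * (c1 + cg + cf)\<close> and hence
    lie in the span of at most \<open>N * K * card M\<close> elements; this is less than
    \<open>N * N\<close> once \<open>N\<close> exceeds \<open>K * card M\<close>.\<close>
  define K where "K = c1 + cg + cf + 1"
  define N where "N = K * card M + 1"
  let ?Y = "{..<N} \<times> {..<N}"
  have "f ^ i * g ^ j \<in> aspan E (T (N * (c1 + cg + cf)))" if "i < N" "j < N" for i j
  proof -
    have "c1 + j * cg + i * cf \<le> N * c1 + N * cg + N * cf"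
      using that by (intro add_mono mult_right_mono) (auto simp: N_def)
    then show ?thesis using fg[of i j] T_mono[of "c1 + j * cg + i * cf" "N * (c1 + cg + cf)"]
      by (auto simp: algebra_simps)
  qed
  moreover have "card (T (N * (c1 + cg + cf))) < card ?Y"
  proof -
    have "card (T (N * (c1 + cg + cf))) \<le> Suc (N * (c1 + cg + cf)) * card M" by (rule T_fin)
    also have "\<dots> \<le> (N * K) * card M" by (intro mult_right_mono) (auto simp: K_def N_def)
    also have "\<dots> = N * (K * card M)" by simp
    also have "\<dots> < N * N" by (simp add: N_def)
    finally show ?thesis by (simp add: card_cartesian_product)
  qed
  ultimately have "\<exists>c. (\<forall>p. c p \<in> E) \<and> (\<exists>p\<in>?Y. c p \<noteq> 0) \<and>
      (\<Sum>p\<in>?Y. c p * (f ^ fst p * g ^ snd p)) = 0"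
    by (intro dependent_family[OF assms(1), of "T (N * (c1 + cg + cf))"] T_fin) auto
  then show ?thesis by (auto simp: case_prod_beta)
qed

section \<open>Noether normalization\<close>

locale usubfield = usubring A for A :: "'a::field set" +
  assumes inverse_mem: "x \<in> A \<Longrightarrow> inverse x \<in> A"

definition monom_at :: "nat \<Rightarrow> (nat \<Rightarrow> 'a::comm_ring_1) \<Rightarrow> (nat \<Rightarrow> nat) \<Rightarrow> 'a" where
  "monom_at d y m = (\<Prod>i<d. y i ^ m i)"

text \<open>Vanishing from \<open>d\<close> on makes exponent vectors that agree below
  \<open>d\<close> equal as functions.\<close>

definition exponents :: "nat \<Rightarrow> (nat \<Rightarrow> nat) set" where
  "exponents d = {m. \<forall>i\<ge>d. m i = 0}"

lemma gen_monom_rep: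
  fixes k :: "'a::field set"
  assumes "usubring k" "x \<in> gen (k \<union> y ` {..<d})"
  shows "\<exists>Ms c. finite Ms \<and> Ms \<subseteq> exponents d \<and> (\<forall>m\<in>Ms. c m \<in> k \<and> c m \<noteq> 0) \<and>
    x = (\<Sum>m\<in>Ms. c m * monom_at d y m)"
proof -
  interpret usubring k by fact
  let ?M = "monom_at d y ` exponents d"
  have one: "1 \<in> ?M"
    by (rule image_eqI[of _ _ "\<lambda>_. 0"]) (auto simp: monom_at_def exponents_def)
  have mult: "u * v \<in> ?M" if uv: "u \<in> ?M" "v \<in> ?M" for u v
  proof -
    from uv obtain m n where mn: "m \<in> exponents d" "n \<in> exponents d" "u = monom_at d y m" "v = monom_at d y n"
      by blast
    then show ?thesis
      by (intro image_eqI[of _ _ "\<lambda>i. m i + n i"])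
         (auto simp: monom_at_def exponents_def power_add prod.distrib)
  qed
  have "usubring (aspan k ?M)"
  proof
    show "1 \<in> aspan k ?M" using one by (rule aspan_base)
  next
    fix u v assume "u \<in> aspan k ?M" "v \<in> aspan k ?M"
    then have "u * v \<in> aspan k {m * n |m n. m \<in> ?M \<and> n \<in> ?M}" by (rule aspan_mult)
    moreover have "{m * n |m n. m \<in> ?M \<and> n \<in> ?M} \<subseteq> ?M" using mult by blast
    ultimately show "u * v \<in> aspan k ?M" using aspan_mono[OF order.refl] by blast
  qed (auto intro: aspan_add aspan_uminus)
  moreover have "k \<subseteq> aspan k ?M" using aspan_scaled[OF _ one, of _ k] by auto
  moreover have "y i \<in> aspan k ?M" if "i < d" for i
  proof (rule aspan_base, rule image_eqI[of _ _ "\<lambda>j. if j = i then 1 else 0"])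
    have "monom_at d y (\<lambda>j. if j = i then 1 else 0) = (\<Prod>j<d. if j = i then y j else 1)"
      unfolding monom_at_def by (intro prod.cong) auto
    then show "y i = monom_at d y (\<lambda>j. if j = i then 1 else 0)" using that by simp
  qed (use that in \<open>auto simp: exponents_def\<close>)
  ultimately have "gen (k \<union> y ` {..<d}) \<subseteq> aspan k ?M" by (intro gen_least) auto
  with assms(2) have "x \<in> aspan k ?M" by blast
  from aspan_sum_rep[OF this] obtain F c where
    F: "finite F" "F \<subseteq> ?M" "\<forall>v\<in>F. c v \<in> k" "x = (\<Sum>v\<in>F. c v * v)" by blast
  from F(2) have "\<forall>v\<in>F. \<exists>m. m \<in> exponents d \<and> monom_at d y m = v" by blast
  \<comment> \<open>Different exponent vectors may give the same value \<open>v\<close>;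
    \<open>\<mu>\<close> picks one for each value and is injective because
    \<open>monom_at d y\<close> inverts it.\<close>
  then obtain \<mu> where \<mu>: "\<And>v. v \<in> F \<Longrightarrow> \<mu> v \<in> exponents d" "\<And>v. v \<in> F \<Longrightarrow> monom_at d y (\<mu> v) = v"
    by metis
  define F' where "F' = {v \<in> F. c v \<noteq> 0}"
  have inj: "inj_on \<mu> F'" by (rule inj_on_inverseI[where g = "monom_at d y"]) (auto simp: F'_def \<mu>)
  have "x = (\<Sum>v\<in>F'. c v * v)" unfolding F(4) F'_def using F(1)
    by (intro sum.mono_neutral_right) auto
  also have "\<dots> = (\<Sum>m\<in>\<mu> ` F'. c (monom_at d y m) * monom_at d y m)"
    unfolding sum.reindex[OF inj] by (intro sum.cong) (auto simp: F'_def \<mu>)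
  finally show ?thesis
    using F(1,3) \<mu> by (intro exI[of _ "\<mu> ` F'"] exI[of _ "\<lambda>m. c (monom_at d y m)"]) (auto simp: F'_def)
qed

lemma digits_unique:
  fixes m n :: "nat \<Rightarrow> nat"
  assumes "(\<Sum>i<d. m i * B ^ i) = (\<Sum>i<d. n i * B ^ i)" "\<And>i. i < d \<Longrightarrow> m i < B" "\<And>i. i < d \<Longrightarrow> n i < B"
  shows "\<forall>i<d. m i = n i"
  using assms
proof (induction d arbitrary: m n)
  case (Suc d)
  have eq: "m 0 + B * (\<Sum>i<d. m (Suc i) * B ^ i) = n 0 + B * (\<Sum>i<d. n (Suc i) * B ^ i)"
    using Suc.prems(1) by (simp add: sum.lessThan_Suc_shift sum_distrib_left ac_simps del: sum.lessThan_Suc)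
  have lt: "m 0 < B" "n 0 < B" using Suc.prems(2,3)[of 0] by auto
  from arg_cong[OF eq, of "\<lambda>x. x mod B"] lt have 0: "m 0 = n 0" by simp
  with eq lt have "(\<Sum>i<d. m (Suc i) * B ^ i) = (\<Sum>i<d. n (Suc i) * B ^ i)" by simp
  from Suc.IH[OF this] Suc.prems(2,3) have "\<forall>i<d. m (Suc i) = n (Suc i)" by simp
  with 0 show ?case by (auto simp: less_Suc_eq_0_disj)
qed auto

section \<open>Monic elements and finite extensions\<close>

definition monic_in :: "'a::comm_ring_1 set \<Rightarrow> 'a \<Rightarrow> nat \<Rightarrow> 'a set" where
  "monic_in Q z n = {x. x - z ^ n \<in> polys_below Q z n}"

context usubring
begin

lemma monic_in_mult:
  assumes "u \<in> monic_in A z m" "v \<in> monic_in A z n" shows "u * v \<in> monic_in A z (m + n)"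
proof -
  define a b where "a = u - z ^ m" and "b = v - z ^ n"
  have ab: "a \<in> polys_below A z m" "b \<in> polys_below A z n" using assms by (auto simp: monic_in_def a_def b_def)
  have pow: "z ^ j \<in> polys_below A z (Suc j)" for j
    unfolding polys_below_def by (intro aspan_base) auto
  have "z ^ m * b \<in> polys_below A z (m + n)"
    using polys_below_mult[OF pow ab(2)] by simp
  moreover have "a * z ^ n \<in> polys_below A z (m + n)"
    using polys_below_mult[OF ab(1) pow] by simp
  moreover have "a * b \<in> polys_below A z (m + n)"
    using polys_below_mult[OF ab] polys_below_mono[of "m + n - 1" "m + n" A z] by auto
  ultimately have "z ^ m * b + a * z ^ n + a * b \<in> polys_below A z (m + n)"
    unfolding polys_below_def by (intro aspan_add)
  moreover have "u * v - z ^ (m + n) = z ^ m * b + a * z ^ n + a * b"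
    by (simp add: a_def b_def algebra_simps power_add)
  ultimately show ?thesis by (simp add: monic_in_def)
qed

lemma monic_in_one: "1 \<in> monic_in A z 0"
  by (auto simp: monic_in_def polys_below_def intro: aspan_zero)

lemma monic_in_power: "u \<in> monic_in A z m \<Longrightarrow> u ^ n \<in> monic_in A z (n * m)"
  by (induction n) (auto intro: monic_in_one monic_in_mult)

lemma monic_in_prod:
  "finite I \<Longrightarrow> (\<And>i. i \<in> I \<Longrightarrow> u i \<in> monic_in A z (m i)) \<Longrightarrow> prod u I \<in> monic_in A z (sum m I)"
  by (induction I rule: finite_induct) (auto intro: monic_in_one monic_in_mult)

lemma adjoin_finite:
  assumes "z ^ N \<in> polys_below A z N"
  shows "adjoin A z \<subseteq> polys_below A z N"
proof -
  have "z ^ i \<in> polys_below A z N" for i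
  proof (induction i)
    case 0
    show ?case
    proof (cases N)
      case 0 then show ?thesis using assms by simp
    next
      case (Suc n)
      then show ?thesis unfolding polys_below_def by (intro aspan_base) (auto intro: image_eqI[of _ _ 0])
    qed
  next
    case (Suc i)
    have "z * v \<in> polys_below A z N" if "v \<in> polys_below A z N" for v
    proof -
      have "z * v \<in> polys_below A z (Suc N)"
        using polys_below_mult[of z z 2 v N] that
        by (simp add: polys_below_def) (metis One_nat_def Suc_1 aspan_base image_eqI lessThan_iff lessI power_one_right)
      then obtain a w where aw: "a \<in> A" "w \<in> polys_below A z N" "z * v = a * z ^ N + w"
        using polys_below_Suc by blast
      then show ?thesis using assms unfolding polys_below_def by (simp add: aspan_add aspan_smult)
    qed
    from this[OF Suc] show ?case by simp
  qed
  then show ?thesis unfolding adjoin_def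
    unfolding polys_below_def by (intro aspan_subset) auto
qed

end

text \<open>
  Nagata's change of variables \<open>y'\<^sub>i = y\<^sub>i - y\<^sub>0 ^ (B ^ i)\<close>: for large \<open>B\<close> the monomials of the relation
  acquire pairwise different degrees in \<open>y\<^sub>0\<close>.
\<close>

lemma Nagata:
  fixes k :: "'a::field set"
  assumes k: "usubfield k" and Ms: "finite Ms" "Ms \<subseteq> exponents d" "\<forall>m\<in>Ms. c m \<in> k \<and> c m \<noteq> 0"
    and nonconst: "\<not> Ms \<subseteq> {\<lambda>_. 0}"
  shows "\<exists>y'. y' 0 = (\<Sum>m\<in>Ms. c m * monom_at d y m) \<and> (\<forall>i\<in>{1..<d}. y' i \<in> gen (k \<union> y ` {..<d})) \<and>
    (\<exists>F. finite F \<and> F \<subseteq> gen (k \<union> y ` {..<d}) \<and>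
      gen (k \<union> y ` {..<d}) \<subseteq> aspan (gen (k \<union> y' ` {..<d})) F)"
proof -
  interpret k: usubfield k by fact
  \<comment> \<open>\<open>B\<close> exceeds every exponent that occurs, so exponents below can be
    read as digits in base \<open>B\<close>.\<close>
  define B where "B = Suc (Max (\<Union>m\<in>Ms. m ` {..<d}))"
  have B: "m i < B" if "m \<in> Ms" "i < d" for m i
    unfolding B_def using Ms(1) that by (intro le_imp_less_Suc Max_ge) auto
  define w where "w = (\<Sum>m\<in>Ms. c m * monom_at d y m)"
  \<comment> \<open>Slot 0 is not shifted but carries the value \<open>w\<close> of the polynomial.
    With \<open>w\<close> a multiple of \<open>h\<close> that multiple becomes a variable; with
    \<open>w = 0\<close> a variable disappears.\<close>
  define y' where "y' i = (if i = 0 then w else y i - y 0 ^ (B ^ i))" for i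
  define R where "R = gen (k \<union> y ` {..<d})"
  define Q where "Q = gen (k \<union> y' ` {..<d})"
  interpret R: usubring R unfolding R_def by (rule usubring_gen)
  interpret Q: usubring Q unfolding Q_def by (rule usubring_gen)
  have kQ: "k \<subseteq> Q" unfolding Q_def using gen_superset[of "k \<union> y' ` {..<d}"] by blast
  have yR: "y i \<in> R" if "i < d" for i unfolding R_def using that by (intro gen_base) auto
  from nonconst obtain m1 where m1: "m1 \<in> Ms" "m1 \<noteq> (\<lambda>_. 0)" by blast
  then obtain i1 where "m1 i1 \<noteq> 0" by auto
  moreover have "m1 \<in> exponents d" using m1 Ms(2) by blast
  ultimately have i1: "i1 < d" "m1 i1 > 0" by (auto simp: exponents_def intro: ccontr[of "i1 < d"])
  then have d: "0 < d" by simp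
  have y'R: "y' i \<in> R" if "i \<in> {1..<d}" for i using that yR d by (auto simp: y'_def)
  have y'Q: "y' i \<in> Q" if "i < d" for i unfolding Q_def using that by (intro gen_base) auto
  have wQ: "w \<in> Q" using y'Q[OF d] by (simp add: y'_def)
  \<comment> \<open>The degree in \<open>y 0\<close> of the monomial with exponents
    \<open>m\<close>, after \<open>y i\<close> is rewritten as \<open>y' i + y 0 ^ (B ^ i)\<close>
    for \<open>i > 0\<close>.\<close>
  define wt where "wt m = (\<Sum>i<d. m i * B ^ i)" for m :: "nat \<Rightarrow> nat"
  have inj: "inj_on wt Ms"
  proof (rule inj_onI)
    fix m n assume mn: "m \<in> Ms" "n \<in> Ms" "wt m = wt n"
    then have "\<forall>i<d. m i = n i" using B digits_unique[of m B d n] by (auto simp: wt_def)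
    moreover have "m i = n i" if "i \<ge> d" for i
    proof -
      have "m \<in> exponents d" "n \<in> exponents d" using mn Ms(2) by auto
      then show ?thesis using that by (simp add: exponents_def)
    qed
    ultimately show "m = n" by (metis ext not_le)
  qed
  have zero_below: "0 \<in> polys_below Q (y 0) n" for n unfolding polys_below_def by (rule aspan_zero)
  have y_monic: "y i \<in> monic_in Q (y 0) (B ^ i)" if "i < d" for i
  proof (cases "i = 0")
    case True
    then show ?thesis using zero_below by (simp add: monic_in_def)
  next
    case False
    have "B > 0" by (simp add: B_def)
    have "y' i * y 0 ^ 0 \<in> polys_below Q (y 0) (B ^ i)"
      unfolding polys_below_def using y'Q[OF that] \<open>B > 0\<close> by (intro aspan_scaled imageI) auto
    then show ?thesis using False by (simp add: monic_in_def y'_def)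
  qed
  have mon_monic: "monom_at d y m \<in> monic_in Q (y 0) (wt m)" for m
    unfolding monom_at_def wt_def using y_monic by (intro Q.monic_in_prod Q.monic_in_power) auto
  have "Max (wt ` Ms) \<in> wt ` Ms" using Ms(1) m1(1) by (intro Max_in) auto
  then obtain ms where "ms \<in> Ms" "wt ms = Max (wt ` Ms)" by auto
  then have ms: "ms \<in> Ms" "\<And>m. m \<in> Ms \<Longrightarrow> wt m \<le> wt ms" using Ms(1) by auto
  define N where "N = wt ms"
  \<comment> \<open>A positive leading degree is what puts \<open>w\<close> itself among the lower
    terms, so that the expression for \<open>w\<close> becomes an equation of degree
    \<open>N\<close> for \<open>y 0\<close>.\<close>
  have "wt m1 > 0"
  proof -
    have "m1 i1 * B ^ i1 \<le> wt m1" unfolding wt_def using i1 by (intro member_le_sum) auto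
    moreover have "B > 0" by (simp add: B_def)
    ultimately show ?thesis using i1 by (metis less_le_trans nat_0_less_mult_iff zero_less_power)
  qed
  then have N: "N > 0" unfolding N_def using ms(2)[OF m1(1)] by simp
  have P_add: "a + b \<in> polys_below Q (y 0) N" if "a \<in> polys_below Q (y 0) N" "b \<in> polys_below Q (y 0) N" for a b
    using that unfolding polys_below_def by (rule aspan_add)
  have other: "c m * monom_at d y m \<in> polys_below Q (y 0) N" if "m \<in> Ms - {ms}" for m
  proof -
    have "wt m < N" using that ms inj unfolding N_def inj_on_def by (metis DiffE insertI1 le_neq_implies_less)
    have "y 0 ^ wt m \<in> polys_below Q (y 0) N"
      unfolding polys_below_def using \<open>wt m < N\<close> by (intro Q.aspan_base) auto
    moreover have "monom_at d y m - y 0 ^ wt m \<in> polys_below Q (y 0) N"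
      using mon_monic[of m] polys_below_mono[of "wt m" N Q "y 0"] \<open>wt m < N\<close> by (auto simp: monic_in_def)
    ultimately have "y 0 ^ wt m + (monom_at d y m - y 0 ^ wt m) \<in> polys_below Q (y 0) N" by (rule P_add)
    then have "monom_at d y m \<in> polys_below Q (y 0) N" by simp
    then show ?thesis using Ms(3)[rule_format, of m] that kQ unfolding polys_below_def by (intro Q.aspan_smult) auto
  qed
  define r where "r = monom_at d y ms - y 0 ^ N"
  have r: "r \<in> polys_below Q (y 0) N" using mon_monic[of ms] by (simp add: r_def N_def monic_in_def)
  define rest where "rest = (\<Sum>m\<in>Ms - {ms}. c m * monom_at d y m)"
  have rest: "rest \<in> polys_below Q (y 0) N"
    unfolding rest_def polys_below_def by (rule aspan_sum) (rule other[unfolded polys_below_def])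
  have "w = c ms * (y 0 ^ N + r) + rest"
    unfolding w_def rest_def r_def using ms(1) Ms(1) by (subst sum.remove[of _ ms]) auto
  then have "c ms * y 0 ^ N = w * 1 - c ms * r - rest" by (simp add: algebra_simps)
  moreover have "w * y 0 ^ 0 \<in> polys_below Q (y 0) N"
    unfolding polys_below_def using wQ N by (intro aspan_scaled imageI) auto
  ultimately have "c ms * y 0 ^ N \<in> polys_below Q (y 0) N"
    using r rest Ms(3)[rule_format, OF ms(1)] kQ unfolding polys_below_def
    by (auto intro!: Q.aspan_diff Q.aspan_smult)
  then have "inverse (c ms) * (c ms * y 0 ^ N) \<in> polys_below Q (y 0) N"
    using Ms(3)[rule_format, OF ms(1)] k.inverse_mem kQ unfolding polys_below_def
    by (intro Q.aspan_smult[of "c ms * y 0 ^ N"]) auto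
  then have "y 0 ^ N \<in> polys_below Q (y 0) N" using Ms(3)[rule_format, OF ms(1)] by (simp add: mult.assoc[symmetric])
  then have fin: "adjoin Q (y 0) \<subseteq> polys_below Q (y 0) N" by (rule Q.adjoin_finite)
  interpret Qy: usubring "adjoin Q (y 0)" by (rule usubring_adjoin) unfold_locales
  have y0: "y 0 \<in> adjoin Q (y 0)" by (rule adjoin_self) unfold_locales
  have "y i \<in> adjoin Q (y 0)" if "i < d" for i
  proof (cases "i = 0")
    case False
    then have "y i = y' i + y 0 ^ (B ^ i)" by (simp add: y'_def)
    then show ?thesis using y0 y'Q[OF that] adjoin_superset[of Q "y 0"] by auto
  qed (use y0 in simp)
  then have "R \<subseteq> adjoin Q (y 0)" unfolding R_def
    using kQ adjoin_superset[of Q "y 0"] by (intro gen_least) (unfold_locales, auto)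
  with fin have "R \<subseteq> aspan Q ((\<lambda>i. y 0 ^ i) ` {..<N})" unfolding polys_below_def by blast
  moreover have "(\<lambda>i. y 0 ^ i) ` {..<N} \<subseteq> R" using yR[OF d] by auto
  ultimately show ?thesis
    using y'R unfolding w_def[symmetric] R_def[symmetric]
    by (intro exI[of _ y'] conjI exI[of _ "(\<lambda>i. y 0 ^ i) ` {..<N}"]) (auto simp: y'_def Q_def)
qed

lemma aspan_trans:
  assumes "usubring Q" "P \<subseteq> aspan Q F" "x \<in> aspan P M"
  shows "x \<in> aspan Q {u * m | u m. u \<in> F \<and> m \<in> M}"
  using assms(3)
proof induction
  case aspan_zero
  show ?case by (rule aspan.aspan_zero)
next
  case (aspan_step x a m)
  interpret usubring Q by fact
  have "a \<in> aspan Q F" "m \<in> aspan Q M" using aspan_step assms(2) by (auto intro: aspan_base)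
  then have "a * m \<in> aspan Q {u * m | u m. u \<in> F \<and> m \<in> M}" by (rule aspan_mult)
  then show ?case using aspan_step by (blast intro: aspan_add)
qed

text \<open>\<open>B\<close> is a finite \<open>P\<close>-module, so \<open>h\<close> satisfies a
  relation over \<open>P\<close>. After cancelling a power of \<open>h\<close>, its lowest nonzero
  coefficient is a multiple of \<open>h\<close>.\<close>

lemma multiple_in_base:
  fixes P :: "'a::field set"
  assumes "usubring P" "usubring B" "P \<subseteq> B" "finite M" "B \<subseteq> aspan P M" "h \<in> B" "h \<noteq> 0"
  shows "\<exists>z\<in>P. z \<noteq> 0 \<and> (\<exists>w\<in>B. z = h * w)"
proof -
  interpret P: usubring P by fact
  interpret B: usubring B by fact
  have "\<exists>c. (\<forall>i. c i \<in> P) \<and> (\<exists>i\<in>{..card M}. c i \<noteq> 0) \<and> (\<Sum>i\<in>{..card M}. c i * h ^ i) = 0"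
    using assms(5,6) by (intro dependent_family[OF assms(1,4)]) auto
  then obtain c where c: "\<And>i. c i \<in> P" "\<exists>i. i \<le> card M \<and> c i \<noteq> 0" "(\<Sum>i\<le>card M. c i * h ^ i) = 0"
    by auto
  define j where "j = (LEAST i. i \<le> card M \<and> c i \<noteq> 0)"
  have j: "j \<le> card M" "c j \<noteq> 0" using LeastI_ex[OF c(2)] by (auto simp: j_def)
  have least: "c i = 0" if "i < j" for i
    using not_less_Least[of i "\<lambda>i. i \<le> card M \<and> c i \<noteq> 0"] that j(1) by (auto simp: j_def[symmetric])
  define w where "w = - (\<Sum>i\<in>{j<..card M}. c i * h ^ (i - Suc j))"
  have "(\<Sum>i\<le>card M. c i * h ^ i) = (\<Sum>i\<in>insert j {j<..card M}. c i * h ^ i)"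
    using j(1) least by (intro sum.mono_neutral_right) (auto simp: not_le not_less intro!: least)
  also have "\<dots> = h ^ j * c j + (\<Sum>i\<in>{j<..card M}. c i * h ^ i)" by simp
  also have "(\<Sum>i\<in>{j<..card M}. c i * h ^ i) = (\<Sum>i\<in>{j<..card M}. h ^ j * (h * (c i * h ^ (i - Suc j))))"
  proof (intro sum.cong refl)
    fix i assume "i \<in> {j<..card M}"
    then have "h ^ i = h ^ j * (h * h ^ (i - Suc j))"
      by (simp add: power_Suc[symmetric] power_add[symmetric] del: power_Suc)
    then show "c i * h ^ i = h ^ j * (h * (c i * h ^ (i - Suc j)))" by simp
  qed
  also have "\<dots> = - (h ^ j * (h * w))" by (simp add: w_def sum_distrib_left)
  finally have "c j = h * w" using c(3) assms(7) by simp
  moreover have "w \<in> B" unfolding w_def using c(1) assms(3,6) by (intro B.uminus_mem B.sum_mem B.mult_mem) auto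
  ultimately show ?thesis using c(1) j(2) by blast
qed

definition finite_over_generated :: "'a::comm_ring_1 set \<Rightarrow> 'a set \<Rightarrow> nat \<Rightarrow> bool" where
  "finite_over_generated k B d \<longleftrightarrow> (\<exists>y M. y ` {..<d} \<subseteq> B \<and> finite M \<and> M \<subseteq> B \<and>
     B \<subseteq> aspan (gen (k \<union> y ` {..<d})) M)"

text \<open>
  Taking the number of variables minimal makes them algebraically independent, so that no theory
  of transcendence degree is needed.
\<close>

theorem Noether_normalization:
  fixes k :: "'a::field set"
  assumes k: "usubfield k" and "finite F" "B = gen (k \<union> F)" "h \<in> B" "h \<noteq> 0"
  shows "inverse h \<in> B \<or> (\<exists>E z M. usubring E \<and> E \<subseteq> B \<and> z \<noteq> 0 \<and> (\<exists>w\<in>B. z = h * w) \<and>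
    transcendental_over E z \<and> finite M \<and> M \<subseteq> B \<and> B \<subseteq> aspan (adjoin E z) M)"
proof -
  interpret k: usubfield k by fact
  have B_sub: "usubring B" unfolding assms(3) by (rule usubring_gen)
  interpret B: usubring B by fact
  have kB: "k \<subseteq> B" unfolding assms(3) using gen_superset[of "k \<union> F"] by blast
  have gen_B: "gen (k \<union> y ` {..<d}) \<subseteq> B" if "y ` {..<d} \<subseteq> B" for y :: "nat \<Rightarrow> 'a" and d
    using that kB B_sub by (intro gen_least) auto
  have ex: "finite_over_generated k B (card F)"
  proof -
    obtain y where "bij_betw y {0..<card F} F" using ex_bij_betw_nat_finite[OF assms(2)] by blast
    then have y: "y ` {..<card F} = F" by (simp add: bij_betw_def lessThan_atLeast0)
    have "B \<subseteq> aspan (gen (k \<union> F)) {1}"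
      using aspan_scaled[of _ B 1 "{1}"] by (auto simp: assms(3))
    then show ?thesis unfolding finite_over_generated_def
      using y gen_superset[of "k \<union> F"] by (intro exI[of _ y] exI[of _ "{1}"]) (auto simp: assms(3))
  qed
  define d where "d = (LEAST d. finite_over_generated k B d)"
  have "finite_over_generated k B d" unfolding d_def using ex by (rule LeastI)
  then obtain y M where y: "y ` {..<d} \<subseteq> B" "finite M" "M \<subseteq> B" "B \<subseteq> aspan (gen (k \<union> y ` {..<d})) M"
    unfolding finite_over_generated_def by blast
  \<comment> \<open>Applied twice: first to an expression for the nonzero multiple \<open>z\<close>
    of \<open>h\<close>, to make \<open>z\<close> a variable, and then to a supposed relation, whose
    value is 0.\<close>
  have change: "\<exists>y' M'. y' 0 = (\<Sum>m\<in>Ms. c m * monom_at d y m) \<and> (\<forall>i\<in>{1..<d}. y' i \<in> B) \<and>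
      finite M' \<and> M' \<subseteq> B \<and> B \<subseteq> aspan (gen (k \<union> y' ` {..<d})) M'"
    if Ms: "finite Ms" "Ms \<subseteq> exponents d" "\<forall>m\<in>Ms. c m \<in> k \<and> c m \<noteq> 0" "\<not> Ms \<subseteq> {\<lambda>_. 0}"
      "y ` {..<d} \<subseteq> B" "finite M" "M \<subseteq> B" "B \<subseteq> aspan (gen (k \<union> y ` {..<d})) M"
    for Ms c y M
  proof -
    obtain y' G where y': "y' 0 = (\<Sum>m\<in>Ms. c m * monom_at d y m)" "\<forall>i\<in>{1..<d}. y' i \<in> gen (k \<union> y ` {..<d})"
      "finite G" "G \<subseteq> gen (k \<union> y ` {..<d})" "gen (k \<union> y ` {..<d}) \<subseteq> aspan (gen (k \<union> y' ` {..<d})) G"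
      using Nagata[OF k Ms(1-4), where y = y] by blast
    let ?M = "{u * m | u m. u \<in> G \<and> m \<in> M}"
    have M: "?M = (\<lambda>(u, m). u * m) ` (G \<times> M)" by auto
    have "finite ?M" unfolding M using y'(3) Ms(6) by simp
    moreover have "?M \<subseteq> B" using gen_B[OF Ms(5)] y'(4) Ms(7) by auto
    moreover have "B \<subseteq> aspan (gen (k \<union> y' ` {..<d})) ?M"
      using Ms(8) aspan_trans[OF usubring_gen y'(5)] by blast
    ultimately show ?thesis using y' gen_B[OF Ms(5)] by blast
  qed
  let ?P = "gen (k \<union> y ` {..<d})"
  obtain z where z: "z \<in> ?P" "z \<noteq> 0" "\<exists>w\<in>B. z = h * w"
    using multiple_in_base[OF usubring_gen B_sub gen_B[OF y(1)] y(2,4) assms(4,5)] by blast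
  obtain Ms c where Ms: "finite Ms" "Ms \<subseteq> exponents d" "\<forall>m\<in>Ms. c m \<in> k \<and> c m \<noteq> 0"
    "z = (\<Sum>m\<in>Ms. c m * monom_at d y m)"
    using gen_monom_rep[OF k.usubring_axioms z(1)] by blast
  show ?thesis
  proof (cases "Ms \<subseteq> {\<lambda>_. 0}")
    \<comment> \<open>A constant \<open>z\<close> is a nonzero element of the field
      \<open>k\<close>, so its divisor \<open>h\<close> is a unit of \<open>B\<close>.\<close>
    case True
    have "z \<in> k" unfolding Ms(4)
    proof (rule k.sum_mem)
      fix m assume "m \<in> Ms"
      then have "m = (\<lambda>_. 0)" using True by blast
      then show "c m * monom_at d y m \<in> k" using Ms(3)[rule_format, OF \<open>m \<in> Ms\<close>] by (simp add: monom_at_def)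
    qed
    then have "inverse z \<in> B" using k.inverse_mem kB by blast
    moreover obtain w where w: "w \<in> B" "z = h * w" using z(3) by blast
    ultimately have "w * inverse z \<in> B" by blast
    moreover have "w * inverse z = inverse h" using w z(2) by (simp add: field_simps)
    ultimately show ?thesis by simp
  next
    case False
    obtain y' M' where y': "y' 0 = z" "\<forall>i\<in>{1..<d}. y' i \<in> B" "finite M'" "M' \<subseteq> B"
      "B \<subseteq> aspan (gen (k \<union> y' ` {..<d})) M'"
      using change[OF Ms(1-3) False y] unfolding Ms(4)[symmetric] by blast
    have "d \<noteq> 0"
    proof
      assume "d = 0"
      then have "exponents d = {\<lambda>_. 0}" by (auto simp: exponents_def)
      then show False using Ms(2) False by simp
    qed
    then obtain d' where d': "d = Suc d'" by (cases d) auto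
    have zB: "z \<in> B" using z(1) gen_B[OF y(1)] by blast
    have y'B: "y' ` {..<d} \<subseteq> B"
    proof
      fix v assume "v \<in> y' ` {..<d}"
      then obtain i where "i < d" "v = y' i" by auto
      then show "v \<in> B" using y'(1,2) zB by (cases "i = 0") auto
    qed
    \<comment> \<open>\<open>z\<close> is now variable 0, and the remaining variables generate
      \<open>E\<close>.\<close>
    define t where "t i = y' (Suc i)" for i
    define E where "E = gen (k \<union> t ` {..<d'})"
    have split: "k \<union> y' ` {..<d} = insert z (k \<union> t ` {..<d'})"
      unfolding d' t_def y'(1)[symmetric] by (simp add: lessThan_Suc_eq_insert_0 image_image)
    have "transcendental_over E z"
      unfolding transcendental_over_def
    proof (intro allI impI)
      fix n c i assume c: "\<forall>i. c i \<in> E" "(\<Sum>i<n. c i * z ^ i) = 0" "i < n"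
      show "c i = 0"
      proof (rule ccontr)
        assume ci: "c i \<noteq> 0"
        have "\<forall>j. \<exists>Ms a. finite Ms \<and> Ms \<subseteq> exponents d' \<and> (\<forall>m\<in>Ms. a m \<in> k \<and> a m \<noteq> 0) \<and>
            c j = (\<Sum>m\<in>Ms. a m * monom_at d' t m)"
          by (intro allI gen_monom_rep k.usubring_axioms c(1)[unfolded E_def, rule_format])
        from choice[OF this] obtain Y where "\<forall>j. \<exists>a. finite (Y j) \<and> Y j \<subseteq> exponents d' \<and>
            (\<forall>m\<in>Y j. a m \<in> k \<and> a m \<noteq> 0) \<and> c j = (\<Sum>m\<in>Y j. a m * monom_at d' t m)" ..
        from choice[OF this] obtain a where Ya: "\<forall>j. finite (Y j) \<and> Y j \<subseteq> exponents d' \<and>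
            (\<forall>m\<in>Y j. a j m \<in> k \<and> a j m \<noteq> 0) \<and> c j = (\<Sum>m\<in>Y j. a j m * monom_at d' t m)" ..
        have Y: "finite (Y j)" "Y j \<subseteq> exponents d'" "\<forall>m\<in>Y j. a j m \<in> k \<and> a j m \<noteq> 0"
          "c j = (\<Sum>m\<in>Y j. a j m * monom_at d' t m)" for j
          using Ya[rule_format, of j] by auto
        define S where "S = Sigma {..<n} Y"
        \<comment> \<open>\<open>\<gamma>\<close> prepends the exponent \<open>j\<close> of
          \<open>z\<close> to the exponents \<open>m\<close> of the other variables, which turns the
          relation for \<open>z\<close> over \<open>E\<close> into one for \<open>y'\<close> over
          \<open>k\<close>.\<close>
        define \<gamma> where "\<gamma> = (\<lambda>(j, m). case_nat j m :: nat \<Rightarrow> nat)"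
        define b where "b m = a (m 0) (\<lambda>i. m (Suc i))" for m
        have inj: "inj_on \<gamma> S"
          by (rule inj_on_inverseI[where g = "\<lambda>m. (m 0, \<lambda>i. m (Suc i))"]) (auto simp: \<gamma>_def)
        have mon: "monom_at d y' (\<gamma> (j, m)) = z ^ j * monom_at d' t m" for j m
          unfolding monom_at_def d' prod.lessThan_Suc_shift by (simp add: \<gamma>_def y'(1) t_def)
        have b\<gamma>: "b (\<gamma> (j, m)) = a j m" for j m by (simp add: b_def \<gamma>_def)
        have fS: "finite S" unfolding S_def using Y(1) by auto
        have sum0: "(\<Sum>m\<in>\<gamma> ` S. b m * monom_at d y' m) = 0"
        proof -
          have "(\<Sum>m\<in>\<gamma> ` S. b m * monom_at d y' m) = (\<Sum>p\<in>S. b (\<gamma> p) * monom_at d y' (\<gamma> p))"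
            by (simp add: sum.reindex[OF inj])
          also have "\<dots> = (\<Sum>(j, m)\<in>S. a j m * (z ^ j * monom_at d' t m))"
            by (intro sum.cong) (auto simp: mon b\<gamma>)
          also have "\<dots> = (\<Sum>j<n. \<Sum>m\<in>Y j. a j m * (z ^ j * monom_at d' t m))"
            unfolding S_def using Y(1) by (intro sum.Sigma[symmetric]) auto
          also have "\<dots> = (\<Sum>j<n. c j * z ^ j)"
            unfolding Y(4) sum_distrib_right by (intro sum.cong) (auto simp: ac_simps)
          finally show ?thesis using c(2) by simp
        qed
        have b: "\<forall>m\<in>\<gamma> ` S. b m \<in> k \<and> b m \<noteq> 0"
          using Y(3) by (auto simp: b_def \<gamma>_def S_def)
        have exps: "\<gamma> ` S \<subseteq> exponents d"
          using Y(2) unfolding S_def \<gamma>_def d' exponents_def by (force split: nat.split)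
        \<comment> \<open>A relation with only the constant monomial would say that its nonzero
          coefficient is 0.\<close>
        have nonconst: "\<not> \<gamma> ` S \<subseteq> {\<lambda>_. 0}"
        proof
          assume sub: "\<gamma> ` S \<subseteq> {\<lambda>_. 0}"
          have "Y i \<noteq> {}" using ci Y(4)[of i] by auto
          then have "S \<noteq> {}" using c(3) by (auto simp: S_def)
          then have "\<gamma> ` S = {\<lambda>_. 0}" using subset_singletonD[OF sub] by simp
          then show False using sum0 b by (auto simp: monom_at_def)
        qed
        obtain y'' M'' where y'': "y'' 0 = 0" "\<forall>i\<in>{1..<d}. y'' i \<in> B" "finite M''" "M'' \<subseteq> B"
          "B \<subseteq> aspan (gen (k \<union> y'' ` {..<d})) M''"
          using change[OF finite_imageI[OF fS] exps b nonconst y'B y'(3-5)] unfolding sum0 by blast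
        have "gen (k \<union> y'' ` {..<d}) \<subseteq> gen (k \<union> (\<lambda>i. y'' (Suc i)) ` {..<d'})" (is "_ \<subseteq> gen ?V")
        proof (rule gen_least[OF usubring_gen])
          interpret V: usubring "gen ?V" by (rule usubring_gen)
          have "k \<union> y'' ` {..<d} = insert 0 ?V"
            unfolding d' y''(1)[symmetric] by (simp add: lessThan_Suc_eq_insert_0 image_image)
          then show "k \<union> y'' ` {..<d} \<subseteq> gen ?V" using gen_superset[of ?V] by auto
        qed
        from aspan_mono[OF this order.refl, of M''] y''(5) have "B \<subseteq> aspan (gen ?V) M''" by blast
        then have "finite_over_generated k B d'"
          unfolding finite_over_generated_def using y''(2-4)
          by (intro exI[of _ "\<lambda>i. y'' (Suc i)"] exI[of _ M'']) (auto simp: d')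
        then have "d \<le> d'" unfolding d_def by (rule Least_le)
        then show False by (simp add: d')
      qed
    qed
    moreover have "E \<subseteq> B" unfolding E_def using kB y'B by (intro gen_least B_sub) (auto simp: t_def d')
    moreover have "B \<subseteq> aspan (adjoin E z) M'"
      using y'(5) unfolding split gen_insert E_def .
    ultimately show ?thesis using z(2,3) y'(3,4) usubring_gen[of "k \<union> t ` {..<d'}"] unfolding E_def by blast
  qed
qed

section \<open>Irrational orders\<close>

text \<open>\<open>W\<close> lives on the whole ambient field, so a power of \<open>h\<close> can be
  cancelled with an exact loss of order even when \<open>inverse h\<close> is not in
  \<open>A\<close>.\<close>

lemma (in order_filtration) inverse_h_in_W: "inverse h \<in> W (-1)"
proof (rule WI)
  fix c :: real assume "c < -1"
  have "inverse h ^ n * h powi (- \<lceil>real n * c\<rceil>) \<in> A" for n :: nat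
  proof -
    have "real n * c \<le> real n * (-1)" using \<open>c < -1\<close> by (intro mult_left_mono) auto
    then have "\<lceil>real n * c\<rceil> \<le> - int n" by (simp add: ceiling_le_iff)
    moreover have "inverse h ^ n * h powi (- \<lceil>real n * c\<rceil>) = h powi (- int n - \<lceil>real n * c\<rceil>)"
      using h_nz by (simp add: power_int_diff power_int_minus divide_inverse power_inverse)
    ultimately show ?thesis by (simp add: powi_mem)
  qed
  then show "\<exists>d\<in>A - {0}. \<forall>n::nat. d * inverse h ^ n * h powi (- \<lceil>real n * c\<rceil>) \<in> A"
    by (intro bexI[of _ 1]) auto
qed

text \<open>
  A relation \<open>\<Sum> c\<^sub>i\<^sub>j f\<^sup>i h\<^sup>j = 0\<close> over \<open>E\<close> has only one term of least weight \<open>i * \<alpha> + j\<close>, because \<open>\<alpha>\<close> is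
  irrational. With \<open>u\<close> its coefficient, \<open>u * f\<close> therefore has order strictly above \<open>\<alpha>\<close>, and so has
  \<open>z * f\<close>; as \<open>u\<close> and \<open>z\<close> form a regular sequence, so has \<open>f\<close>.
\<close>

theorem W_irrational_gap:
  fixes k :: "'a::field set" and \<alpha> :: real
  assumes "usubfield k" "finite F" "B = gen (k \<union> F)" "mult_subset B S" "0 \<notin> S"
    and "h \<in> B" "h \<noteq> 0" "f \<in> B" "\<alpha> \<notin> \<rat>"
    and f: "f \<in> order_filtration.W (loc S B) h \<alpha>"
  shows "\<exists>\<alpha>'>\<alpha>. f \<in> order_filtration.W (loc S B) h \<alpha>'"
proof -
  define A where "A = loc S B"
  interpret S: mult_subset B S by fact
  interpret usubring A unfolding A_def by (rule S.usubring_loc)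
  have BA: "B \<subseteq> A" unfolding A_def by (rule S.subset_loc)
  interpret order_filtration A h using BA assms(6,7) by unfold_locales auto
  have f: "f \<in> W \<alpha>" using f by (simp add: A_def)
  have fA: "f \<in> A" using assms(8) BA by blast
  from Noether_normalization[OF assms(1-3,6,7)]
  have "\<exists>\<alpha>'>\<alpha>. f \<in> W \<alpha>'"
  proof (elim disjE exE conjE)
    \<comment> \<open>When \<open>h\<close> is a unit, elements of \<open>A\<close> are divisible by
      all powers of \<open>h\<close>, and any larger level will do.\<close>
    assume "inverse h \<in> B"
    then have inv: "inverse h \<in> A" using BA by blast
    have "f \<in> W (\<alpha> + 1)"
    proof (rule WI)
      fix c
      have "f ^ n * h powi (- \<lceil>real n * c\<rceil>) \<in> A" for n :: nat
        using fA inv h_mem by (auto simp: power_int_def)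
      then show "\<exists>d\<in>A - {0}. \<forall>n::nat. d * f ^ n * h powi (- \<lceil>real n * c\<rceil>) \<in> A"
        by (intro bexI[of _ 1]) auto
    qed
    then show ?thesis by (intro exI[of _ "\<alpha> + 1"]) auto
  next
    fix E z M
    assume E: "usubring E" "E \<subseteq> B" "z \<noteq> 0" "\<exists>w\<in>B. z = h * w" "transcendental_over E z"
      "finite M" "M \<subseteq> B" "B \<subseteq> aspan (adjoin E z) M"
    interpret E: usubring E by fact
    obtain w where w: "w \<in> B" "z = h * w" using E(4) by blast
    have zB: "z \<in> B" using w assms(6) by simp
    obtain N c where c: "\<And>p. c p \<in> E" "\<exists>p\<in>{..<N} \<times> {..<N}. c p \<noteq> 0"
      "(\<Sum>(i, j)\<in>{..<N} \<times> {..<N}. c (i, j) * (f ^ i * h ^ j)) = 0"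
      using algebraic_relation[OF E(1) S.usubring_axioms E(6-8) assms(8,6)] by blast
    define Ps where "Ps = {p \<in> {..<N} \<times> {..<N}. c p \<noteq> 0}"
    have Ps: "finite Ps" "Ps \<noteq> {}" using c(2) by (auto simp: Ps_def)
    define T where "T p = c p * (f ^ fst p * h ^ snd p)" for p
    have sumT: "sum T Ps = 0"
    proof -
      have "sum T Ps = (\<Sum>p\<in>{..<N} \<times> {..<N}. T p)"
        unfolding Ps_def T_def by (intro sum.mono_neutral_left) auto
      then show ?thesis using c(3) by (simp add: T_def case_prod_beta)
    qed
    define wt where "wt p = real (fst p) * \<alpha> + real (snd p)" for p :: "nat \<times> nat"
    have inj: "p = q" if "wt p = wt q" for p q
    proof -
      have eq: "(real (fst p) - real (fst q)) * \<alpha> = real (snd q) - real (snd p)"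
        using that by (simp add: wt_def algebra_simps)
      have "fst p = fst q"
      proof (rule ccontr)
        assume "fst p \<noteq> fst q"
        then have "\<alpha> = (real (snd q) - real (snd p)) / (real (fst p) - real (fst q))"
          using eq by (simp add: field_simps)
        then show False using assms(9) by (metis Rats_diff Rats_divide Rats_of_nat)
      qed
      with eq show ?thesis by (simp add: prod_eq_iff)
    qed
    have "Min (wt ` Ps) \<in> wt ` Ps" using Ps by (intro Min_in) auto
    then obtain p0 where p0: "p0 \<in> Ps" "wt p0 = Min (wt ` Ps)" by auto
    have least: "wt p0 < wt p" if "p \<in> Ps - {p0}" for p
    proof -
      have "wt p0 \<le> wt p" using that Ps(1) p0(2) by simp
      moreover have "wt p0 \<noteq> wt p" using inj[of p0 p] that by blast
      ultimately show ?thesis by simp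
    qed
    \<comment> \<open>\<open>\<epsilon>\<close> is the distance from the least weight to the next
      one, or an arbitrary value if \<open>p0\<close> is the only term.\<close>
    have "\<exists>\<epsilon>>0. \<forall>p\<in>Ps - {p0}. wt p0 + \<epsilon> \<le> wt p"
    proof (cases "Ps - {p0} = {}")
      case True
      then show ?thesis by (intro exI[of _ 1]) auto
    next
      case False
      define m where "m = Min (wt ` (Ps - {p0}))"
      have "m \<in> wt ` (Ps - {p0})" unfolding m_def using Ps(1) False by (intro Min_in) auto
      then have "m > wt p0" using least by auto
      moreover have "m \<le> wt p" if "p \<in> Ps - {p0}" for p
        unfolding m_def using Ps(1) that by (intro Min_le) auto
      ultimately show ?thesis by (intro exI[of _ "m - wt p0"]) auto
    qed
    then obtain \<epsilon> where \<epsilon>: "\<epsilon> > 0" "\<And>p. p \<in> Ps - {p0} \<Longrightarrow> wt p0 + \<epsilon> \<le> wt p" by blast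
    obtain i j where ij: "p0 = (i, j)" by force
    define u where "u = c (i, j)"
    have u: "u \<in> E" "u \<noteq> 0" using c(1) p0(1) by (auto simp: u_def Ps_def ij)
    then have uA: "u \<in> A" using E(2) BA by blast
    have hpow: "h ^ m \<in> W (real m)" for m using W_power[OF h_in_W, of m] by simp
    have invpow: "inverse h ^ m \<in> W (- real m)" for m using W_power[OF inverse_h_in_W, of m] by simp
    have "T p \<in> W (wt p0 + \<epsilon>)" if "p \<in> Ps - {p0}" for p
    proof -
      have "f ^ fst p * h ^ snd p \<in> W (wt p)"
        unfolding wt_def by (intro W_mult W_power f hpow)
      then have "T p \<in> W (wt p)" unfolding T_def
        using c(1)[of p] E(2) BA by (intro W_smult[of "c p"]) auto
      then show ?thesis using W_mono[OF \<epsilon>(2)[OF that]] by blast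
    qed
    then have "(-1) * sum T (Ps - {p0}) \<in> W (wt p0 + \<epsilon>)" by (intro W_smult W_sum) auto
    moreover have "T p0 = (-1) * sum T (Ps - {p0})"
      using sumT sum.remove[OF Ps(1) p0(1), of T] by (simp add: eq_neg_iff_add_eq_0)
    ultimately have "T p0 \<in> W (wt p0 + \<epsilon>)" by simp
    from W_mult[OF this invpow[of j]] have "T p0 * inverse h ^ j \<in> W (real i * \<alpha> + \<epsilon>)"
      by (simp add: wt_def ij)
    also have "T p0 * inverse h ^ j = u * f ^ i"
      using h_nz by (simp add: T_def ij u_def power_inverse)
    finally have ufi: "u * f ^ i \<in> W (real i * \<alpha> + \<epsilon>)" .
    have "\<exists>\<alpha>'>\<alpha>. u * f \<in> W \<alpha>'"
    proof (cases "i = 0")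
      case True
      with ufi have "u \<in> W \<epsilon>" by simp
      from W_mult[OF this f] show ?thesis using \<epsilon>(1) by (intro exI[of _ "\<epsilon> + \<alpha>"]) auto
    next
      case False
      \<comment> \<open>The factor completes \<open>u * f ^ i\<close> to an \<open>i\<close>-th
        power; spreading \<open>\<epsilon>\<close> over \<open>i\<close> factors still leaves a
        positive gain.\<close>
      have "u ^ (i - 1) * (u * f ^ i) \<in> W (real i * \<alpha> + \<epsilon>)"
        using ufi uA by (intro W_smult[of "u ^ (i - 1)"]) auto
      moreover have "u ^ (i - 1) * (u * f ^ i) = (u * f) ^ i"
        using False by (cases i) (auto simp: power_mult_distrib)
      moreover have "real i * \<alpha> + \<epsilon> = real i * (\<alpha> + \<epsilon> / real i)" using False by (simp add: algebra_simps)
      ultimately have "(u * f) ^ i \<in> W (real i * (\<alpha> + \<epsilon> / real i))" by simp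
      moreover have "u * f \<in> A" using uA fA by simp
      ultimately have "u * f \<in> W (\<alpha> + \<epsilon> / real i)" using False W_root[of "u * f" i] by blast
      then show ?thesis using \<epsilon>(1) False by (intro exI[of _ "\<alpha> + \<epsilon> / real i"]) auto
    qed
    then obtain \<alpha>1 where \<alpha>1: "\<alpha>1 > \<alpha>" "u * f \<in> W \<alpha>1" by blast
    \<comment> \<open>\<open>z * f = w * (f * h)\<close> has order at least
      \<open>\<alpha> + 1\<close>, so the minimum is a level reached by both \<open>u * f\<close>
      and \<open>z * f\<close>.\<close>
    define \<alpha>' where "\<alpha>' = min \<alpha>1 (\<alpha> + 1)"
    have uf: "u * f \<in> W \<alpha>'" using \<alpha>1(2) W_mono[of \<alpha>' \<alpha>1] by (auto simp: \<alpha>'_def)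
    have "w * (f * h) \<in> W (\<alpha> + 1)" using w(1) BA f h_in_W by (intro W_smult[of w] W_mult) auto
    then have zf: "z * f \<in> W \<alpha>'" using W_mono[of \<alpha>' "\<alpha> + 1"] by (auto simp: \<alpha>'_def w(2) ac_simps)
    let ?P = "adjoin E z"
    have P_sub: "usubring ?P" by (rule usubring_adjoin) fact
    interpret P: usubring ?P by fact
    have PB: "?P \<subseteq> B" using E(1,2) zB S.usubring_axioms by (intro adjoin_least) auto
    obtain e D where e: "e \<subseteq> M" "independent_over ?P e" "D \<in> ?P" "D \<noteq> 0"
      "\<And>x. x \<in> aspan ?P M \<Longrightarrow> D * x \<in> aspan ?P e"
      using free_submodule[OF P_sub E(6)] by blast
    have fe: "finite e" using e(1) E(6) by (rule finite_subset)
    have eB: "aspan ?P e \<subseteq> B"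
      using aspan_mono[OF PB order.refl, of e] S.aspan_subset_self[of e] e(1) E(7) by blast
    have "f \<in> W \<alpha>'"
    proof (rule WI)
      fix b assume "b < \<alpha>'"
      obtain d where d: "d \<in> A" "d \<noteq> 0" "\<And>n::nat. d * (u * f) ^ n * h powi (- \<lceil>real n * b\<rceil>) \<in> A"
        using WD[OF uf \<open>b < \<alpha>'\<close>] by metis
      obtain d' where d': "d' \<in> A" "d' \<noteq> 0" "\<And>n::nat. d' * (z * f) ^ n * h powi (- \<lceil>real n * b\<rceil>) \<in> A"
        using WD[OF zf \<open>b < \<alpha>'\<close>] by metis
      have "(D * d * d') * f ^ n * h powi (- \<lceil>real n * b\<rceil>) \<in> A" for n :: nat
      proof -
        \<comment> \<open>With both multipliers in \<open>x\<close>, the products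
          \<open>u ^ n * x\<close> and \<open>z ^ n * x\<close> lie in \<open>A\<close>.
          Denominators \<open>s\<close>, \<open>s'\<close> move them into \<open>B\<close>, and
          \<open>D\<close> into the free module on \<open>e\<close>, where \<open>u ^ n\<close> and
          \<open>z ^ n\<close> can be removed. The denominators may depend on \<open>n\<close>
          because they are invertible in \<open>A\<close>; \<open>D\<close>, \<open>d\<close> and
          \<open>d'\<close> do not depend on it.\<close>
        define x where "x = d * d' * f ^ n * h powi (- \<lceil>real n * b\<rceil>)"
        have "u ^ n * x = d' * (d * (u * f) ^ n * h powi (- \<lceil>real n * b\<rceil>))"
          by (simp add: x_def power_mult_distrib)
        then have "u ^ n * x \<in> A" using d d'(1) by (simp only: mult_mem)
        then obtain s where s: "s \<in> S" "s * (u ^ n * x) \<in> B" by (auto simp: A_def loc_def)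
        have "z ^ n * x = d * (d' * (z * f) ^ n * h powi (- \<lceil>real n * b\<rceil>))"
          by (simp add: x_def power_mult_distrib)
        then have "z ^ n * x \<in> A" using d(1) d' by (simp only: mult_mem)
        then obtain s' where s': "s' \<in> S" "s' * (z ^ n * x) \<in> B" by (auto simp: A_def loc_def)
        define y where "y = D * (s * s' * x)"
        have "s' * (s * (u ^ n * x)) \<in> B" "s * (s' * (z ^ n * x)) \<in> B"
          using s s' S.S_subset by blast+
        then have "D * (s' * (s * (u ^ n * x))) \<in> aspan ?P e" "D * (s * (s' * (z ^ n * x))) \<in> aspan ?P e"
          using e(5) E(8) by blast+
        then have "u ^ n * y \<in> aspan ?P e" "z ^ n * y \<in> aspan ?P e" by (simp_all add: y_def ac_simps)
        then have "y \<in> aspan ?P e"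
          using free_module_Hartogs[OF E(1,5,3) fe e(2), of "u ^ n" y n] u by auto
        then have "(s * s') * (D * x) \<in> B" using eB by (auto simp: y_def ac_simps)
        then have "D * x \<in> A" unfolding A_def using S.S_mult[OF s(1) s'(1)] by (rule S.locI[rotated])
        then show ?thesis by (simp add: x_def ac_simps)
      qed
      moreover have "D * d * d' \<in> A - {0}" using d d' e(3,4) PB BA by auto
      ultimately show "\<exists>d\<in>A - {0}. \<forall>n::nat. d * f ^ n * h powi (- \<lceil>real n * b\<rceil>) \<in> A" by blast
    qed
    moreover have "\<alpha>' > \<alpha>" using \<alpha>1(1) by (simp add: \<alpha>'_def)
    ultimately show ?thesis by blast
  qed
  then show ?thesis by (simp add: A_def)
qed

section \<open>Idealistic filtrations\<close>

lemma is_ring_homD: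
  assumes "is_ring_hom \<eta>"
  shows "\<eta> (x + y) = \<eta> x + \<eta> y" "\<eta> (x * y) = \<eta> x * \<eta> y" "\<eta> 1 = 1" "\<eta> 0 = 0" "\<eta> (- x) = - \<eta> x"
proof -
  show add: "\<eta> (x + y) = \<eta> x + \<eta> y" for x y
    using assms by (auto simp: ring_hom_def ring_of_type_algebra_def)
  show "\<eta> (x * y) = \<eta> x * \<eta> y" "\<eta> 1 = 1"
    using assms by (auto simp: ring_hom_def ring_of_type_algebra_def)
  show zero: "\<eta> 0 = 0" using add[of 0 0] by simp
  show "\<eta> (- x) = - \<eta> x" using add[of x "- x"] zero by (simp add: eq_neg_iff_add_eq_0 add.commute)
qed

lemma a_inv_ring_of_type_algebra:
  "a_inv (ring_of_type_algebra :: 'a::comm_ring_1 ring) x = - x"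
proof -
  interpret R: ring "ring_of_type_algebra :: 'a ring" by (rule ring_from_type_algebra)
  show ?thesis
    by (rule R.minus_equality) (auto simp: ring_of_type_algebra_def)
qed

lemma is_ideal_iff:
  fixes J :: "'a::comm_ring_1 set"
  shows "is_ideal J \<longleftrightarrow> 0 \<in> J \<and> (\<forall>x\<in>J. \<forall>y\<in>J. x + y \<in> J) \<and> (\<forall>r. \<forall>x\<in>J. r * x \<in> J)"
proof
  assume i: "is_ideal J"
  have a: "additive_subgroup J ring_of_type_algebra" using i by (rule ideal.axioms(1))
  show "0 \<in> J \<and> (\<forall>x\<in>J. \<forall>y\<in>J. x + y \<in> J) \<and> (\<forall>r. \<forall>x\<in>J. r * x \<in> J)"
    using additive_subgroup.zero_closed[OF a] additive_subgroup.a_closed[OF a] ideal.I_l_closed[OF i]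
    by (simp add: ring_of_type_algebra_def)
next
  assume J: "0 \<in> J \<and> (\<forall>x\<in>J. \<forall>y\<in>J. x + y \<in> J) \<and> (\<forall>r. \<forall>x\<in>J. r * x \<in> J)"
  interpret R: ring "ring_of_type_algebra :: 'a ring" by (rule ring_from_type_algebra)
  have "- x \<in> J" if "x \<in> J" for x using J that by (metis mult_minus1)
  then have "m_inv (add_monoid ring_of_type_algebra) x \<in> J" if "x \<in> J" for x
    using that a_inv_ring_of_type_algebra[of x] by (simp add: a_inv_def)
  then have "subgroup J (add_monoid ring_of_type_algebra)"
    using J by (intro subgroup.intro) (auto simp: ring_of_type_algebra_def)
  moreover have "x * r \<in> J" if "x \<in> J" for x r using J that by (metis mult.commute)
  ultimately show "is_ideal J"
    using J by (intro idealI ring_from_type_algebra) (auto simp: ring_of_type_algebra_def)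
qed

lemma idealistic_filtration_iff:
  "idealistic_filtration J \<longleftrightarrow>
    (\<forall>f. (f, 0) \<in> J) \<and> (\<forall>a. (0, a) \<in> J) \<and>
    (\<forall>f g a. (f, a) \<in> J \<longrightarrow> (g, a) \<in> J \<longrightarrow> (f + g, a) \<in> J) \<and>
    (\<forall>r f a. (f, a) \<in> J \<longrightarrow> (r * f, a) \<in> J) \<and>
    (\<forall>f g a b. (f, a) \<in> J \<longrightarrow> (g, b) \<in> J \<longrightarrow> (f * g, a + b) \<in> J) \<and>
    (\<forall>f a b. b \<le> a \<longrightarrow> (f, a) \<in> J \<longrightarrow> (f, b) \<in> J)"
  unfolding idealistic_filtration_def is_ideal_iff level_def subset_eq by auto

context
  fixes J :: "('r::comm_ring_1 \<times> real) set"
  assumes J: "idealistic_filtration J"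
begin

lemma filtration_level_0: "(f, 0) \<in> J"
  using J[unfolded idealistic_filtration_iff, THEN conjunct1] by blast

lemma filtration_zero: "(0, a) \<in> J"
  using J[unfolded idealistic_filtration_iff, THEN conjunct2, THEN conjunct1] by blast

lemma filtration_add: "(f, a) \<in> J \<Longrightarrow> (g, a) \<in> J \<Longrightarrow> (f + g, a) \<in> J"
  using J[unfolded idealistic_filtration_iff, THEN conjunct2, THEN conjunct2, THEN conjunct1] by blast

lemma filtration_smult: "(f, a) \<in> J \<Longrightarrow> (r * f, a) \<in> J"
  using J[unfolded idealistic_filtration_iff, THEN conjunct2, THEN conjunct2, THEN conjunct2, THEN conjunct1]
  by blast

lemma filtration_mult: "(f, a) \<in> J \<Longrightarrow> (g, b) \<in> J \<Longrightarrow> (f * g, a + b) \<in> J"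
  using J unfolding idealistic_filtration_def level_def by simp

lemma filtration_mono: "(f, a) \<in> J \<Longrightarrow> b \<le> a \<Longrightarrow> (f, b) \<in> J"
  using J unfolding idealistic_filtration_def level_def by blast

end

lemma filtration_sum:
  "idealistic_filtration J \<Longrightarrow> (\<And>i. i \<in> U \<Longrightarrow> (g i, a) \<in> J) \<Longrightarrow> (sum g U, a) \<in> J"
  by (induction U rule: infinite_finite_induct) (auto intro: filtration_zero filtration_add)

lemma filtration_power:
  assumes "idealistic_filtration J" "(f, a) \<in> J" shows "(f ^ n, real n * a) \<in> J"
proof (induction n)
  case 0
  show ?case using filtration_level_0[OF assms(1)] by simp
next
  case (Suc n)
  from filtration_mult[OF assms this] show ?case by (simp add: algebra_simps)
qed

text \<open>
  If \<open>f\<close> has level \<open>u \<le> a\<close>, an integral equation of level \<open>a\<close> puts \<open>f ^ n\<close> into level \<open>a + (n - 1) * u\<close>.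
  Extracting the root and iterating gives levels that converge to \<open>a\<close>.
\<close>

theorem R_saturated_imp_integrally_closed:
  assumes J: "idealistic_filtration J" and sat: "R_saturated J"
  shows "integrally_closed J"
  unfolding integrally_closed_def
proof (intro allI impI)
  fix f and a :: real assume "integral_over J f a"
  then obtain n c where n: "n \<ge> 1" and c: "\<forall>i\<in>{1..n}. (c i, real i * a) \<in> J"
    and eq: "f ^ n + (\<Sum>i=1..n. c i * f ^ (n - i)) = 0"
    unfolding integral_over_def by (elim exE conjE bexE) blast
  \<comment> \<open>Each step shrinks the distance of the level from \<open>a\<close> by the factor
    \<open>q\<close>; for \<open>n = 1\<close> it reaches \<open>a\<close> at once.\<close>
  define q where "q = (real n - 1) / real n"
  have q: "0 \<le> q" "q < 1" using n by (auto simp: q_def)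
  \<comment> \<open>The iteration starts at \<open>u 0 = min 0 a\<close>, a level that contains the
    whole ring.\<close>
  define e where "e = a - min 0 a"
  have e: "e \<ge> 0" by (simp add: e_def)
  define u where "u l = a - e * q ^ l" for l :: nat
  have "(f, u l) \<in> J" for l
  proof (induction l)
    case 0
    show ?case using filtration_mono[OF J filtration_level_0[OF J], of "u 0"] by (simp add: u_def e_def)
  next
    case (Suc l)
    have ul: "u l \<le> a" using e q by (simp add: u_def)
    have "(c i * f ^ (n - i), real n * u (Suc l)) \<in> J" if i: "i \<in> {1..n}" for i
    proof (rule filtration_mono[OF J])
      show "(c i * f ^ (n - i), real i * a + real (n - i) * u l) \<in> J"
        using c i by (intro filtration_mult[OF J] filtration_power[OF J Suc]) auto
      have "real n * u (Suc l) = real n * a - (real n - 1) * (e * q ^ l)"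
        using n by (simp add: u_def q_def field_simps)
      also have "\<dots> = a + (real n - 1) * u l" by (simp add: u_def algebra_simps)
      \<comment> \<open>As \<open>u l \<le> a\<close>, the term \<open>i = 1\<close> has the lowest
        level.\<close>
      also have "\<dots> \<le> a + (real n - 1) * u l + (real i - 1) * (a - u l)" using i ul by simp
      also have "\<dots> = real i * a + real (n - i) * u l"
        using i by (simp add: of_nat_diff algebra_simps)
      finally show "real n * u (Suc l) \<le> real i * a + real (n - i) * u l" .
    qed
    then have "(\<Sum>i=1..n. c i * f ^ (n - i), real n * u (Suc l)) \<in> J"
      by (rule filtration_sum[OF J])
    from filtration_smult[OF J this, of "-1"]
    have "((-1) * (\<Sum>i=1..n. c i * f ^ (n - i)), real n * u (Suc l)) \<in> J" .
    moreover have "f ^ n = (-1) * (\<Sum>i=1..n. c i * f ^ (n - i))" using eq by (simp add: eq_neg_iff_add_eq_0)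
    ultimately have "(f ^ n, real n * u (Suc l)) \<in> J" by simp
    then show ?case using sat n unfolding R_saturated_def by (metis One_nat_def Suc_le_lessD)
  qed
  then have levels: "\<forall>l. (f, u l) \<in> J" ..
  have "u \<longlonglongrightarrow> a - e * 0"
    unfolding u_def using q by (intro tendsto_diff tendsto_const tendsto_mult LIMSEQ_power_zero) auto
  then have "u \<longlonglongrightarrow> a" by simp
  with levels show "(f, a) \<in> J" using sat unfolding R_saturated_def by blast
qed

lemma integral_over_mono: "integral_over I f a \<Longrightarrow> I \<subseteq> J \<Longrightarrow> integral_over J f a"
  unfolding integral_over_def by (meson subset_iff)

text \<open>\<open>f\<close> is a root of \<open>X ^ n - f ^ n\<close>, an integral equation whose
  only possibly nonzero coefficient below the leading one is the constant term.\<close>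

lemma integrally_closed_root:
  assumes "integrally_closed J" "idealistic_filtration J" "n > 0" "(f ^ n, real n * a) \<in> J"
  shows "(f, a) \<in> J"
proof -
  define c where "c i = (if i = n then - (f ^ n) else 0)" for i
  have "(\<Sum>i=1..n. c i * f ^ (n - i)) = (\<Sum>i\<in>{1..n}. if i = n then - (f ^ n) else 0)"
    by (intro sum.cong) (auto simp: c_def)
  also have "\<dots> = - (f ^ n)" using assms(3) by simp
  finally have "f ^ n + (\<Sum>i=1..n. c i * f ^ (n - i)) = 0" by simp
  moreover have "(c i, real i * a) \<in> J" for i
    using assms(2,4) filtration_smult[OF assms(2,4), of "-1"] by (auto simp: c_def filtration_zero)
  ultimately have "integral_over J f a"
    unfolding integral_over_def using assms(3) by (intro exI[of _ n] conjI exI[of _ c]) auto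
  then show ?thesis using assms(1) by (simp add: integrally_closed_def)
qed

section \<open>The extended Rees algebra\<close>

definition fls_monom :: "'a::field \<Rightarrow> int \<Rightarrow> 'a fls" where
  "fls_monom c n = fls_shift (- n) (fls_const c)"

lemma fls_nth_monom [simp]: "fls_nth (fls_monom c n) i = (if i = n then c else 0)"
  by (simp add: fls_monom_def)

lemma fls_nth_mult_monom [simp]: "fls_nth (F * fls_monom c n) i = fls_nth F (i - n) * c"
  by (simp add: fls_monom_def fls_shifted_times_simps)

lemma fls_monom_add: "fls_monom a n + fls_monom b n = fls_monom (a + b) n"
  by (rule fls_eqI) simp

lemma fls_monom_mult [simp]: "fls_monom a m * fls_monom b n = fls_monom (a * b) (m + n)"
  by (rule fls_eqI) auto

lemma fls_monom_zero [simp]: "fls_monom 0 n = 0"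
  by (rule fls_eqI) simp

lemma fls_monom_eq_0_iff [simp]: "fls_monom a n = 0 \<longleftrightarrow> a = 0"
  by (auto dest!: arg_cong[where f = "\<lambda>F. fls_nth F n"])

lemma fls_monom_uminus: "- fls_monom a n = fls_monom (- a) n"
  by (rule fls_eqI) simp

lemma fls_monom_one: "fls_monom 1 0 = 1"
  by (rule fls_eqI) simp

lemma fls_monom_power [simp]: "fls_monom a m ^ n = fls_monom (a ^ n) (int n * m)"
  by (induction n) (auto simp: fls_monom_one algebra_simps)

lemma fls_monom_inverse: "a \<noteq> 0 \<Longrightarrow> inverse (fls_monom a m) = fls_monom (inverse a) (- m)"
  by (rule inverse_unique) (simp add: fls_monom_one)

lemma fls_monom_powi: "fls_monom 1 m powi k = fls_monom 1 (k * m)"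
  by (auto simp: power_int_def power_inverse fls_monom_inverse algebra_simps)

text \<open>
  \<open>A\<close> is the extended Rees algebra of the filtration, inside the Laurent series over the fraction
  field. The coefficient at index \<open>n\<close> belongs to level \<open>n / \<delta>\<close>, and \<open>h\<close> is the inverse of the variable.
\<close>

locale rees_model =
  fixes I :: "('r::comm_ring_1 \<times> real) set" and \<psi> :: "'r \<Rightarrow> 'f::field" and \<delta> :: nat
    and A :: "'f fls set"
  assumes filt: "idealistic_filtration I" and \<delta>_pos: "\<delta> > (0::nat)"
    and \<psi>_add: "\<psi> (x + y) = \<psi> x + \<psi> y" and \<psi>_mult: "\<psi> (x * y) = \<psi> x * \<psi> y"
    and \<psi>_one: "\<psi> 1 = 1" and \<psi>_inj: "\<psi> x = 0 \<longleftrightarrow> x = 0"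
    and noeth_A: "noeth A"
    and coeff: "F \<in> A \<Longrightarrow> \<exists>r. fls_nth F n = \<psi> r \<and> (r, real_of_int n / real \<delta>) \<in> I"
    and monom_mem: "(r, c) \<in> I \<Longrightarrow> fls_monom (\<psi> r) \<lceil>c * \<delta>\<rceil> \<in> A"
begin

abbreviation h :: "'f fls" where "h \<equiv> fls_monom 1 (- 1)"

sublocale noeth A by (rule noeth_A)

lemma h_in_A: "h \<in> A"
proof -
  have "(1, - 1 / real \<delta>) \<in> I" using filtration_level_0[OF filt] by (rule filtration_mono[OF filt]) auto
  from monom_mem[OF this] show ?thesis using \<delta>_pos by (simp add: \<psi>_one ceiling_minus)
qed

sublocale order_filtration A h
  using h_in_A by unfold_locales auto

lemma \<psi>_power: "\<psi> (x ^ n) = \<psi> x ^ n"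
  by (induction n) (auto simp: \<psi>_one \<psi>_mult)

lemma \<psi>_zero: "\<psi> 0 = 0"
  by (simp add: \<psi>_inj)

lemma \<psi>_sum: "\<psi> (sum g U) = (\<Sum>i\<in>U. \<psi> (g i))"
  by (induction U rule: infinite_finite_induct) (auto simp: \<psi>_zero \<psi>_add)

lemma \<psi>_uminus: "\<psi> (- x) = - \<psi> x"
  using \<psi>_add[of x "- x"] by (simp add: \<psi>_zero eq_neg_iff_add_eq_0 add.commute)

lemma \<psi>_eq: "\<psi> x = \<psi> y \<Longrightarrow> x = y"
  using \<psi>_inj[of "x - y"] \<psi>_add[of x "- y"] by (simp add: \<psi>_uminus)

lemma const_mem: "fls_monom (\<psi> r) 0 \<in> A"
  using monom_mem[OF filtration_level_0[OF filt], of r] by simp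

text \<open>Dividing a constant by \<open>h ^ p\<close> moves it to index \<open>p\<close>, that is
  to level \<open>p / \<delta>\<close>; hence the factor \<open>\<delta>\<close>.\<close>

definition order_levels :: "('r \<times> real) set" where
  "order_levels = {(f, c). fls_monom (\<psi> f) 0 \<in> W (c * \<delta>)}"

lemma order_levels_filtration: "idealistic_filtration order_levels"
  unfolding idealistic_filtration_iff order_levels_def mem_Collect_eq case_prod_conv
proof (intro conjI allI impI)
  show "fls_monom (\<psi> f) 0 \<in> W (0 * real \<delta>)" for f
    using const_mem by (intro subset_W) auto
  show "fls_monom (\<psi> 0) 0 \<in> W (a * real \<delta>)" for a
    by (simp add: \<psi>_zero W_zero)
  show "fls_monom (\<psi> (f + g)) 0 \<in> W (a * real \<delta>)"
    if "fls_monom (\<psi> f) 0 \<in> W (a * real \<delta>)" "fls_monom (\<psi> g) 0 \<in> W (a * real \<delta>)" for f g a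
    using W_add[OF that] by (simp add: fls_monom_add \<psi>_add)
  show "fls_monom (\<psi> (r * f)) 0 \<in> W (a * real \<delta>)" if "fls_monom (\<psi> f) 0 \<in> W (a * real \<delta>)" for r f a
    using W_smult[OF const_mem that, of r] by (simp add: \<psi>_mult)
  show "fls_monom (\<psi> (f * g)) 0 \<in> W ((a + b) * real \<delta>)"
    if "fls_monom (\<psi> f) 0 \<in> W (a * real \<delta>)" "fls_monom (\<psi> g) 0 \<in> W (b * real \<delta>)" for f g a b
    using W_mult[OF that] by (simp add: \<psi>_mult distrib_right)
  show "fls_monom (\<psi> f) 0 \<in> W (b * real \<delta>)" if "b \<le> a" "fls_monom (\<psi> f) 0 \<in> W (a * real \<delta>)" for f a b
    using W_mono[of "b * real \<delta>" "a * real \<delta>"] that by (auto simp: mult_right_mono)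
qed

lemma order_levels_saturated: "R_saturated order_levels"
  unfolding R_saturated_def order_levels_def mem_Collect_eq case_prod_conv
proof (intro conjI allI impI)
  fix f a and n :: nat assume "n > 0" "fls_monom (\<psi> (f ^ n)) 0 \<in> W (real n * a * real \<delta>)"
  then show "fls_monom (\<psi> f) 0 \<in> W (a * real \<delta>)"
    using W_root[OF const_mem, of n f "a * real \<delta>"] by (simp add: \<psi>_power mult.assoc)
next
  fix f a and u :: "nat \<Rightarrow> real"
  assume u: "\<forall>l. fls_monom (\<psi> f) 0 \<in> W (u l * real \<delta>)" "u \<longlonglongrightarrow> a"
  show "fls_monom (\<psi> f) 0 \<in> W (a * real \<delta>)"
  proof (rule W_limit)
    fix c assume "c < a * real \<delta>"
    moreover have "(\<lambda>l. u l * real \<delta>) \<longlonglongrightarrow> a * real \<delta>" using u(2) by (intro tendsto_intros)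
    ultimately have "eventually (\<lambda>l. c < u l * real \<delta>) sequentially" by (rule order_tendstoD(1)[rotated])
    then obtain l where "c < u l * real \<delta>" by (auto simp: eventually_sequentially)
    then show "fls_monom (\<psi> f) 0 \<in> W c" using u(1) W_mono[of c "u l * real \<delta>"] by auto
  qed
qed

lemma subset_order_levels: "I \<subseteq> order_levels"
proof
  fix p assume "p \<in> I"
  then obtain f c where fc: "p = (f, c)" "(f, c) \<in> I" by (cases p) auto
  have "fls_monom (\<psi> f) 0 \<in> W (c * \<delta>)"
  proof (rule WI)
    fix b assume "b < c * \<delta>"
    have "fls_monom (\<psi> f) 0 ^ n * h powi (- \<lceil>real n * b\<rceil>) \<in> A" for n :: nat
    proof (rule weaken_exponent)
      have "fls_monom (\<psi> (f ^ n)) \<lceil>real n * c * \<delta>\<rceil> \<in> A"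
        by (intro monom_mem filtration_power[OF filt fc(2)])
      then show "fls_monom (\<psi> f) 0 ^ n * h powi (- \<lceil>real n * c * \<delta>\<rceil>) \<in> A"
        by (simp add: fls_monom_powi \<psi>_power)
      have "real n * b \<le> real n * (c * real \<delta>)" using \<open>b < c * \<delta>\<close> by (intro mult_left_mono) auto
      then show "\<lceil>real n * b\<rceil> \<le> \<lceil>real n * c * \<delta>\<rceil>" by (intro ceiling_mono) (simp add: mult.assoc)
    qed
    then show "\<exists>d\<in>A - {0}. \<forall>n::nat. d * fls_monom (\<psi> f) 0 ^ n * h powi (- \<lceil>real n * b\<rceil>) \<in> A"
      by (intro bexI[of _ 1]) auto
  qed
  then show "p \<in> order_levels" by (simp add: order_levels_def fc(1))
qed

text \<open>\<open>W_imp_adjoin_inverse\<close> writes \<open>\<xi>\<close> as a polynomial in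
  \<open>inverse \<xi>\<close> over \<open>A\<close>. Multiplying by \<open>\<xi> ^ m\<close> gives
  a monic equation for \<open>\<xi>\<close>, and its coefficient at index \<open>(m + 1) * p\<close>
  is an integral equation for \<open>g\<close> over \<open>I\<close>.\<close>

lemma integral_of_integer_order:
  assumes "g \<noteq> 0" "fls_monom (\<psi> g) 0 \<in> W (real_of_int p)"
  shows "integral_over I g (p / \<delta>)"
proof -
  define \<xi> where "\<xi> = fls_monom (\<psi> g) p"
  have nz: "\<xi> \<noteq> 0" using assms(1) by (simp add: \<xi>_def \<psi>_inj)
  have "fls_monom (\<psi> g) 0 * h powi (- p) = \<xi>" by (simp add: fls_monom_powi \<xi>_def)
  with W_imp_adjoin_inverse[OF noeth_A assms(2)] assms(1) have "\<xi> \<in> adjoin A (inverse \<xi>)"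
    by (simp add: \<psi>_inj)
  then obtain m where "\<xi> \<in> polys_below A (inverse \<xi>) m" using adjoin_polys_below by blast
  from polys_below_rep[OF this] obtain w where
    w: "\<And>i. w i \<in> A" "\<xi> = (\<Sum>i<m. w i * inverse \<xi> ^ i)" by blast
  have "\<xi> ^ Suc m = (\<Sum>i<m. w i * inverse \<xi> ^ i) * \<xi> ^ m" using w(2) by simp
  also have "\<dots> = (\<Sum>i<m. w i * \<xi> ^ (m - i))"
    unfolding sum_distrib_right
  proof (intro sum.cong refl)
    fix i assume "i \<in> {..<m}"
    then have "\<xi> ^ m = \<xi> ^ i * \<xi> ^ (m - i)" by (simp add: power_add[symmetric])
    then show "w i * inverse \<xi> ^ i * \<xi> ^ m = w i * \<xi> ^ (m - i)"
      using nz by (simp add: power_inverse)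
  qed
  finally have eq: "fls_monom (\<psi> g ^ Suc m) (int (Suc m) * p) =
      (\<Sum>i<m. w i * fls_monom (\<psi> g ^ (m - i)) (int (m - i) * p))"
    unfolding \<xi>_def fls_monom_power .
  have "\<forall>i. \<exists>r. fls_nth (w i) ((int i + 1) * p) = \<psi> r \<and> (r, real_of_int ((int i + 1) * p) / \<delta>) \<in> I"
    using coeff w(1) by blast
  then obtain r where r: "\<And>i. fls_nth (w i) ((int i + 1) * p) = \<psi> (r i)"
    "\<And>i. (r i, real_of_int ((int i + 1) * p) / \<delta>) \<in> I" by metis
  have "\<psi> g ^ Suc m = fls_nth (fls_monom (\<psi> g ^ Suc m) (int (Suc m) * p)) (int (Suc m) * p)"
    by simp
  also have "\<dots> = (\<Sum>i<m. fls_nth (w i) (int (Suc m) * p - int (m - i) * p) * \<psi> g ^ (m - i))"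
    unfolding eq by (simp add: fls_nth_sum)
  also have "\<dots> = (\<Sum>i<m. \<psi> (r i) * \<psi> g ^ (m - i))"
  proof (intro sum.cong refl)
    fix i assume "i \<in> {..<m}"
    then have "int (Suc m) * p - int (m - i) * p = (int i + 1) * p"
      by (simp add: of_nat_diff algebra_simps)
    then show "fls_nth (w i) (int (Suc m) * p - int (m - i) * p) * \<psi> g ^ (m - i) = \<psi> (r i) * \<psi> g ^ (m - i)"
      using r(1) by (simp only:)
  qed
  also have "\<dots> = \<psi> (\<Sum>i<m. r i * g ^ (m - i))" by (simp add: \<psi>_sum \<psi>_mult \<psi>_power)
  finally have "\<psi> (g ^ Suc m) = \<psi> (\<Sum>i<m. r i * g ^ (m - i))" by (simp only: \<psi>_power)
  then have g: "g ^ Suc m = (\<Sum>i<m. r i * g ^ (m - i))" by (rule \<psi>_eq)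
  \<comment> \<open>The coefficient \<open>r i\<close> belongs to \<open>g ^ (m - i)\<close> and has
    level \<open>(i + 1) * p / \<delta>\<close>, hence the shift by one. The equation has no
    constant term, so the last coefficient is 0.\<close>
  define c where "c i = (if i = Suc m then 0 else - r (i - 1))" for i
  have "(\<Sum>i=1..Suc m. c i * g ^ (Suc m - i)) = (\<Sum>i<Suc m. c (Suc i) * g ^ (m - i))"
    by (simp add: sum.atLeast1_atMost_eq)
  also have "\<dots> = (\<Sum>i<m. - (r i * g ^ (m - i)))" by (simp add: c_def)
  also have "\<dots> = - (g ^ Suc m)" unfolding g by (rule sum_negf)
  finally have "g ^ Suc m + (\<Sum>i=1..Suc m. c i * g ^ (Suc m - i)) = 0" by simp
  moreover have "(c i, real i * (p / \<delta>)) \<in> I" if "i \<in> {1..Suc m}" for i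
  proof (cases "i = Suc m")
    case True
    then show ?thesis by (simp add: c_def filtration_zero[OF filt])
  next
    case False
    have "real_of_int ((int (i - 1) + 1) * p) / \<delta> = real i * (p / \<delta>)"
      using that by (simp add: of_nat_diff)
    then have "(r (i - 1), real i * (p / \<delta>)) \<in> I" using r(2)[of "i - 1"] by (simp only:)
    from filtration_smult[OF filt this, of "-1"] show ?thesis using False by (simp add: c_def)
  qed
  ultimately show ?thesis
    unfolding integral_over_def by (intro exI[of _ "Suc m"] conjI exI[of _ c]) auto
qed

text \<open>\<open>gap\<close> is kept as an assumption because its proof needs finite generation
  over a field up to localization, while \<open>rees_model\<close> records only the Noetherian
  property.\<close>

theorem R_saturation_eq_integral_closure:
  assumes gap: "\<And>f \<alpha>. fls_monom (\<psi> f) 0 \<in> W \<alpha> \<Longrightarrow> \<alpha> \<notin> \<rat> \<Longrightarrow> \<exists>\<alpha>'>\<alpha>. fls_monom (\<psi> f) 0 \<in> W \<alpha>'"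
  shows "R_saturation I = integral_closure I"
proof
  have sat: "idealistic_filtration (R_saturation I)" "R_saturated (R_saturation I)"
    using R_saturation_saturated[of I] by auto
  have IC: "idealistic_filtration (integral_closure I)" "integrally_closed (integral_closure I)"
    using integral_closure_closed[of I] by auto
  have I_sub: "I \<subseteq> integral_closure I" unfolding integral_closure_def by (rule hull_subset)
  have "I \<subseteq> R_saturation I" unfolding R_saturation_def by (rule hull_subset)
  then show "integral_closure I \<subseteq> R_saturation I"
    unfolding integral_closure_def using sat R_saturated_imp_integrally_closed
    by (intro hull_minimal) auto
  have "R_saturation I \<subseteq> order_levels"
    unfolding R_saturation_def
    using subset_order_levels order_levels_filtration order_levels_saturated by (intro hull_minimal) auto
  moreover have "(f, c) \<in> integral_closure I" if fc: "(f, c) \<in> order_levels" for f c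
  proof (cases "f = 0")
    case True
    then show ?thesis using filtration_zero[OF IC(1)] by simp
  next
    case False
    let ?x = "fls_monom (\<psi> f) 0"
    have x: "?x \<in> W (c * \<delta>)" using fc by (simp add: order_levels_def)
    have "\<exists>r\<in>\<rat>. c * \<delta> \<le> r \<and> ?x \<in> W r"
    proof (cases "c * \<delta> \<in> \<rat>")
      case False
      from gap[OF x False] obtain \<alpha>' where \<alpha>': "\<alpha>' > c * \<delta>" "?x \<in> W \<alpha>'" by blast
      from Rats_dense_in_real[OF \<alpha>'(1)] obtain r where r: "r \<in> \<rat>" "c * \<delta> < r" "r < \<alpha>'" by blast
      then show ?thesis using W_mono[of r \<alpha>'] \<alpha>'(2) by (intro bexI[of _ r]) auto
    qed (use x in auto)
    then obtain r where r: "r \<in> \<rat>" "c * \<delta> \<le> r" "?x \<in> W r" by blast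
    from r(1) obtain p q :: int where pq: "q > 0" "r = real_of_int p / real_of_int q"
      by (elim Rats_cases') auto
    \<comment> \<open>The \<open>n\<close>-th power clears the denominator of \<open>r\<close> and
      has integer order at least \<open>p\<close>; the root is taken afterwards inside the integral
      closure.\<close>
    define n where "n = nat q"
    have n: "n > 0" "real_of_int q = real n" using pq(1) by (auto simp: n_def)
    have "?x ^ n \<in> W (real n * r)" using r(3) by (rule W_power)
    then have "fls_monom (\<psi> (f ^ n)) 0 \<in> W (real_of_int p)"
      using n by (simp add: \<psi>_power pq(2))
    moreover have "f ^ n \<noteq> 0" using False \<psi>_inj[of "f ^ n"] \<psi>_inj[of f] by (simp add: \<psi>_power)
    ultimately have "integral_over I (f ^ n) (p / \<delta>)" by (intro integral_of_integer_order)
    then have "(f ^ n, p / \<delta>) \<in> integral_closure I"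
      using IC(2) I_sub integral_over_mono unfolding integrally_closed_def by blast
    moreover have "p / \<delta> = real n * (r / \<delta>)" using n by (simp add: pq(2))
    ultimately have "(f, r / \<delta>) \<in> integral_closure I"
      using integrally_closed_root[OF IC(2,1) n(1)] by simp
    moreover have "c \<le> r / \<delta>" using r(2) \<delta>_pos by (simp add: field_simps)
    ultimately show ?thesis using filtration_mono[OF IC(1)] by blast
  qed
  ultimately show "R_saturation I \<subseteq> integral_closure I" by auto
qed

end

lemma common_denominator:
  assumes "finite T" "T \<subseteq> \<rat>"
  shows "\<exists>\<delta>::nat. \<delta> > (0::nat) \<and> (\<forall>b\<in>T. (b::real) * real \<delta> \<in> \<int>)"
  using assms
proof induction
  case empty
  show ?case by (rule exI[of _ 1]) auto
next
  case (insert b T)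
  then obtain \<delta> :: nat where \<delta>: "\<delta> > (0::nat)" "\<forall>b\<in>T. b * real \<delta> \<in> \<int>" by auto
  obtain p q :: int where pq: "q > 0" "b = real_of_int p / real_of_int q"
    using insert.prems by (auto elim: Rats_cases')
  have q: "real (nat q) = real_of_int q" using pq(1) by simp
  have "b * real (\<delta> * nat q) = real_of_int (p * int \<delta>)" using pq q by simp
  then have "b * real (\<delta> * nat q) \<in> \<int>" by (simp only: Ints_of_int)
  moreover have "b' * real (\<delta> * nat q) \<in> \<int>" if "b' \<in> T" for b'
  proof -
    have "b' * real \<delta> \<in> \<int>" using \<delta>(2) that by blast
    then have "(b' * real \<delta>) * real_of_int q \<in> \<int>" by (rule Ints_mult) simp
    then show ?thesis using q by (simp add: mult.assoc)
  qed
  ultimately show ?case using \<delta>(1) pq(1) by (intro exI[of _ "\<delta> * nat q"]) auto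
qed

lemma generate_ring_UNIV_imp_gen:
  assumes "generate_ring ring_of_type_algebra H = (UNIV :: 'a::comm_ring_1 set)"
  shows "gen H = UNIV"
proof -
  have "x \<in> gen H" if "x \<in> generate_ring ring_of_type_algebra H" for x
    using that
    by induction
      (auto simp: a_inv_ring_of_type_algebra, auto simp: ring_of_type_algebra_def intro: gen.intros)
  then show ?thesis using assms by auto
qed

theorem corollary2p3p2p6:
  fixes \<phi> :: "'k::alg_closed_field \<Rightarrow> 'a::idom"
    and S :: "'a set"
    and \<iota> :: "'a \<Rightarrow> 'r::comm_ring_1"
    and I :: "('r \<times> real) set"
  assumes "smooth_affine_coordinate_ring \<phi>"
    and "is_localization S \<iota>"
    and "idealistic_filtration I"
    and "rfg_type I"
  shows "R_saturation I = integral_closure I"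
proof -

  \<comment> \<open>Embedding of the localization into the fraction field\<close>
  obtain G where \<phi>: "is_ring_hom \<phi>" and "finite G" and "generate_ring ring_of_type_algebra (range \<phi> \<union> G) = UNIV"
    using assms(1) unfolding smooth_affine_coordinate_ring_def by blast
  note gens = generate_ring_UNIV_imp_gen[OF this(3)]
  note \<phi>_simps = is_ring_homD[OF \<phi>]
  have S_sub: "submonoid S ring_of_type_algebra" and \<iota>: "is_ring_hom \<iota>"
    and unit: "\<And>s. s \<in> S \<Longrightarrow> \<iota> s dvd 1" and frac: "\<And>r. \<exists>a. \<exists>s\<in>S. r * \<iota> s = \<iota> a"
    and ker: "\<And>a. \<iota> a = 0 \<longleftrightarrow> (\<exists>s\<in>S. s * a = 0)"
    using assms(2) unfolding is_localization_def by auto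
  note \<iota>_simps = is_ring_homD[OF \<iota>]
  have S_one: "1 \<in> S" and S_mult: "\<And>s t. s \<in> S \<Longrightarrow> t \<in> S \<Longrightarrow> s * t \<in> S"
    using submonoid.one_closed[OF S_sub] submonoid.m_closed[OF S_sub] by (auto simp: ring_of_type_algebra_def)
  have S_nz: "s \<noteq> 0" if "s \<in> S" for s using unit[OF that] \<iota>_simps by auto
  \<comment> \<open>0 is not in \<open>S\<close>, whose elements become units, and \<open>'a\<close>
    has no zero divisors; so the kernel is trivial.\<close>
  have \<iota>_inj: "a = b" if "\<iota> a = \<iota> b" for a b
  proof -
    have "\<iota> (a + - b) = 0" using that by (simp add: \<iota>_simps del: add_uminus_conv_diff)
    then show ?thesis using ker[of "a + - b"] S_nz by auto
  qed
  have \<iota>_cancel: "x = y" if xy: "x * \<iota> s = y * \<iota> s" "s \<in> S" for x y s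
  proof -
    obtain t where t: "1 = \<iota> s * t" using unit[OF xy(2)] by (auto elim: dvdE)
    have "x = (x * \<iota> s) * t" using t by (simp add: mult.assoc)
    also have "\<dots> = y" using t xy(1) by (simp add: mult.assoc)
    finally show ?thesis .
  qed
  obtain num den where nd: "\<And>r. den r \<in> S" "\<And>r. r * \<iota> (den r) = \<iota> (num r)"
    using frac by metis
  define j where "j a = Fract a 1" for a :: 'a
  have j: "j (a + b) = j a + j b" "j (a * b) = j a * j b" "j 1 = 1" "j 0 = 0" "j (- a) = - j a"
    "j a = 0 \<longleftrightarrow> a = 0" "j a = j b \<longleftrightarrow> a = b" for a b
    by (auto simp: j_def One_fract_def Zero_fract_def eq_fract)
  \<comment> \<open>\<open>num\<close> and \<open>den\<close> are arbitrary choices; the fact below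
    shows that any other fraction for \<open>r\<close> gives the same value.\<close>
  define \<psi> where "\<psi> r = j (num r) / j (den r)" for r
  have \<psi>: "\<psi> r * j s = j a" if "r * \<iota> s = \<iota> a" "s \<in> S" for r a s
  proof -
    have "\<iota> (num r * s) = \<iota> (a * den r)"
      using nd(2)[of r] that(1) by (simp add: \<iota>_simps) (metis mult.assoc mult.commute)
    then have "num r * s = a * den r" by (rule \<iota>_inj)
    then have "j (num r) * j s = j a * j (den r)" by (simp only: j(2)[symmetric])
    moreover have "j (den r) \<noteq> 0" using S_nz nd(1) by (simp add: j)
    ultimately show ?thesis by (simp add: \<psi>_def field_simps)
  qed
  have \<psi>\<iota>: "\<psi> (\<iota> a) = j a" for a using \<psi>[of "\<iota> a" 1 a] S_one by (simp add: \<iota>_simps j)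
  have js: "j s \<noteq> 0" if "s \<in> S" for s using that S_nz by (simp add: j)
  have \<psi>_mult: "\<psi> (x * y) = \<psi> x * \<psi> y" for x y
  proof -
    have "(x * y) * \<iota> (den x * den y) = \<iota> (num x * num y)"
      unfolding \<iota>_simps nd(2)[symmetric] by (simp add: ac_simps)
    from \<psi>[OF this] have "\<psi> (x * y) * (j (den x) * j (den y)) = j (num x) * j (num y)"
      by (simp add: j S_mult nd(1))
    then show ?thesis using js nd(1) by (simp add: \<psi>_def field_simps)
  qed
  have \<psi>_add: "\<psi> (x + y) = \<psi> x + \<psi> y" for x y
  proof -
    have "(x + y) * \<iota> (den x * den y) = \<iota> (num x * den y + num y * den x)"
      unfolding \<iota>_simps nd(2)[symmetric] by (simp add: algebra_simps)
    from \<psi>[OF this] have "\<psi> (x + y) * (j (den x) * j (den y)) = j (num x) * j (den y) + j (num y) * j (den x)"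
      by (simp add: j S_mult nd(1))
    then show ?thesis using js nd(1) by (simp add: \<psi>_def field_simps)
  qed
  have \<psi>_inj: "\<psi> x = 0 \<longleftrightarrow> x = 0" for x
  proof
    assume "\<psi> x = 0"
    then have "num x = 0" using js nd(1) by (simp add: \<psi>_def j)
    then have "x * \<iota> (den x) = 0 * \<iota> (den x)" using nd(2)[of x] by (simp add: \<iota>_simps)
    then show "x = 0" using nd(1) by (rule \<iota>_cancel)
  qed (use \<psi>\<iota>[of 0] in \<open>simp add: \<iota>_simps j\<close>)
  have \<psi>_one: "\<psi> 1 = 1" using \<psi>\<iota>[of 1] by (simp add: \<iota>_simps j)

  obtain T where T: "finite T" "snd ` T \<subseteq> \<rat>" "I = generated_filtration T"
    using assms(4) unfolding rfg_type_def by blast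
  have TI: "T \<subseteq> I" unfolding T(3) generated_filtration_def by (rule hull_subset)
  from common_denominator[OF finite_imageI[OF T(1)] T(2)]
  obtain \<delta> :: nat where \<delta>': "\<delta> > (0::nat) \<and> (\<forall>b\<in>snd ` T. b * real \<delta> \<in> \<int>)" ..
  have \<delta>: "\<delta> > (0::nat)" "(g, b) \<in> T \<Longrightarrow> b * \<delta> \<in> \<int>" for g b using \<delta>' by force+
  note filt = assms(3)

  \<comment> \<open>The finitely generated algebra B and its localization A\<close>
  define k where "k = range (\<lambda>c. fls_monom (j (\<phi> c)) 0)"
  have k: "usubfield k"
  proof
    show "1 \<in> k" unfolding k_def by (rule range_eqI[of _ _ 1]) (simp add: \<phi>_simps j fls_monom_one)
  next
    fix x y assume "x \<in> k" "y \<in> k"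
    then obtain a b where ab: "x = fls_monom (j (\<phi> a)) 0" "y = fls_monom (j (\<phi> b)) 0" by (auto simp: k_def)
    show "x + y \<in> k" unfolding k_def ab
      by (rule range_eqI[of _ _ "a + b"]) (simp add: \<phi>_simps j fls_monom_add)
    show "x * y \<in> k" unfolding k_def ab
      by (rule range_eqI[of _ _ "a * b"]) (simp add: \<phi>_simps j)
    show "- x \<in> k" unfolding k_def ab
      by (rule range_eqI[of _ _ "- a"]) (simp add: \<phi>_simps j fls_monom_uminus)
    show "inverse x \<in> k"
    proof (cases "a = 0")
      case True
      then show ?thesis unfolding k_def ab
        by (intro range_eqI[of _ _ 0]) (simp add: \<phi>_simps j)
    next
      case False
      have "j (\<phi> (inverse a)) * j (\<phi> a) = 1"
        using False by (simp only: j(2)[symmetric] \<phi>_simps(2)[symmetric]) (simp add: \<phi>_simps j)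
      then have "inverse (j (\<phi> a)) = j (\<phi> (inverse a))" "j (\<phi> a) \<noteq> 0"
        by (auto intro!: inverse_unique simp: mult.commute)
      then show ?thesis unfolding k_def ab
        by (intro range_eqI[of _ _ "inverse a"]) (simp add: fls_monom_inverse)
    qed
  qed
  interpret k: usubfield k by fact

  let ?h = "fls_monom (1 :: 'a fract) (- 1)"
  \<comment> \<open>The elements of \<open>T\<close> enter through numerators, so all coefficients
    come from \<open>'a\<close> and \<open>B\<close> is finitely generated over \<open>k\<close>;
    localizing restores the denominators. The floor is exact, because \<open>b * \<delta>\<close> is
    an integer.\<close>
  define F where "F = (\<lambda>a. fls_monom (j a) 0) ` G \<union> {?h} \<union> (\<lambda>(g, b). fls_monom (j (num g)) \<lfloor>b * \<delta>\<rfloor>) ` T"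
  have fF: "finite F" using \<open>finite G\<close> T(1) by (simp add: F_def)
  define B where "B = gen (k \<union> F)"
  interpret B: usubring B unfolding B_def by (rule usubring_gen)
  have F_B: "k \<union> F \<subseteq> B" unfolding B_def by (rule gen_superset)
  have const_B: "fls_monom (j a) 0 \<in> B" for a
  proof -
    have "a \<in> gen (range \<phi> \<union> G)" using gens by simp
    then show ?thesis
    proof induction
      case (gen_base a)
      then show ?case using F_B by (auto simp: k_def F_def)
    next
      case gen_one
      show ?case by (simp add: j fls_monom_one)
    next
      case (gen_add a b)
      then show ?case using B.add_mem by (simp add: j fls_monom_add[symmetric])
    next
      case (gen_mult a b)
      then show ?case using B.mult_mem[of "fls_monom (j a) 0" "fls_monom (j b) 0"] by (simp add: j)
    next
      case (gen_uminus a)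
      then show ?case using B.uminus_mem by (simp add: j fls_monom_uminus[symmetric])
    qed
  qed
  define S' where "S' = (\<lambda>s. fls_monom (j s) 0) ` S"
  have S'_zero: "0 \<notin> S'" using S_nz by (auto simp: S'_def j dest!: sym[of 0])
  interpret S': mult_subset B S'
  proof
    show "S' \<subseteq> B" using const_B by (auto simp: S'_def)
    show "1 \<in> S'" unfolding S'_def by (rule image_eqI[OF _ S_one]) (simp add: j fls_monom_one)
    show "s * t \<in> S'" if st: "s \<in> S'" "t \<in> S'" for s t
    proof -
      obtain a b where "a \<in> S" "b \<in> S" "s = fls_monom (j a) 0" "t = fls_monom (j b) 0"
        using st by (auto simp: S'_def)
      then show ?thesis unfolding S'_def by (intro image_eqI[OF _ S_mult[of a b]]) (auto simp: j)
    qed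
  qed
  define A where "A = loc S' B"
  have BA: "B \<subseteq> A" unfolding A_def by (rule S'.subset_loc)
  interpret A: usubring A unfolding A_def by (rule S'.usubring_loc)
  have noeth_A: "noeth A"
    unfolding A_def B_def
    using S'.mult_subset_axioms S'_zero noeth_gen_field[OF k.usubring_axioms k.inverse_mem fF]
    by (intro noeth_loc) (auto simp: B_def)
  have inv_A: "fls_monom (inverse (j s)) 0 \<in> A" if "s \<in> S" for s
    unfolding A_def by (rule S'.locI[of "fls_monom (j s) 0"]) (use that js in \<open>auto simp: S'_def fls_monom_one\<close>)
  have monom_A: "fls_monom (\<psi> r) n \<in> A" if "fls_monom (j (num r)) n \<in> B" for r n
    using A.mult_mem[OF inv_A[OF nd(1)[of r]], of "fls_monom (j (num r)) n"] that BA
    by (auto simp: \<psi>_def field_simps)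
  have h_A: "?h \<in> A" using F_B BA by (auto simp: F_def)

  have monom_mem: "fls_monom (\<psi> r) \<lceil>c * \<delta>\<rceil> \<in> A" if rc: "(r, c) \<in> I" for r c
  proof -
    \<comment> \<open>\<open>J\<close> asks for membership after the index is rounded up. A sum of
      ceilings dominates the ceiling of the sum, so \<open>J\<close> is a filtration; it contains
      \<open>T\<close> and therefore \<open>I\<close>.\<close>
    define J where "J = {(r, c). fls_monom (\<psi> r) \<lceil>c * real \<delta>\<rceil> \<in> A}"
    have lower: "fls_monom x m \<in> A" if "fls_monom x n \<in> A" "m \<le> n" for x m n
    proof -
      have "fls_monom x n * ?h ^ nat (n - m) \<in> A" by (intro A.mult_mem A.power_mem that(1) h_A)
      then show ?thesis using that(2) by simp
    qed
    have "idealistic_filtration J"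
      unfolding idealistic_filtration_iff J_def mem_Collect_eq case_prod_conv
    proof (intro conjI allI impI)
      show "fls_monom (\<psi> f) \<lceil>0 * real \<delta>\<rceil> \<in> A" for f
        using monom_A const_B by simp
      then have const: "fls_monom (\<psi> f) 0 \<in> A" for f by simp
      show "fls_monom (\<psi> 0) \<lceil>a * real \<delta>\<rceil> \<in> A" for a
        using \<psi>_inj[of 0] by simp
      show "fls_monom (\<psi> (f + g)) \<lceil>a * real \<delta>\<rceil> \<in> A"
        if "fls_monom (\<psi> f) \<lceil>a * real \<delta>\<rceil> \<in> A" "fls_monom (\<psi> g) \<lceil>a * real \<delta>\<rceil> \<in> A" for f g a
        using A.add_mem[OF that] by (simp add: \<psi>_add fls_monom_add)
      show "fls_monom (\<psi> (r * f)) \<lceil>a * real \<delta>\<rceil> \<in> A" if "fls_monom (\<psi> f) \<lceil>a * real \<delta>\<rceil> \<in> A" for r f a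
        using A.mult_mem[OF const[of r] that] by (simp add: \<psi>_mult)
      show "fls_monom (\<psi> (f * g)) \<lceil>(a + b) * real \<delta>\<rceil> \<in> A"
        if "fls_monom (\<psi> f) \<lceil>a * real \<delta>\<rceil> \<in> A" "fls_monom (\<psi> g) \<lceil>b * real \<delta>\<rceil> \<in> A" for f g a b
      proof (rule lower)
        show "fls_monom (\<psi> (f * g)) (\<lceil>a * real \<delta>\<rceil> + \<lceil>b * real \<delta>\<rceil>) \<in> A"
          using A.mult_mem[OF that] by (simp add: \<psi>_mult)
        show "\<lceil>(a + b) * real \<delta>\<rceil> \<le> \<lceil>a * real \<delta>\<rceil> + \<lceil>b * real \<delta>\<rceil>"
          unfolding distrib_right by (rule ceiling_add_le)
      qed
      show "fls_monom (\<psi> f) \<lceil>b * real \<delta>\<rceil> \<in> A" if "b \<le> a" "fls_monom (\<psi> f) \<lceil>a * real \<delta>\<rceil> \<in> A" for f a b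
        using that(2) by (rule lower) (use that(1) in \<open>auto intro!: ceiling_mono mult_right_mono\<close>)
    qed
    moreover have "T \<subseteq> J"
    proof
      fix p assume p: "p \<in> T"
      obtain g b where gb: "p = (g, b)" by force
      have "b * \<delta> \<in> \<int>" using \<delta>(2) p gb by simp
      then have "\<lceil>b * real \<delta>\<rceil> = \<lfloor>b * real \<delta>\<rfloor>" by (auto elim!: Ints_cases)
      moreover have "fls_monom (j (num g)) \<lfloor>b * \<delta>\<rfloor> \<in> B"
        using F_B p gb by (force simp: F_def)
      ultimately show "p \<in> J" using monom_A by (simp add: J_def gb)
    qed
    ultimately have "I \<subseteq> J" unfolding T(3) generated_filtration_def by (intro hull_minimal)
    then show ?thesis using rc by (auto simp: J_def)
  qed

  \<comment> \<open>Coefficients of A lie in the levels of I\<close>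
  define C where "C = {F. \<forall>n. \<exists>r. fls_nth F n = \<psi> r \<and> (r, real_of_int n / real \<delta>) \<in> I}"
  have C_sum: "\<exists>r. (\<Sum>i\<in>U. x i) = \<psi> r \<and> (r, a) \<in> I"
    if x: "\<And>i. i \<in> U \<Longrightarrow> \<exists>r. x i = \<psi> r \<and> (r, a) \<in> I" for x :: "int \<Rightarrow> 'a fract" and U a
    using x
  proof (induction U rule: infinite_finite_induct)
    case (insert i U)
    then obtain r r' where "x i = \<psi> r" "(r, a) \<in> I" "sum x U = \<psi> r'" "(r', a) \<in> I" by blast
    then show ?case using insert.hyps
      by (intro exI[of _ "r + r'"]) (auto simp: \<psi>_add intro: filtration_add[OF filt])
  qed (use \<psi>_inj[of 0] filtration_zero[OF filt] in \<open>auto intro: exI[of _ 0]\<close>)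
  have C_monom: "fls_monom (\<psi> r) n \<in> C" if "(r, real_of_int n / real \<delta>) \<in> I" for r n
    unfolding C_def using that \<psi>_inj[of 0] filtration_zero[OF filt] by (auto intro: exI[of _ r] exI[of _ 0])
  have "usubring C"
  proof
    have "fls_monom (\<psi> 1) 0 \<in> C" using filtration_level_0[OF filt] by (intro C_monom) simp
    then show "1 \<in> C" by (simp add: \<psi>_one fls_monom_one)
  next
    fix x y assume xy: "x \<in> C" "y \<in> C"
    show "x + y \<in> C" unfolding C_def
    proof (intro CollectI allI)
      fix n
      from xy obtain r s where "fls_nth x n = \<psi> r" "(r, real_of_int n / \<delta>) \<in> I"
        "fls_nth y n = \<psi> s" "(s, real_of_int n / \<delta>) \<in> I" unfolding C_def by blast
      then show "\<exists>r. fls_nth (x + y) n = \<psi> r \<and> (r, real_of_int n / \<delta>) \<in> I"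
        by (intro exI[of _ "r + s"]) (auto simp: \<psi>_add intro: filtration_add[OF filt])
    qed
    have "\<exists>r. fls_nth (x * y) n = \<psi> r \<and> (r, real_of_int n / \<delta>) \<in> I" for n
      unfolding fls_times_nth(2)
    proof (rule C_sum)
      fix i
      from xy obtain r s where rs: "fls_nth x i = \<psi> r" "(r, real_of_int i / \<delta>) \<in> I"
        "fls_nth y (n - i) = \<psi> s" "(s, real_of_int (n - i) / \<delta>) \<in> I" unfolding C_def by blast
      have "real_of_int i / real \<delta> + real_of_int (n - i) / real \<delta> = real_of_int n / real \<delta>"
        by (simp add: add_divide_distrib[symmetric])
      with filtration_mult[OF filt rs(2,4)] rs(1,3)
      show "\<exists>r. fls_nth x i * fls_nth y (n - i) = \<psi> r \<and> (r, real_of_int n / \<delta>) \<in> I"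
        by (intro exI[of _ "r * s"]) (auto simp: \<psi>_mult)
    qed
    then show "x * y \<in> C" by (simp add: C_def)
    show "- x \<in> C" unfolding C_def
    proof (intro CollectI allI)
      fix n
      from xy obtain r where r: "fls_nth x n = \<psi> r" "(r, real_of_int n / \<delta>) \<in> I" unfolding C_def by blast
      have "\<psi> (- 1) = - 1" using \<psi>\<iota>[of "- 1"] by (simp add: \<iota>_simps j)
      then show "\<exists>r. fls_nth (- x) n = \<psi> r \<and> (r, real_of_int n / \<delta>) \<in> I"
        using r filtration_smult[OF filt r(2), of "- 1"] \<psi>_mult[of "- 1" r]
        by (intro exI[of _ "(- 1) * r"]) auto
    qed
  qed
  moreover have "k \<union> F \<subseteq> C"
  proof -
    have const: "fls_monom (j a) 0 \<in> C" for a
      using C_monom[of "\<iota> a" 0] filtration_level_0[OF filt] by (simp add: \<psi>\<iota>)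
    have "(1, - 1 / real \<delta>) \<in> I"
      using filtration_level_0[OF filt] by (rule filtration_mono[OF filt]) auto
    then have "?h \<in> C" using C_monom[of 1 "- 1"] by (simp add: \<psi>_one)
    moreover have "fls_monom (j (num g)) \<lfloor>b * \<delta>\<rfloor> \<in> C" if gb: "(g, b) \<in> T" for g b
    proof -
      have "b * \<delta> \<in> \<int>" using \<delta>(2) gb by simp
      then have "real_of_int \<lfloor>b * \<delta>\<rfloor> / \<delta> = b" using \<delta>(1) by (auto elim!: Ints_cases simp: field_simps)
      \<comment> \<open>The numerator is a multiple of \<open>g\<close> in the localized ring, so it
        has the level of \<open>g\<close>.\<close>
      moreover have "(\<iota> (den g) * g, b) \<in> I" using gb TI by (intro filtration_smult[OF filt]) auto
      then have "(\<iota> (num g), b) \<in> I" using nd(2)[of g] by (simp add: mult.commute)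
      ultimately show ?thesis using C_monom[of "\<iota> (num g)" "\<lfloor>b * \<delta>\<rfloor>"] by (simp add: \<psi>\<iota>)
    qed
    ultimately show ?thesis using const by (auto simp: F_def k_def)
  qed
  ultimately have BC: "B \<subseteq> C" unfolding B_def by (rule gen_least)
  have coeff: "\<exists>r. fls_nth x n = \<psi> r \<and> (r, real_of_int n / real \<delta>) \<in> I" if x: "x \<in> A" for x n
  proof -
    from x obtain s where s: "s \<in> S" "fls_monom (j s) 0 * x \<in> B" by (auto simp: A_def loc_def S'_def)
    then have "x * fls_monom (j s) 0 \<in> C" using BC by (auto simp: mult.commute)
    then obtain r where r: "fls_nth (x * fls_monom (j s) 0) n = \<psi> r" "(r, real_of_int n / real \<delta>) \<in> I"
      unfolding C_def by blast
    \<comment> \<open>The denominator is a unit of the localized ring and can be divided out without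
      leaving the level.\<close>
    obtain t where t: "1 = \<iota> s * t" using unit[OF s(1)] by (auto elim: dvdE)
    have "j s * \<psi> t = 1" using \<psi>_mult[of "\<iota> s" t] t by (simp add: \<psi>\<iota> \<psi>_one)
    then have "fls_nth x n = \<psi> (t * r)" using r(1) by (simp add: \<psi>_mult ac_simps flip: r(1))
    then show ?thesis using filtration_smult[OF filt r(2), of t] by blast
  qed

  interpret rees_model I \<psi> \<delta> A
    by (rule rees_model.intro; fact filt \<delta>(1) \<psi>_add \<psi>_mult \<psi>_one \<psi>_inj noeth_A coeff monom_mem)
  show ?thesis
  proof (rule R_saturation_eq_integral_closure)
    fix f \<alpha> assume f: "fls_monom (\<psi> f) 0 \<in> W \<alpha>" "\<alpha> \<notin> \<rat>"
    \<comment> \<open>\<open>W_irrational_gap\<close> concerns elements of \<open>B\<close>, so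
      \<open>f\<close> is replaced by its numerator, which differs from it by a unit of
      \<open>A\<close>.\<close>
    have eq: "fls_monom (j (num f)) 0 = fls_monom (j (den f)) 0 * fls_monom (\<psi> f) 0"
      "fls_monom (\<psi> f) 0 = fls_monom (inverse (j (den f))) 0 * fls_monom (j (num f)) 0"
      using js[OF nd(1)[of f]] by (auto simp: \<psi>_def field_simps)
    have "fls_monom (j (num f)) 0 \<in> W \<alpha>"
      unfolding eq(1) using const_B BA f(1) by (intro W_smult) auto
    moreover have "?h \<in> B" using F_B by (auto simp: F_def)
    ultimately have "\<exists>\<alpha>'>\<alpha>. fls_monom (j (num f)) 0 \<in> W \<alpha>'"
      using W_irrational_gap[OF k fF B_def S'.mult_subset_axioms S'_zero, of ?h "fls_monom (j (num f)) 0" \<alpha>]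
        f(2) const_B unfolding A_def by simp
    then show "\<exists>\<alpha>'>\<alpha>. fls_monom (\<psi> f) 0 \<in> W \<alpha>'"
      unfolding eq(2) using W_smult[OF inv_A[OF nd(1)]] by blast
  qed
qed

end
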